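(* Let $p\equiv 3\pmod 4$ be a prime and $m=\frac{p-1}{2}$. Let $1=a_1<a_2<\dots<a_m\le p-1$ be the quadratic residues modulo $p$ in $\{1,\dots,p-1\}$ in ascending order, and for $1\le k\le m$ let $c_k=\{k\left(\frac{k}{p}\right)\}_p$. Let $\sigma_{4,0}$ be the permutation of $\{a_1,\dots,a_m\}$ with $\sigma_{4,0}(a_k)=c_k$ for $k=1,\dots,m$. Then $$\operatorname{sgn}(\sigma_{4,0})=\begin{cases}(-1)^{\lfloor\frac{p+1}{8}\rfloor}&\text{if } p\equiv3\pmod8,\\ (-1)^{\lfloor\frac{p+1}{8}\rfloor+\frac{h(-p)+1}{2}}&\text{if } p\equiv7\pmod8,\end{cases}$$ where $h(-p)$ is the class number of $\mathbb{Q}(\sqrt{-p})$.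
   Context: $\{a\}_p$ denotes the least nonnegative residue of $a$ modulo $p$; $\left(\frac{\cdot}{p}\right)$ is the Legendre symbol; $\operatorname{sgn}$ denotes the sign of a permutation; $\lfloor\cdot\rfloor$ is the floor function. Since $p\equiv 3\pmod 4$, $-1$ is a non-residue and the numbers $c_1,\dots,c_m$ are exactly the quadratic residues in $\{1,\dots,p-1\}$, each once. *)

theory Defs
  imports
    "HOL-Number_Theory.Number_Theory"
    "HOL-Combinatorics.Permutations"
    "HOL-Computational_Algebra.Polynomial"
    "HOL-Algebra.Ideal"
begin

definition quadratic_field :: "int \<Rightarrow> complex set" where
  "quadratic_field d = {of_rat x + of_rat y * csqrt (of_int d) | x y. True}"

definition ring_of_integers :: "complex set \<Rightarrow> complex ring" where
  "ring_of_integers K =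
     \<lparr>carrier = {z \<in> K. algebraic_int z}, mult = (*), one = 1, zero = 0, add = (+)\<rparr>"

definition nonzero_ideals :: "('a, 'b) ring_scheme \<Rightarrow> 'a set set" where
  "nonzero_ideals R = {I. ideal I R \<and> I \<noteq> {\<zero>\<^bsub>R\<^esub>}}"

text \<open>\<open>I\<close> and \<open>J\<close> are in the same ideal class iff \<open>a I = b J\<close> for some nonzero \<open>a\<close>, \<open>b\<close>.\<close>

definition ideal_class_rel :: "('a, 'b) ring_scheme \<Rightarrow> ('a set \<times> 'a set) set" where
  "ideal_class_rel R =
     {(I, J). I \<in> nonzero_ideals R \<and> J \<in> nonzero_ideals R \<and>
        (\<exists>a \<in> carrier R - {\<zero>\<^bsub>R\<^esub>}. \<exists>b \<in> carrier R - {\<zero>\<^bsub>R\<^esub>}.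
           (\<lambda>x. a \<otimes>\<^bsub>R\<^esub> x) ` I = (\<lambda>x. b \<otimes>\<^bsub>R\<^esub> x) ` J)}"

definition class_number :: "complex set \<Rightarrow> nat" where
  "class_number K =
     (let R = ring_of_integers K in card (nonzero_ideals R // ideal_class_rel R))"

text \<open>The permutation in the theorem exists.\<close>

lemma residue_permutation_exists:
  fixes p m :: nat and a :: "nat \<Rightarrow> int"
  assumes p: "prime p" "p mod 4 = 3" and m: "m = (p - 1) div 2"
    and inj: "strict_mono_on {1..m} a"
    and img: "a ` {1..m} = {x \<in> {1..int p - 1}. QuadRes (int p) x}"
  shows "\<exists>\<sigma>. \<sigma> permutes a ` {1..m} \<and>
    (\<forall>k \<in> {1..m}. \<sigma> (a k) = (int k * Legendre (int k) (int p)) mod int p)"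
proof -
  define c where "c k = (int k * Legendre (int k) (int p)) mod int p" for k :: nat
  have p2: "2 < p" using p by (cases "p = 2") (auto dest: prime_ge_2_nat)
  have pm: "int p = 2 * int m + 1" using p(2) m by presburger
  have odd_m: "odd m" using p(2) m by presburger
  have nd: "\<not> int p dvd int k" if "k \<in> {1..m}" for k
    using that pm by (auto dest: zdvd_imp_le)
  have L: "Legendre (int k) (int p) = 1 \<or> Legendre (int k) (int p) = -1" if "k \<in> {1..m}" for k
    using nd[OF that] by (auto simp: Legendre_def cong_0_iff)
  have inj_a: "inj_on a {1..m}" using inj by (rule strict_mono_on_imp_inj_on)
  have inj_c: "inj_on c {1..m}"
  proof (rule inj_onI)
    fix k l assume kl: "k \<in> {1..m}" "l \<in> {1..m}" "c k = c l"
    then have "int p dvd int k * Legendre (int k) (int p) - int l * Legendre (int l) (int p)"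
      by (simp add: c_def mod_eq_dvd_iff)
    then have "int p dvd int k - int l \<or> int p dvd int k + int l"
      using L[OF kl(1)] L[OF kl(2)]
      by (smt (verit, best) dvd_minus_iff mult_cancel_left1 mult_minus_right)
    moreover have "\<not> int p dvd int k + int l"
      using kl(1,2) pm by (auto dest!: zdvd_imp_le)
    ultimately have "int p dvd int k - int l" by blast
    moreover have "\<bar>int k - int l\<bar> < int p" using kl(1,2) pm by auto
    ultimately show "k = l" using dvd_imp_le_int[of "int k - int l" "int p"] by force
  qed
  have c_img: "c k \<in> a ` {1..m}" if k: "k \<in> {1..m}" for k
  proof -
    have "\<not> int p dvd c k" using nd[OF k] L[OF k] by (auto simp: c_def dvd_mod_iff)
    then have "c k \<noteq> 0" by auto
    moreover have "0 \<le> c k" "c k < int p" using p2 by (auto simp: c_def)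
    moreover have "QuadRes (int p) (c k)"
    proof (rule ccontr)
      assume nq: "\<not> QuadRes (int p) (c k)"
      have pr: "prime p" "2 < p" using p p2 by auto
      have e: "[Legendre x (int p) = x ^ m] (mod int p)" for x
        using euler_criterion[OF pr, of x] m by simp
      have "Legendre (c k) (int p) = -1"
        using nq \<open>\<not> int p dvd c k\<close> by (simp add: Legendre_def cong_0_iff)
      then have 1: "[-1 = c k ^ m] (mod int p)" using e[of "c k"] by simp
      have "[c k ^ m = (int k * Legendre (int k) (int p)) ^ m] (mod int p)"
        by (intro cong_pow) (simp add: c_def)
      then have 2: "[c k ^ m = int k ^ m * Legendre (int k) (int p) ^ m] (mod int p)"
        by (simp add: power_mult_distrib)
      have "Legendre (int k) (int p) ^ m = Legendre (int k) (int p)"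
        using L[OF k] odd_m by auto
      with 2 have 3: "[c k ^ m = int k ^ m * Legendre (int k) (int p)] (mod int p)" by simp
      have "[int k ^ m * Legendre (int k) (int p)
             = Legendre (int k) (int p) * Legendre (int k) (int p)] (mod int p)"
        using e[of "int k"] by (intro cong_mult) (auto simp: cong_sym)
      moreover have "Legendre (int k) (int p) * Legendre (int k) (int p) = 1"
        using L[OF k] by auto
      ultimately have "[-1 = 1] (mod int p)" using 1 3 by (metis cong_trans)
      then have "int p dvd 2" by (simp add: cong_iff_dvd_diff)
      then show False using p2 by (auto dest: zdvd_imp_le)
    qed
    ultimately show ?thesis using img by auto
  qed
  have "c ` {1..m} = a ` {1..m}"
  proof (rule card_subset_eq)
    show "c ` {1..m} \<subseteq> a ` {1..m}" using c_img by blast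
    show "card (c ` {1..m}) = card (a ` {1..m})"
      by (simp only: card_image[OF inj_a] card_image[OF inj_c])
  qed simp
  then have "bij_betw c {1..m} (a ` {1..m})" using inj_c by (simp add: bij_betw_def)
  moreover have "bij_betw (inv_into {1..m} a) (a ` {1..m}) {1..m}"
    using inj_a by (intro bij_betw_inv_into inj_on_imp_bij_betw)
  ultimately have bij: "bij_betw (c \<circ> inv_into {1..m} a) (a ` {1..m}) (a ` {1..m})"
    using bij_betw_trans by blast
  define \<sigma> where "\<sigma> x = (if x \<in> a ` {1..m} then (c \<circ> inv_into {1..m} a) x else x)" for x
  have "bij_betw \<sigma> (a ` {1..m}) (a ` {1..m})"
    using bij by (subst bij_betw_cong[where g = "c \<circ> inv_into {1..m} a"]) (auto simp: \<sigma>_def)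
  then have "\<sigma> permutes a ` {1..m}"
    by (rule bij_imp_permutes) (simp add: \<sigma>_def)
  moreover have "\<sigma> (a k) = c k" if "k \<in> {1..m}" for k
    using that inv_into_f_f[OF inj_a that] by (simp only: \<sigma>_def comp_apply imageI if_True)
  ultimately show ?thesis unfolding c_def by blast
qed

end

theory Submission
  imports Defs "HOL-Analysis.Analysis"
begin

text \<open>
  Counting inversions, \<open>\<sigma>\<close> has sign \<open>(-1) ^ w\<close>, where \<open>w\<close> is the number of even non-residues below \<open>p/2\<close>.
  Splitting sums of Legendre symbols by parity, \<open>w\<close> is determined by \<open>p\<close> if \<open>p \<equiv> 3 (mod 8)\<close>, and by \<open>p\<close> and
  the sum \<open>\<Sum>k<p. k (k/p)\<close> if \<open>p \<equiv> 7 (mod 8)\<close>. In the second case the class number formula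
  \<open>p h(-p) = - (\<Sum>k<p. k (k/p))\<close> finishes the proof.

  The class number formula comes from comparing constant terms. Let \<open>\<Theta>(t)\<close> be the sum over the ideal classes of
  the theta series of the norm forms. Counting ideals by norm gives
  \<open>\<Theta>(t) = h + 2 L(t)\<close> with \<open>L(t) = (\<Sum>d\<ge>1. (d/p) / (exp (d t) - 1))\<close>.
  As \<open>t\<close> tends to \<open>0\<close>, \<open>\<Theta>(t) - 4 \<Theta>(4 t)\<close> tends to \<open>0\<close>, because smooth sums over a lattice coset hardly depend
  on the coset. On the other hand \<open>L(t) - 2 L(2 t) = (\<Sum>d\<ge>1. (d/p) / (exp (d t) + 1))\<close> tends to half the Abel sum
  of \<open>(d/p)\<close>, which is \<open>- (\<Sum>k<p. k (k/p)) / p\<close>. Hence no Gauss sums and no value \<open>L(1)\<close> are needed.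
\<close>

section \<open>Theta series of binary quadratic forms\<close>

text \<open>As t tends to 0, each theta series looks like a multiple of 1/t. Comparing t with 4t
  cancels that part and leaves -3 times the constant term, which has to be 0. Dyadic scaling is used
  because doubling lattice vectors multiplies a form by 4, so the series at 4t is the part of the
  series at t over the even vectors, one of four cosets. The obstacle is that the cosets must agree
  up to an error tending to 0, not merely a bounded one. With t = \<tau>^2 about \<tau>^(-2) lattice
  points matter, and an n-th difference of the Gaussian has size \<tau>^n. Hence third differences:
  they leave O(\<tau>), whereas second differences leave O(1). On the arithmetic side h appears as
  the number of origins, one for each class, and the factor 2 is the number of units, which requires
  p > 3. Ideals are never multiplied or inverted abstractly: the inverse of an ideal is its
  conjugate divided by its norm.\<close>

lemma third_difference_mvt:
  fixes g g1 g2 g3 :: "real \<Rightarrow> real"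
  assumes "\<And>x. (g has_real_derivative g1 x) (at x)"
    and "\<And>x. (g1 has_real_derivative g2 x) (at x)"
    and "\<And>x. (g2 has_real_derivative g3 x) (at x)"
  shows "\<exists>\<xi>. x < \<xi> \<and> \<xi> < x + 3 \<and> g (x + 3) - 3 * g (x + 2) + 3 * g (x + 1) - g x = g3 \<xi>"
proof -
  have d: "((\<lambda>s. f (s + k)) has_real_derivative f' (s + k)) (at s)"
    if "\<And>x. (f has_real_derivative f' x) (at x)" for f f' :: "real \<Rightarrow> real" and k s
    using that[of "s + k"] by (simp add: DERIV_shift)
  \<comment> \<open>Each mean value step removes one difference. The summands \<open>+ 0\<close>
    give every term the shape \<open>g (s + k)\<close>, so that the shifted derivative rule
    \<open>d\<close> covers them all.\<close>
  have "\<exists>z. x < z \<and> z < x + 1 \<and>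
      (g (x + 1 + 2) - 2 * g (x + 1 + 1) + g (x + 1 + 0)) - (g (x + 2) - 2 * g (x + 1) + g (x + 0))
      = (x + 1 - x) * (g1 (z + 2) - 2 * g1 (z + 1) + g1 (z + 0))"
    by (rule MVT2[where f = "\<lambda>s. g (s + 2) - 2 * g (s + 1) + g (s + 0)"])
      (simp, intro DERIV_add DERIV_diff DERIV_cmult d[of g, OF assms(1)])
  then obtain u where u: "x < u" "u < x + 1"
    "g (x + 3) - 3 * g (x + 2) + 3 * g (x + 1) - g x = g1 (u + 2) - 2 * g1 (u + 1) + g1 u"
    by (auto simp: algebra_simps)
  have "\<exists>z. u < z \<and> z < u + 1 \<and>
      (g1 (u + 1 + 1) - g1 (u + 1 + 0)) - (g1 (u + 1) - g1 (u + 0))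
      = (u + 1 - u) * (g2 (z + 1) - g2 (z + 0))"
    by (rule MVT2[where f = "\<lambda>s. g1 (s + 1) - g1 (s + 0)"])
      (simp, intro DERIV_diff d[of g1, OF assms(2)])
  then obtain v where v: "u < v" "v < u + 1"
    "g1 (u + 2) - 2 * g1 (u + 1) + g1 u = g2 (v + 1) - g2 v"
    by (auto simp: algebra_simps)
  have "\<exists>z. v < z \<and> z < v + 1 \<and> g2 (v + 1) - g2 v = (v + 1 - v) * g3 z"
    by (rule MVT2) (auto intro!: assms)
  then obtain w where "v < w" "w < v + 1" "g2 (v + 1) - g2 v = g3 w" by auto
  with u v show ?thesis by (intro exI[of _ w]) auto
qed

text \<open>The constant is determinant over trace of the matrix of the form, which lies below both
  eigenvalues. A sum of two squares takes the place of a diagonalisation.\<close>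

lemma posdef_form_lower_bound:
  fixes a b c :: real
  assumes "a > 0" and "4 * a * c - b\<^sup>2 > 0"
  obtains \<mu> where "\<mu> > 0" and "\<And>x y. a * x\<^sup>2 + b * x * y + c * y\<^sup>2 \<ge> \<mu> * (x\<^sup>2 + y\<^sup>2)"
proof
  have "c > 0"
  proof (rule ccontr)
    assume "\<not> c > 0"
    then have "4 * a * c \<le> 0" using assms(1) by (simp add: mult_nonneg_nonpos)
    then show False using assms(2) by (smt (verit) zero_le_power2)
  qed
  then have s: "a + c > 0" using assms by simp
  show "(4 * a * c - b\<^sup>2) / (4 * (a + c)) > 0" using s assms by simp
  fix x y :: real
  have "4 * (a + c) * (a * x\<^sup>2 + b * x * y + c * y\<^sup>2) - (4 * a * c - b\<^sup>2) * (x\<^sup>2 + y\<^sup>2)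
    = (2 * a * x + b * y)\<^sup>2 + (2 * c * y + b * x)\<^sup>2"
    by (simp add: power2_eq_square algebra_simps)
  then have "(4 * a * c - b\<^sup>2) * (x\<^sup>2 + y\<^sup>2) \<le> 4 * (a + c) * (a * x\<^sup>2 + b * x * y + c * y\<^sup>2)"
    by (smt (verit) zero_le_power2)
  then show "(4 * a * c - b\<^sup>2) / (4 * (a + c)) * (x\<^sup>2 + y\<^sup>2) \<le> a * x\<^sup>2 + b * x * y + c * y\<^sup>2"
    using s by (simp add: divide_simps mult.commute)
qed

text \<open>Since u^2 \<ge> |u| - 1. Trading Gaussians for exponentials of |u| turns the sums over
  the integers into geometric series.\<close>

lemma exp_neg_square_le:
  fixes u :: real
  shows "exp (- (u\<^sup>2)) \<le> exp 1 * exp (- \<bar>u\<bar>)"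
proof -
  have "0 \<le> (\<bar>u\<bar> - 1/2)\<^sup>2" by simp
  then have "\<bar>u\<bar> - 1 \<le> u\<^sup>2" by (simp add: power2_eq_square algebra_simps)
  then show ?thesis by (simp flip: exp_add)
qed

text \<open>The left side is the polynomial factor in the third derivative of a Gaussian, with l the
  rescaled derivative of the form. The exponent on the right is small enough to be paid for by half
  of the Gaussian.\<close>

lemma cubic_le_exp_square:
  fixes l a :: real
  assumes "l \<ge> 0" "a > 0"
  shows "l ^ 3 + 6 * a * l \<le> (1 + 128 * a\<^sup>2 + 6 * a * (1 + 8 * a)) * exp (l\<^sup>2 / (8 * a))"
proof -
  define u where "u = l\<^sup>2 / (8 * a)"
  have u0: "u \<ge> 0" using assms by (simp add: u_def)
  have l2: "l\<^sup>2 = 8 * a * u" using assms by (simp add: u_def)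
  have e1: "exp u \<ge> 1 + u + u\<^sup>2 / 2"
    using exp_lower_Taylor_quadratic[OF u0] by simp
  have l4: "l ^ 4 = 64 * a\<^sup>2 * u\<^sup>2"
  proof -
    have "l ^ 4 = (l\<^sup>2)\<^sup>2" by simp
    then show ?thesis by (simp add: l2 power_mult_distrib)
  qed
  have "l \<le> 1 + l\<^sup>2"
  proof -
    have "0 \<le> (l - 1/2)\<^sup>2" by simp
    then show ?thesis by (simp add: power2_eq_square algebra_simps)
  qed
  moreover have "l ^ 3 \<le> 1 + l ^ 4"
  proof (cases "l \<le> 1")
    case True
    then have "l ^ 3 \<le> 1" using assms by (simp add: power_le_one)
    then show ?thesis by (simp add: add_increasing2)
  next
    case False
    then have "l ^ 3 \<le> l ^ 4" by (intro power_increasing) auto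
    then show ?thesis by simp
  qed
  ultimately have "l ^ 3 + 6 * a * l \<le> 1 + 64 * a\<^sup>2 * u\<^sup>2 + 6 * a * (1 + 8 * a * u)"
    using assms l2 l4 by (intro add_mono mult_left_mono) auto
  also have "\<dots> \<le> exp u + 64 * a\<^sup>2 * (2 * exp u) + 6 * a * (exp u + 8 * a * exp u)"
  proof -
    have "u \<ge> 0" "u\<^sup>2 \<ge> 0" using u0 by auto
    then have "1 \<le> exp u" "u\<^sup>2 \<le> 2 * exp u" "u \<le> exp u" using e1 by linarith+
    then show ?thesis using assms by (intro add_mono mult_left_mono) auto
  qed
  finally show ?thesis by (simp add: u_def algebra_simps)
qed

text \<open>By the mean value theorem the difference is a third derivative, and each x-derivative
  brings out a factor \<tau>. Half of the exponent absorbs the polynomial factor and the other half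
  provides the decay. The constants are uniform in \<tau>, which is what the limit needs.\<close>

lemma gaussian_third_difference_bound:
  fixes a b c :: real
  assumes a: "a > 0" and disc: "4 * a * c - b\<^sup>2 > 0"
  obtains K \<kappa> where "K \<ge> 0" "\<kappa> > 0"
    "\<And>\<tau> x y. 0 < \<tau> \<Longrightarrow> \<tau> \<le> 1 \<Longrightarrow>
       (let g = (\<lambda>x. exp (- (\<tau>\<^sup>2 * (a * x\<^sup>2 + b * x * y + c * y\<^sup>2)))) in
        \<bar>g (x + 3) - 3 * g (x + 2) + 3 * g (x + 1) - g x\<bar>
        \<le> K * \<tau> ^ 3 * (exp (- \<kappa> * \<tau> * \<bar>x\<bar>) * exp (- \<kappa> * \<tau> * \<bar>y\<bar>)))"
proof -
  obtain \<mu> where \<mu>: "\<mu> > 0" "\<And>x y. a * x\<^sup>2 + b * x * y + c * y\<^sup>2 \<ge> \<mu> * (x\<^sup>2 + y\<^sup>2)"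
    using posdef_form_lower_bound[OF assms] by blast
  \<comment> \<open>Half of the exponent is at least \<tau>^2 \<mu> (x^2 + y^2) / 2, that is the sum
    of the squares of \<kappa> \<tau> x and \<kappa> \<tau> y.\<close>
  define \<kappa> where "\<kappa> = sqrt (\<mu> / 2)"
  have \<kappa>: "\<kappa> > 0" "\<kappa>\<^sup>2 = \<mu> / 2" using \<mu> by (auto simp: \<kappa>_def)
  define K0 where "K0 = 1 + 128 * a\<^sup>2 + 6 * a * (1 + 8 * a)"
  have K0: "K0 \<ge> 0" using a by (simp add: K0_def)
  \<comment> \<open>\<open>K0\<close> bounds the polynomial factor, each \<open>exp 1\<close> comes
    from replacing a Gaussian by an exponential, and \<open>exp (3 * \<kappa>)\<close> pays for
    moving the intermediate point back to x.\<close>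
  define K where "K = K0 * (exp 1 * exp (3 * \<kappa>) * exp 1)"
  have "K \<ge> 0" using K0 by (simp add: K_def)
  moreover have "let g = (\<lambda>x. exp (- (\<tau>\<^sup>2 * (a * x\<^sup>2 + b * x * y + c * y\<^sup>2)))) in
        \<bar>g (x + 3) - 3 * g (x + 2) + 3 * g (x + 1) - g x\<bar>
        \<le> K * \<tau> ^ 3 * (exp (- \<kappa> * \<tau> * \<bar>x\<bar>) * exp (- \<kappa> * \<tau> * \<bar>y\<bar>))"
    if t: "0 < \<tau>" "\<tau> \<le> 1" for \<tau> x y
  proof -
    define Q where "Q x = a * x\<^sup>2 + b * x * y + c * y\<^sup>2" for x
    define L where "L x = 2 * a * x + b * y" for x
    define g where "g x = exp (- (\<tau>\<^sup>2 * Q x))" for x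
    have dQ: "(Q has_real_derivative L x) (at x)" for x
      unfolding Q_def L_def by (auto intro!: derivative_eq_intros simp: algebra_simps)
    have dL: "(L has_real_derivative 2 * a) (at x)" for x
      unfolding L_def by (auto intro!: derivative_eq_intros)
    have d1: "(g has_real_derivative - (\<tau>\<^sup>2 * L x) * g x) (at x)" for x
      unfolding g_def by (auto intro!: derivative_eq_intros dQ)
    have d2: "((\<lambda>x. - (\<tau>\<^sup>2 * L x) * g x) has_real_derivative
        (\<tau> ^ 4 * (L x)\<^sup>2 - 2 * a * \<tau>\<^sup>2) * g x) (at x)" for x
      by (auto intro!: derivative_eq_intros dL d1 simp: power2_eq_square power4_eq_xxxx algebra_simps)
    have d3: "((\<lambda>x. (\<tau> ^ 4 * (L x)\<^sup>2 - 2 * a * \<tau>\<^sup>2) * g x) has_real_derivative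
        (6 * a * \<tau> ^ 4 * L x - \<tau> ^ 6 * (L x) ^ 3) * g x) (at x)" for x
      by (auto intro!: derivative_eq_intros dL d1
          simp: power2_eq_square power4_eq_xxxx power3_eq_cube eval_nat_numeral algebra_simps)
    obtain \<xi> where \<xi>: "x < \<xi>" "\<xi> < x + 3"
      "g (x + 3) - 3 * g (x + 2) + 3 * g (x + 1) - g x
        = (6 * a * \<tau> ^ 4 * L \<xi> - \<tau> ^ 6 * (L \<xi>) ^ 3) * g \<xi>"
      using third_difference_mvt[OF d1 d2 d3] by blast
    \<comment> \<open>In terms of l the third derivative is at most \<tau>^3 (l^3 + 6 a l) times the
      Gaussian. Completing the square bounds l^2 by 4 a times the Gaussian exponent.\<close>
    define l where "l = \<tau> * \<bar>L \<xi>\<bar>"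
    have l0: "l \<ge> 0" using t by (simp add: l_def)
    have l2: "l\<^sup>2 / (8 * a) \<le> \<tau>\<^sup>2 * Q \<xi> / 2"
    proof -
      have "4 * a * Q \<xi> = (L \<xi>)\<^sup>2 + (4 * a * c - b\<^sup>2) * y\<^sup>2"
        by (simp add: Q_def L_def power2_eq_square algebra_simps)
      then have "(L \<xi>)\<^sup>2 \<le> 4 * a * Q \<xi>" using disc by simp
      then have "\<tau>\<^sup>2 * (L \<xi>)\<^sup>2 \<le> \<tau>\<^sup>2 * (4 * a * Q \<xi>)" by (intro mult_left_mono) auto
      then show ?thesis using a by (simp add: l_def power_mult_distrib divide_simps) (simp add: ac_simps)
    qed
    have "\<bar>6 * a * \<tau> ^ 4 * L \<xi> - \<tau> ^ 6 * (L \<xi>) ^ 3\<bar> \<le> \<bar>6 * a * \<tau> ^ 4 * L \<xi>\<bar> + \<bar>\<tau> ^ 6 * (L \<xi>) ^ 3\<bar>"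
      by (rule abs_triangle_ineq4)
    also have "\<dots> = \<tau> ^ 3 * (l ^ 3 + 6 * a * l)"
      using a t by (simp add: l_def abs_mult power_abs eval_nat_numeral algebra_simps)
    also have "\<dots> \<le> \<tau> ^ 3 * (K0 * exp (l\<^sup>2 / (8 * a)))"
      using cubic_le_exp_square[OF l0 a] t by (intro mult_left_mono) (auto simp: K0_def)
    also have "\<dots> \<le> \<tau> ^ 3 * (K0 * exp (\<tau>\<^sup>2 * Q \<xi> / 2))"
      using l2 t K0 by (intro mult_left_mono) auto
    finally have "\<bar>(6 * a * \<tau> ^ 4 * L \<xi> - \<tau> ^ 6 * (L \<xi>) ^ 3) * g \<xi>\<bar>
        \<le> \<tau> ^ 3 * (K0 * exp (\<tau>\<^sup>2 * Q \<xi> / 2)) * g \<xi>"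
      by (simp add: abs_mult g_def)
    also have "\<dots> = \<tau> ^ 3 * K0 * (exp (\<tau>\<^sup>2 * Q \<xi> / 2) * exp (- (\<tau>\<^sup>2 * Q \<xi>)))"
      by (simp add: g_def)
    also have "\<dots> = \<tau> ^ 3 * K0 * exp (- (\<tau>\<^sup>2 * Q \<xi>) / 2)"
      by (simp flip: exp_add)
    also have "exp (- (\<tau>\<^sup>2 * Q \<xi>) / 2) \<le> exp (- ((\<kappa> * \<tau> * \<xi>)\<^sup>2)) * exp (- ((\<kappa> * \<tau> * y)\<^sup>2))"
    proof -
      have "\<tau>\<^sup>2 * (\<mu> * (\<xi>\<^sup>2 + y\<^sup>2)) \<le> \<tau>\<^sup>2 * Q \<xi>"
        using \<mu>(2)[of \<xi> y] by (intro mult_left_mono) (auto simp: Q_def)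
      then show ?thesis
        by (simp add: power_mult_distrib \<kappa> algebra_simps flip: exp_add)
    qed
    also have "\<dots> \<le> (exp 1 * exp (- \<bar>\<kappa> * \<tau> * \<xi>\<bar>)) * (exp 1 * exp (- \<bar>\<kappa> * \<tau> * y\<bar>))"
      by (intro mult_mono exp_neg_square_le) auto
    also have "exp (- \<bar>\<kappa> * \<tau> * \<xi>\<bar>) \<le> exp (3 * \<kappa>) * exp (- \<kappa> * \<tau> * \<bar>x\<bar>)"
    proof -
      have "\<bar>x\<bar> \<le> \<bar>\<xi>\<bar> + 3" using \<xi> by auto
      then have "(\<kappa> * \<tau>) * \<bar>x\<bar> \<le> (\<kappa> * \<tau>) * (\<bar>\<xi>\<bar> + 3)" using \<kappa> t by (intro mult_left_mono) auto
      also have "\<dots> = \<kappa> * \<tau> * \<bar>\<xi>\<bar> + 3 * (\<kappa> * \<tau>)" by (simp add: algebra_simps)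
      finally have "(\<kappa> * \<tau>) * \<bar>x\<bar> \<le> \<kappa> * \<tau> * \<bar>\<xi>\<bar> + 3 * (\<kappa> * \<tau>)" .
      moreover have "\<kappa> * \<tau> \<le> \<kappa> * 1" using \<kappa> t by (intro mult_left_mono) auto
      ultimately have "- (\<kappa> * \<tau> * \<bar>\<xi>\<bar>) \<le> 3 * \<kappa> - \<kappa> * \<tau> * \<bar>x\<bar>" by linarith
      then show ?thesis using \<kappa> t by (simp add: abs_mult flip: exp_add)
    qed
    finally have "\<bar>g (x + 3) - 3 * g (x + 2) + 3 * g (x + 1) - g x\<bar>
      \<le> \<tau> ^ 3 * K0 * ((exp 1 * (exp (3 * \<kappa>) * exp (- \<kappa> * \<tau> * \<bar>x\<bar>))) * (exp 1 * exp (- \<bar>\<kappa> * \<tau> * y\<bar>)))"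
      using \<xi>(3) t K0 by (simp add: mult_left_mono mult_right_mono)
    also have "\<dots> = K * \<tau> ^ 3 * (exp (- \<kappa> * \<tau> * \<bar>x\<bar>) * exp (- \<kappa> * \<tau> * \<bar>y\<bar>))"
      using \<kappa> t by (simp add: K_def abs_mult algebra_simps)
    finally show ?thesis by (simp add: g_def Q_def Let_def)
  qed
  ultimately show ?thesis using that \<kappa> by blast
qed

section \<open>Sums over the integer lattice and their alternating versions\<close>

text \<open>Two geometric series with ratio exp (-s). What matters is the explicit bound of order
  1/s, since s will be proportional to \<tau>; it follows from exp s \<ge> 1 + s.\<close>

lemma exp_abs_int_has_sum:
  fixes s :: real
  assumes s: "s > 0"
  obtains S where "((\<lambda>x::int. exp (- s * \<bar>real_of_int x\<bar>)) has_sum S) UNIV" and "0 \<le> S" and "S \<le> 2 * (1 + 1 / s)"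
proof -
  define q where "q = exp (- s)"
  have q: "0 < q" "q < 1" using s by (auto simp: q_def)
  have pow: "exp (- s * real n) = q ^ n" for n
    by (simp add: q_def exp_of_nat_mult[symmetric] mult.commute)
  have g: "((\<lambda>n::nat. q ^ n) has_sum (1 / (1 - q))) UNIV"
    using q geometric_sums[of q] by (intro sums_nonneg_imp_has_sum) auto
  have npow: "q ^ nat x = exp (- (s * real_of_int x))" if "x \<ge> 0" for x :: int
    using pow[of "nat x"] that by simp
  have A: "((\<lambda>x::int. exp (- s * \<bar>real_of_int x\<bar>)) has_sum (1 / (1 - q))) {0..}"
    by (subst has_sum_reindex_bij_witness[where T = UNIV and i = int and j = nat and h = "\<lambda>n. q ^ n"])
      (use g in \<open>auto simp: npow\<close>)
  have "((\<lambda>n::nat. q ^ n * q) has_sum (1 / (1 - q) * q)) UNIV"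
    using g by (rule has_sum_cmult_left)
  then have B: "((\<lambda>x::int. exp (- s * \<bar>real_of_int x\<bar>)) has_sum (1 / (1 - q) * q)) {..<0}"
    by (subst has_sum_reindex_bij_witness[where T = UNIV and i = "\<lambda>n. - int n - 1"
          and j = "\<lambda>x. nat (- x - 1)" and h = "\<lambda>n. q ^ n * q"])
      (auto simp: pow[symmetric], auto simp: q_def algebra_simps simp flip: exp_add)
  have "((\<lambda>x::int. exp (- s * \<bar>real_of_int x\<bar>)) has_sum (1 / (1 - q) + 1 / (1 - q) * q)) ({0..} \<union> {..<0})"
    by (rule has_sum_Un_disjoint[OF A B]) auto
  moreover have "{0::int..} \<union> {..<0} = UNIV" by auto
  moreover have "1 / (1 - q) \<le> 1 + 1 / s"
  proof -
    have "q \<le> 1 / (1 + s)"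
      using exp_ge_add_one_self[of s] s by (simp add: q_def exp_minus divide_simps)
    then have "q * (1 + s) \<le> 1" using s by (simp add: field_simps)
    then have "1 - q \<ge> s / (1 + s)" using s by (simp add: field_simps)
    then have "1 / (1 - q) \<le> 1 / (s / (1 + s))" using s q by (intro divide_left_mono) auto
    also have "\<dots> = 1 + 1 / s" using s by (simp add: field_simps)
    finally show ?thesis .
  qed
  moreover have "1 / (1 - q) * q \<le> 1 / (1 - q) * 1" using q by (intro mult_left_mono) auto
  ultimately show ?thesis using q by (intro that[of "1 / (1 - q) + 1 / (1 - q) * q"]) auto
qed

lemma exp_abs_int_pair_has_sum:
  fixes s :: real
  assumes s: "s > 0"
  obtains S where "((\<lambda>(x::int, y::int). exp (- s * \<bar>real_of_int x\<bar>) * exp (- s * \<bar>real_of_int y\<bar>)) has_sum S) UNIV"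
    and "S \<le> (2 * (1 + 1 / s))\<^sup>2"
proof -
  obtain T where T: "((\<lambda>x::int. exp (- s * \<bar>real_of_int x\<bar>)) has_sum T) UNIV" "0 \<le> T" "T \<le> 2 * (1 + 1 / s)"
    using exp_abs_int_has_sum[OF s] by blast
  define f where "f = (\<lambda>(x::int, y::int). exp (- s * \<bar>real_of_int x\<bar>) * exp (- s * \<bar>real_of_int y\<bar>))"
  have 1: "((\<lambda>y. f (x, y)) has_sum exp (- s * \<bar>real_of_int x\<bar>) * T) UNIV" for x
    unfolding f_def using T(1) by (auto intro: has_sum_cmult_right)
  have 2: "((\<lambda>x::int. exp (- s * \<bar>real_of_int x\<bar>) * T) has_sum T * T) UNIV"
    by (rule has_sum_cmult_left[OF T(1)])
  have "f summable_on UNIV \<times> UNIV"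
    by (rule summable_on_SigmaI[OF 1]) (use 2 in \<open>auto simp: f_def summable_on_def\<close>)
  then have "(f has_sum T * T) (UNIV \<times> UNIV)"
    by (intro has_sum_SigmaI[OF 1 2])
  moreover have "T * T \<le> (2 * (1 + 1 / s))\<^sup>2"
    unfolding power2_eq_square using T by (intro mult_mono) auto
  ultimately show ?thesis using that unfolding f_def by simp
qed

lemma infsum_translation:
  fixes f :: "'a::ab_group_add \<Rightarrow> 'b::{topological_comm_monoid_add, t2_space}"
  shows "infsum (\<lambda>v. f (v + e)) UNIV = infsum f UNIV"
  by (rule infsum_reindex_bij_witness[where i = "\<lambda>v. v - e" and j = "\<lambda>v. v + e"]) auto

lemma summable_on_translation:
  fixes f :: "'a::ab_group_add \<Rightarrow> 'b::{topological_comm_monoid_add, t2_space}"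
  shows "(\<lambda>v. f (v + e)) summable_on UNIV \<longleftrightarrow> f summable_on UNIV"
  by (rule summable_on_reindex_bij_witness[where i = "\<lambda>v. v - e" and j = "\<lambda>v. v + e"]) auto

text \<open>Summation by parts: each difference in the direction \<open>e\<close> multiplies an alternating sum by \<open>-2\<close>.\<close>

lemma alternating_sum_third_difference:
  fixes g \<epsilon> d :: "'a::ab_group_add \<Rightarrow> real"
  assumes g: "g summable_on UNIV" "\<And>v. g v \<ge> 0"
    and eps: "\<And>v. \<epsilon> (v + e) = - \<epsilon> v" "\<And>v. \<bar>\<epsilon> v\<bar> = 1"
    and d: "(d has_sum S) UNIV"
      "\<And>v. \<bar>g (v + e + e + e) - 3 * g (v + e + e) + 3 * g (v + e) - g v\<bar> \<le> d v"
  shows "\<bar>\<Sum>\<^sub>\<infinity>v. \<epsilon> v * g v\<bar> \<le> S / 8"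
proof -
  define f where "f v = \<epsilon> v * g v" for v
  have f: "f summable_on UNIV"
    by (rule abs_summable_summable, rule summable_on_comparison_test[OF g(1)])
      (auto simp: f_def abs_mult eps g)
  define H where "H = infsum f UNIV"
  have H: "(f has_sum H) UNIV" using f by (simp add: H_def)
  have sh: "((\<lambda>v. h (v + e)) has_sum X) UNIV" if "(h has_sum X) UNIV" for h :: "'a \<Rightarrow> real" and X
    using that summable_on_translation[of h e] infsum_translation[of h e] has_sum_iff by metis
  have H1: "((\<lambda>v. \<epsilon> v * g (v + e)) has_sum - H) UNIV"
    using has_sum_cmult_right[OF sh[OF H], of "-1"] by (simp add: f_def eps)
  have H2: "((\<lambda>v. \<epsilon> v * g (v + e + e)) has_sum H) UNIV"
    using sh[OF sh[OF H]] by (simp add: f_def eps)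
  have H3: "((\<lambda>v. \<epsilon> v * g (v + e + e + e)) has_sum - H) UNIV"
    using has_sum_cmult_right[OF sh[OF sh[OF sh[OF H]]], of "-1"] by (simp add: f_def eps)
  have "((\<lambda>v. ((\<epsilon> v * g (v + e + e + e) + (-3) * (\<epsilon> v * g (v + e + e))) + 3 * (\<epsilon> v * g (v + e))) + (-1) * f v)
     has_sum ((- H + (-3) * H) + 3 * (- H)) + (-1) * H) UNIV"
    by (intro has_sum_add has_sum_cmult_right H H1 H2 H3)
  then have "norm (((- H + (-3) * H) + 3 * (- H)) + (-1) * H) \<le> S"
  proof (rule norm_infsum_le[OF _ d(1)])
    fix v
    have "((\<epsilon> v * g (v + e + e + e) + (-3) * (\<epsilon> v * g (v + e + e))) + 3 * (\<epsilon> v * g (v + e))) + (-1) * f v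
      = \<epsilon> v * (g (v + e + e + e) - 3 * g (v + e + e) + 3 * g (v + e) - g v)"
      by (simp add: f_def algebra_simps)
    then show "norm (((\<epsilon> v * g (v + e + e + e) + (-3) * (\<epsilon> v * g (v + e + e))) + 3 * (\<epsilon> v * g (v + e))) + (-1) * f v) \<le> d v"
      using d(2)[of v] by (simp add: abs_mult eps)
  qed
  then have "\<bar>H\<bar> \<le> S / 8" by simp
  then show ?thesis unfolding H_def f_def .
qed

abbreviation gauss2 :: "real \<Rightarrow> real \<Rightarrow> real \<Rightarrow> real \<Rightarrow> int \<times> int \<Rightarrow> real" where
  "gauss2 a b c t \<equiv>
    \<lambda>(x, y). exp (- (t * (a * (of_int x)\<^sup>2 + b * of_int x * of_int y + c * (of_int y)\<^sup>2)))"

definition theta :: "real \<Rightarrow> real \<Rightarrow> real \<Rightarrow> real \<Rightarrow> real" where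
  "theta a b c t = infsum (gauss2 a b c t) UNIV"

lemma theta_summable:
  fixes a b c t :: real
  assumes "a > 0" and "4 * a * c - b\<^sup>2 > 0" and t: "t > 0"
  shows "gauss2 a b c t summable_on UNIV"
proof -
  obtain \<mu> where \<mu>: "\<mu> > 0" "\<And>x y. a * x\<^sup>2 + b * x * y + c * y\<^sup>2 \<ge> \<mu> * (x\<^sup>2 + y\<^sup>2)"
    using posdef_form_lower_bound[OF assms(1,2)] by blast
  define s where "s = sqrt (t * \<mu>)"
  have s: "s > 0" "s\<^sup>2 = t * \<mu>" using \<mu> t by (auto simp: s_def)
  obtain S where "((\<lambda>(x::int, y::int). exp (- s * \<bar>real_of_int x\<bar>) * exp (- s * \<bar>real_of_int y\<bar>)) has_sum S) UNIV"
    using exp_abs_int_pair_has_sum[OF s(1)] by blast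
  then have "(\<lambda>v. (exp 1 * exp 1) * (case v of (x::int, y::int) \<Rightarrow> exp (- s * \<bar>real_of_int x\<bar>) * exp (- s * \<bar>real_of_int y\<bar>))) summable_on UNIV"
    by (intro summable_on_cmult_right) (auto simp: summable_on_def)
  then show ?thesis
  proof (rule summable_on_comparison_test)
    fix v :: "int \<times> int"
    obtain x y where v: "v = (x, y)" by (cases v)
    have "t * (\<mu> * ((of_int x)\<^sup>2 + (of_int y)\<^sup>2)) \<le> t * (a * (of_int x)\<^sup>2 + b * of_int x * of_int y + c * (of_int y)\<^sup>2)"
      using t \<mu>(2)[of "of_int x" "of_int y"] by (intro mult_left_mono) auto
    then have "exp (- (t * (a * (of_int x)\<^sup>2 + b * of_int x * of_int y + c * (of_int y)\<^sup>2)))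
      \<le> exp (- ((s * of_int x)\<^sup>2)) * exp (- ((s * of_int y)\<^sup>2))"
      by (simp add: power_mult_distrib s algebra_simps flip: exp_add)
    also have "\<dots> \<le> (exp 1 * exp (- \<bar>s * of_int x\<bar>)) * (exp 1 * exp (- \<bar>s * of_int y\<bar>))"
      by (intro mult_mono exp_neg_square_le) auto
    finally show "gauss2 a b c t v
      \<le> (exp 1 * exp 1) * (case v of (x::int, y::int) \<Rightarrow> exp (- s * \<bar>real_of_int x\<bar>) * exp (- s * \<bar>real_of_int y\<bar>))"
      using s by (simp add: v abs_mult mult_ac)
  qed auto
qed

text \<open>A third difference of size \<tau>^3 against a lattice sum of size \<tau>^(-2) leaves
  \<open>B\<close> of order \<tau>. The same \<open>B\<close> serves every sign pattern that flips
  under the shift by (1, 0).\<close>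

lemma alternating_theta_bound:
  fixes a b c :: real
  assumes a: "a > 0" and disc: "4 * a * c - b\<^sup>2 > 0"
  obtains B where "(B \<longlongrightarrow> 0) (at_right 0)" and
    "\<And>\<tau> \<epsilon>. 0 < \<tau> \<Longrightarrow> \<tau> \<le> 1 \<Longrightarrow> (\<And>v. \<epsilon> (v + (1, 0)) = - \<epsilon> v) \<Longrightarrow> (\<And>v. \<bar>\<epsilon> v\<bar> = 1) \<Longrightarrow>
      \<bar>\<Sum>\<^sub>\<infinity>v. \<epsilon> v * gauss2 a b c (\<tau>\<^sup>2) v\<bar>
        \<le> B (\<tau> :: real)"
proof -
  obtain K \<kappa> where K: "K \<ge> 0" "\<kappa> > 0"
    "\<And>\<tau> x y. 0 < \<tau> \<Longrightarrow> \<tau> \<le> 1 \<Longrightarrow>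
       (let g = (\<lambda>x. exp (- (\<tau>\<^sup>2 * (a * x\<^sup>2 + b * x * y + c * y\<^sup>2)))) in
        \<bar>g (x + 3) - 3 * g (x + 2) + 3 * g (x + 1) - g x\<bar>
        \<le> K * \<tau> ^ 3 * (exp (- \<kappa> * \<tau> * \<bar>x\<bar>) * exp (- \<kappa> * \<tau> * \<bar>y\<bar>)))"
    using gaussian_third_difference_bound[OF assms] by blast
  define B where "B \<tau> = K * \<tau> ^ 3 * (2 * (1 + 1 / (\<kappa> * \<tau>)))\<^sup>2 / 8" for \<tau> :: real
  have "eventually (\<lambda>\<tau>. K * \<tau> * (2 * (\<tau> + 1 / \<kappa>))\<^sup>2 / 8 = B \<tau>) (at_right 0)"
    using eventually_at_right_less[of "0::real"]
  proof eventually_elim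
    case (elim \<tau>)
    then show ?case using K(2)
      by (simp add: B_def power2_eq_square power3_eq_cube divide_simps) (simp add: algebra_simps)
  qed
  moreover have "((\<lambda>\<tau>. K * \<tau> * (2 * (\<tau> + 1 / \<kappa>))\<^sup>2 / 8) \<longlongrightarrow> K * 0 * (2 * (0 + 1 / \<kappa>))\<^sup>2 / 8) (at_right 0)"
    by (intro tendsto_intros) simp
  ultimately have "(B \<longlongrightarrow> 0) (at_right 0)"
    using Lim_transform_eventually by fastforce
  moreover have "\<bar>\<Sum>\<^sub>\<infinity>v. \<epsilon> v * gauss2 a b c (\<tau>\<^sup>2) v\<bar>
        \<le> B \<tau>"
    if t: "0 < \<tau>" "\<tau> \<le> 1" and eps: "\<And>v. \<epsilon> (v + (1, 0)) = - \<epsilon> v" "\<And>v. \<bar>\<epsilon> v\<bar> = 1" for \<tau> \<epsilon>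
  proof -
    define g where "g = gauss2 a b c (\<tau>\<^sup>2)"
    define d where "d = (\<lambda>(x::int, y::int). exp (- (\<kappa> * \<tau>) * \<bar>real_of_int x\<bar>) * exp (- (\<kappa> * \<tau>) * \<bar>real_of_int y\<bar>))"
    obtain S where S: "(d has_sum S) UNIV" "S \<le> (2 * (1 + 1 / (\<kappa> * \<tau>)))\<^sup>2"
      using exp_abs_int_pair_has_sum[of "\<kappa> * \<tau>"] K t unfolding d_def by auto
    have "\<bar>\<Sum>\<^sub>\<infinity>v. \<epsilon> v * g v\<bar> \<le> (K * \<tau> ^ 3 * S) / 8"
    proof (rule alternating_sum_third_difference[where d = "\<lambda>v. K * \<tau> ^ 3 * d v"])
      show "g summable_on UNIV"
        unfolding g_def using theta_summable[OF assms, of "\<tau>\<^sup>2"] t by simp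
      show "((\<lambda>v. K * \<tau> ^ 3 * d v) has_sum K * \<tau> ^ 3 * S) UNIV"
        by (rule has_sum_cmult_right[OF S(1)])
      fix v :: "int \<times> int"
      obtain x y where v: "v = (x, y)" by (cases v)
      show "\<bar>g (v + (1, 0) + (1, 0) + (1, 0)) - 3 * g (v + (1, 0) + (1, 0)) + 3 * g (v + (1, 0)) - g v\<bar>
        \<le> K * \<tau> ^ 3 * d v"
        using K(3)[OF t, where x = "of_int x" and y = "of_int y"]
        by (simp add: v g_def d_def Let_def add.assoc)
    qed (auto simp: g_def eps split: prod.split)
    also have "\<dots> \<le> B \<tau>"
      unfolding B_def using K t S(2) by (intro divide_right_mono mult_left_mono) auto
    finally show ?thesis by (simp add: g_def)
  qed
  ultimately show ?thesis using that by blast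
qed

text \<open>A positive definite theta series behaves like a multiple of \<open>1/t\<close> at \<open>0\<close>, with no constant term.\<close>

lemma theta_scaling_limit:
  fixes a b c :: real
  assumes a: "a > 0" and disc: "4 * a * c - b\<^sup>2 > 0"
  shows "((\<lambda>t. theta a b c t - 4 * theta a b c (4 * t)) \<longlongrightarrow> 0) (at_right 0)"
proof -
  have c: "c > 0"
  proof (rule ccontr)
    assume "\<not> c > 0"
    then have "4 * a * c \<le> 0" using a by (simp add: mult_nonneg_nonpos)
    then show False using disc by (smt (verit) zero_le_power2)
  qed
  have disc': "4 * c * a - b\<^sup>2 > 0" using disc by (simp add: mult_ac)
  define g where "g \<tau> = gauss2 a b c (\<tau>\<^sup>2)" for \<tau> :: real
  obtain B where B: "(B \<longlongrightarrow> 0) (at_right 0)"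
    "\<And>\<tau> \<epsilon>. 0 < \<tau> \<Longrightarrow> \<tau> \<le> 1 \<Longrightarrow> (\<And>v. \<epsilon> (v + (1, 0)) = - \<epsilon> v) \<Longrightarrow> (\<And>v. \<bar>\<epsilon> v\<bar> = 1) \<Longrightarrow>
      \<bar>\<Sum>\<^sub>\<infinity>v. \<epsilon> v * g \<tau> v\<bar> \<le> B (\<tau> :: real)"
    using alternating_theta_bound[OF a disc] unfolding g_def by blast
  obtain B' where B': "(B' \<longlongrightarrow> 0) (at_right 0)"
    "\<And>\<tau> \<epsilon>. 0 < \<tau> \<Longrightarrow> \<tau> \<le> 1 \<Longrightarrow> (\<And>v. \<epsilon> (v + (1, 0)) = - \<epsilon> v) \<Longrightarrow> (\<And>v. \<bar>\<epsilon> v\<bar> = 1) \<Longrightarrow>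
      \<bar>\<Sum>\<^sub>\<infinity>v. \<epsilon> v * gauss2 c b a (\<tau>\<^sup>2) v\<bar>
        \<le> B' (\<tau> :: real)"
    using alternating_theta_bound[OF c disc'] by blast
  \<comment> \<open>These are the nontrivial characters of the lattice modulo 2: together with the
    constant 1 they add up to 4 on even vectors and to 0 elsewhere. Thus four times the series at 4t
    is the series at t plus three alternating sums. Only \<open>\<epsilon>2\<close> does not flip
    under (1, 0); it is treated by exchanging the coordinates, which exchanges a and c.\<close>
  define \<epsilon>1 \<epsilon>2 \<epsilon>3 :: "int \<times> int \<Rightarrow> real" where
    "\<epsilon>1 = (\<lambda>(x, y). if even x then 1 else -1)" and
    "\<epsilon>2 = (\<lambda>(x, y). if even y then 1 else -1)" and
    "\<epsilon>3 = (\<lambda>(x, y). if even (x + y) then 1 else -1)"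
  have main: "\<bar>theta a b c (\<tau>\<^sup>2) - 4 * theta a b c (4 * \<tau>\<^sup>2)\<bar> \<le> 2 * B \<tau> + B' \<tau>" if t: "0 < \<tau>" "\<tau> \<le> 1" for \<tau>
  proof -
    have gs: "g \<tau> summable_on UNIV"
      unfolding g_def using theta_summable[OF assms, of "\<tau>\<^sup>2"] t by simp
    have es: "(\<lambda>v. \<epsilon> v * g \<tau> v) summable_on UNIV" if "\<And>v. \<bar>\<epsilon> v\<bar> = 1" for \<epsilon>
      by (rule abs_summable_summable, rule summable_on_comparison_test[OF gs])
        (auto simp: abs_mult that, auto simp: g_def)
    have e1: "\<bar>\<Sum>\<^sub>\<infinity>v. \<epsilon>1 v * g \<tau> v\<bar> \<le> B \<tau>" by (rule B(2)[OF t]) (auto simp: \<epsilon>1_def)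
    have e3: "\<bar>\<Sum>\<^sub>\<infinity>v. \<epsilon>3 v * g \<tau> v\<bar> \<le> B \<tau>" by (rule B(2)[OF t]) (auto simp: \<epsilon>3_def)
    have "(\<Sum>\<^sub>\<infinity>v. \<epsilon>2 v * g \<tau> v) = (\<Sum>\<^sub>\<infinity>v. \<epsilon>1 v * gauss2 c b a (\<tau>\<^sup>2) v)"
      by (rule infsum_reindex_bij_witness[where i = prod.swap and j = prod.swap])
        (auto simp: \<epsilon>1_def \<epsilon>2_def g_def algebra_simps)
    also have "\<bar>\<dots>\<bar> \<le> B' \<tau>" by (rule B'(2)[OF t]) (auto simp: \<epsilon>1_def)
    finally have e2: "\<bar>\<Sum>\<^sub>\<infinity>v. \<epsilon>2 v * g \<tau> v\<bar> \<le> B' \<tau>" .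
    have th: "theta a b c (\<tau>\<^sup>2) = infsum (g \<tau>) UNIV" by (simp add: theta_def g_def)
    define Ev where "Ev = {(x::int, y::int). even x \<and> even y}"
    have "theta a b c (4 * \<tau>\<^sup>2) = infsum (g \<tau>) Ev"
      unfolding theta_def
      by (rule infsum_reindex_bij_witness[where i = "\<lambda>(x, y). (x div 2, y div 2)" and j = "\<lambda>(x, y). (2 * x, 2 * y)"])
        (auto simp: Ev_def g_def power2_eq_square algebra_simps)
    also have "\<dots> = (\<Sum>\<^sub>\<infinity>v. (if v \<in> Ev then g \<tau> v else 0))"
      by (rule infsum_cong_neutral) auto
    finally have "4 * theta a b c (4 * \<tau>\<^sup>2) = (\<Sum>\<^sub>\<infinity>v. 4 * (if v \<in> Ev then g \<tau> v else 0))"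
      by (simp add: infsum_cmult_right')
    also have "\<dots> = (\<Sum>\<^sub>\<infinity>v. g \<tau> v + (\<epsilon>1 v * g \<tau> v + (\<epsilon>2 v * g \<tau> v + \<epsilon>3 v * g \<tau> v)))"
      by (rule infsum_cong) (auto simp: Ev_def \<epsilon>1_def \<epsilon>2_def \<epsilon>3_def split: if_splits)
    also have "\<dots> = theta a b c (\<tau>\<^sup>2) + ((\<Sum>\<^sub>\<infinity>v. \<epsilon>1 v * g \<tau> v) + ((\<Sum>\<^sub>\<infinity>v. \<epsilon>2 v * g \<tau> v) + (\<Sum>\<^sub>\<infinity>v. \<epsilon>3 v * g \<tau> v)))"
      unfolding th
      by (subst infsum_add infsum_add, (intro summable_on_add gs es; force simp: \<epsilon>1_def \<epsilon>2_def \<epsilon>3_def)+)+ simp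
    finally show ?thesis using e1 e2 e3 by linarith
  qed
  have F: "filterlim sqrt (at_right 0) (at_right 0)"
    unfolding filterlim_at
    by (auto simp: eventually_at_filter intro!: tendsto_eq_intros)
  have "((\<lambda>t. 2 * B (sqrt t) + B' (sqrt t)) \<longlongrightarrow> 2 * 0 + 0) (at_right 0)"
    by (intro tendsto_intros filterlim_compose[OF B(1) F] filterlim_compose[OF B'(1) F])
  then have L: "((\<lambda>t. 2 * B (sqrt t) + B' (sqrt t)) \<longlongrightarrow> 0) (at_right 0)" by simp
  have "eventually (\<lambda>t::real. 0 < t \<and> t < 1) (at_right 0)"
    by (auto simp: eventually_at_right[of 0 1] intro: exI[of _ 1])
  then have "eventually (\<lambda>t. norm (theta a b c t - 4 * theta a b c (4 * t)) \<le> 2 * B (sqrt t) + B' (sqrt t)) (at_right 0)"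
  proof eventually_elim
    case (elim t)
    then show ?case using main[of "sqrt t"] by simp
  qed
  then show ?thesis by (rule Lim_null_comparison[OF _ L])
qed

section \<open>A Lambert series of a periodic function\<close>

text \<open>A convex decreasing function loses at least the fraction \<theta> of its drop on the
  initial \<theta>-part of an interval, and at most that fraction on the final \<theta>-part.
  Comparing with intervals of length h that start at j h, respectively end at (j + 1) h + \<theta>
  h, bounds the sum by telescoping series from both sides. The second comparison misses the term j =
  0, hence the extra difference in the upper bound.\<close>

lemma convex_shifted_difference_sums:
  fixes f :: "real \<Rightarrow> real" and h \<theta> :: real
  assumes conv: "convex_on {0..} f" and mono: "\<And>x y. 0 \<le> x \<Longrightarrow> x \<le> y \<Longrightarrow> f y \<le> f x"
    and lim: "(f \<longlongrightarrow> 0) at_top" and h: "h > 0" and l: "0 \<le> \<theta>" "\<theta> \<le> 1"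
  defines "u \<equiv> \<lambda>j::nat. f (j * h) - f (j * h + \<theta> * h)"
  shows "summable u" "\<theta> * f 0 \<le> suminf u" "suminf u \<le> f 0 - f (\<theta> * h) + \<theta> * f (\<theta> * h)"
proof -
  have cv: "f ((1 - s) * x + s * y) \<le> (1 - s) * f x + s * f y" if "0 \<le> s" "s \<le> 1" "0 \<le> x" "0 \<le> y" for s x y
    using convex_onD[OF conv, of s x y] that by simp
  have tel: "(\<lambda>j::nat. f (j * h + s) - f (Suc j * h + s)) sums f s" if "s \<ge> 0" for s
  proof -
    have "filterlim (\<lambda>j::nat. s + h * real j) at_top sequentially"
      by (intro filterlim_tendsto_add_at_top[OF tendsto_const]
          filterlim_tendsto_pos_mult_at_top[OF tendsto_const h] filterlim_real_sequentially)
    then have "filterlim (\<lambda>j::nat. real j * h + s) at_top sequentially"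
      by (simp add: ac_simps)
    then have "(\<lambda>j::nat. f (j * h + s)) \<longlonglongrightarrow> 0" by (rule filterlim_compose[OF lim])
    from telescope_sums'[OF this] show ?thesis by simp
  qed
  have low: "\<theta> * (f (j * h) - f (Suc j * h)) \<le> u j" for j
  proof -
    have "f ((1 - \<theta>) * (j * h) + \<theta> * (Suc j * h)) \<le> (1 - \<theta>) * f (j * h) + \<theta> * f (Suc j * h)"
      by (rule cv) (use l h in auto)
    moreover have "(1 - \<theta>) * (j * h) + \<theta> * (Suc j * h) = j * h + \<theta> * h" by (simp add: algebra_simps)
    ultimately show ?thesis by (simp add: u_def algebra_simps)
  qed
  have up: "u (Suc j) \<le> \<theta> * (f (j * h + \<theta> * h) - f (Suc j * h + \<theta> * h))" for j
  proof -
    have "f ((1 - (1 - \<theta>)) * (j * h + \<theta> * h) + (1 - \<theta>) * (Suc j * h + \<theta> * h))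
      \<le> (1 - (1 - \<theta>)) * f (j * h + \<theta> * h) + (1 - \<theta>) * f (Suc j * h + \<theta> * h)"
      by (rule cv) (use l h in auto)
    moreover have "(1 - (1 - \<theta>)) * (j * h + \<theta> * h) + (1 - \<theta>) * (Suc j * h + \<theta> * h) = Suc j * h"
      by (simp add: algebra_simps)
    ultimately show ?thesis by (simp add: u_def algebra_simps)
  qed
  have upsums: "(\<lambda>j::nat. \<theta> * (f (j * h + \<theta> * h) - f (Suc j * h + \<theta> * h))) sums (\<theta> * f (\<theta> * h))"
    by (rule sums_mult[OF tel]) (use l h in simp)
  have u0: "u j \<ge> 0" for j unfolding u_def using mono[of "j * h" "j * h + \<theta> * h"] l h by simp
  have sS: "summable (\<lambda>j. u (Suc j))"
  proof (rule summable_comparison_test'[OF sums_summable[OF upsums], of 0])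
    fix j show "norm (u (Suc j)) \<le> \<theta> * (f (j * h + \<theta> * h) - f (Suc j * h + \<theta> * h))"
      using up[of j] u0[of "Suc j"] by simp
  qed
  then show su: "summable u" by (simp only: summable_Suc_iff)
  have lowsums: "(\<lambda>j::nat. \<theta> * (f (j * h) - f (Suc j * h))) sums (\<theta> * f 0)"
    using sums_mult[OF tel[of 0], of \<theta>] by simp
  show "\<theta> * f 0 \<le> suminf u"
    unfolding sums_unique[OF lowsums] by (rule suminf_le[OF low sums_summable[OF lowsums] su])
  have "(\<Sum>j. u (Suc j)) \<le> \<theta> * f (\<theta> * h)"
    unfolding sums_unique[OF upsums] by (rule suminf_le[OF up sS sums_summable[OF upsums]])
  moreover have "suminf u = u 0 + (\<Sum>j. u (Suc j))" using suminf_split_head[OF su] by simp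
  ultimately show "suminf u \<le> f 0 - f (\<theta> * h) + \<theta> * f (\<theta> * h)" by (simp add: u_def)
qed

text \<open>The limit is the Abel mean of the divergent series \<open>\<psi> 0 + \<psi> 1 + \<dots>\<close>, scaled by \<open>f 0\<close>.\<close>

lemma periodic_convex_sum_limit:
  fixes f :: "real \<Rightarrow> real" and \<psi> :: "nat \<Rightarrow> real"
  assumes conv: "convex_on {0..} f" and mono: "\<And>x y. 0 \<le> x \<Longrightarrow> x \<le> y \<Longrightarrow> f y \<le> f x"
    and lim: "(f \<longlongrightarrow> 0) at_top" and cont: "isCont f 0"
    and per: "\<And>n. \<psi> (n + p) = \<psi> n" and p: "p > 0" and zero: "(\<Sum>k<p. \<psi> k) = 0"
    and sm: "\<And>t::real. t > 0 \<Longrightarrow> summable (\<lambda>d. \<psi> d * f (d * t))"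
  shows "((\<lambda>t::real. \<Sum>d. \<psi> d * f (d * t)) \<longlongrightarrow> - (\<Sum>k<p. k * \<psi> k) / p * f 0) (at_right 0)"
proof -
  \<comment> \<open>Since \<psi> sums to 0 over a period, the value of f at the start of each period
    may be subtracted from all values in it. \<open>D k\<close> collects the resulting drops for the
    residue k, with \<theta> = k/p and h = p t, and is squeezed to k/p times
    \<open>f 0\<close>.\<close>
  define D where "D k t = (\<Sum>j. f (real j * (p * t)) - f (real j * (p * t) + real k / p * (p * t)))" for k :: nat and t :: real
  have Dlim: "(D k \<longlongrightarrow> k / p * f 0) (at_right 0)" if k: "k < p" for k
  proof (rule tendsto_sandwich)
    have l: "0 \<le> real k / p" "real k / p \<le> 1" using k by auto
    note C = convex_shifted_difference_sums[OF conv mono lim _ l]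
    have pos: "eventually (\<lambda>t::real. t > 0) (at_right 0)" by (rule eventually_at_right_less)
    then show "eventually (\<lambda>t::real. real k / p * f 0 \<le> D k t) (at_right 0)"
      by (rule eventually_mono) (unfold D_def, rule C(2), use p in auto)
    from pos show "eventually (\<lambda>t::real. D k t \<le> f 0 - f (real k / p * (p * t)) + real k / p * f (real k / p * (p * t))) (at_right 0)"
      by (rule eventually_mono) (unfold D_def, rule C(3), use p in auto)
    have "((\<lambda>t::real. real k / p * (p * t)) \<longlongrightarrow> real k / p * (real p * 0)) (at_right 0)"
      by (intro tendsto_intros)
    then have "((\<lambda>t::real. f (real k / p * (p * t))) \<longlongrightarrow> f 0) (at_right 0)"
      using cont by (auto intro: isCont_tendsto_compose)
    then have "((\<lambda>t::real. f 0 - f (real k / p * (p * t)) + real k / p * f (real k / p * (p * t)))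
      \<longlongrightarrow> f 0 - f 0 + real k / p * f 0) (at_right 0)"
      by (intro tendsto_intros)
    then show "((\<lambda>t::real. f 0 - f (real k / p * (p * t)) + real k / p * f (real k / p * (p * t)))
      \<longlongrightarrow> real k / p * f 0) (at_right 0)" by simp
  qed simp
  have "((\<lambda>t::real. \<Sum>k<p. - \<psi> k * D k t) \<longlongrightarrow> (\<Sum>k<p. - \<psi> k * (k / p * f 0))) (at_right 0)"
    by (intro tendsto_sum tendsto_mult tendsto_const Dlim) auto
  moreover have "(\<Sum>k<p. - \<psi> k * (k / p * f 0)) = - (\<Sum>k<p. k * \<psi> k) / p * f 0"
    by (simp add: sum_distrib_left sum_distrib_right sum_divide_distrib sum_negf mult_ac)
  moreover have "eventually (\<lambda>t::real. (\<Sum>k<p. - \<psi> k * D k t) = (\<Sum>d. \<psi> d * f (d * t))) (at_right 0)"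
    using eventually_at_right_less[of "0::real"]
  proof eventually_elim
    case (elim t)
    have per': "\<psi> (k + j * p) = \<psi> k" for k j
    proof (induction j)
      case (Suc j)
      have "k + Suc j * p = (k + j * p) + p" by simp
      then show ?case using per[of "k + j * p"] Suc by (simp only:)
    qed simp
    have "(\<lambda>j. \<Sum>d\<in>{j * p..<j * p + p}. \<psi> d * f (d * t)) sums (\<Sum>d. \<psi> d * f (d * t))"
      by (rule sums_group[OF summable_sums[OF sm[OF elim]] p])
    moreover have "(\<Sum>d\<in>{j * p..<j * p + p}. \<psi> d * f (d * t))
       = (\<Sum>k<p. - \<psi> k * (f (real j * (p * t)) - f (real j * (p * t) + real k / p * (p * t))))" for j
    proof -
      have "(\<Sum>d\<in>{j * p..<j * p + p}. \<psi> d * f (d * t)) = (\<Sum>k<p. \<psi> (k + j * p) * f (real (k + j * p) * t))"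
        using sum.shift_bounds_nat_ivl[of "\<lambda>d. \<psi> d * f (d * t)" 0 "j * p" p]
        by (simp add: add.commute lessThan_atLeast0)
      also have "\<dots> = (\<Sum>k<p. \<psi> k * f (real j * (p * t) + real k / p * (p * t)))"
        using p by (intro sum.cong) (auto simp: per' algebra_simps)
      also have "\<dots> = (\<Sum>k<p. \<psi> k * f (real j * (p * t) + real k / p * (p * t))) - (\<Sum>k<p. \<psi> k) * f (real j * (p * t))"
        by (simp add: zero)
      also have "\<dots> = (\<Sum>k<p. \<psi> k * f (real j * (p * t) + real k / p * (p * t)) - \<psi> k * f (real j * (p * t)))"
        by (simp only: sum_subtractf sum_distrib_right)
      also have "\<dots> = (\<Sum>k<p. - \<psi> k * (f (real j * (p * t)) - f (real j * (p * t) + real k / p * (p * t))))"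
        by (intro sum.cong) (simp_all add: right_diff_distrib)
      finally show ?thesis .
    qed
    moreover have "(\<lambda>j. \<Sum>k<p. - \<psi> k * (f (real j * (p * t)) - f (real j * (p * t) + real k / p * (p * t))))
       sums (\<Sum>k<p. - \<psi> k * D k t)"
    proof (intro sums_sum sums_mult)
      fix k assume "k \<in> {..<p}"
      then have l: "0 \<le> real k / p" "real k / p \<le> 1" by auto
      show "(\<lambda>j. f (real j * (p * t)) - f (real j * (p * t) + real k / p * (p * t))) sums D k t"
        unfolding D_def
        by (rule summable_sums, rule convex_shifted_difference_sums(1)[OF conv mono lim _ l]) (use p elim in auto)
    qed
    ultimately show ?case using sums_unique2 by auto
  qed
  ultimately show ?thesis using Lim_transform_eventually by fastforce
qed

lemma fermi_function_convex: "convex_on {0..} (\<lambda>x::real. 1 / (exp x + 1))"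
proof (rule convex_on_realI[where f' = "\<lambda>x. - exp x / (exp x + 1)\<^sup>2"])
  fix x :: real
  show "((\<lambda>x. 1 / (exp x + 1)) has_real_derivative - exp x / (exp x + 1)\<^sup>2) (at x)"
  proof -
    have "exp x + 1 \<noteq> 0" using exp_gt_zero[of x] by linarith
    then show ?thesis by (auto intro!: derivative_eq_intros simp: power2_eq_square)
  qed
next
  fix x y :: real
  assume xy: "x \<in> {0..}" "y \<in> {0..}" "x \<le> y"
  define u v where "u = exp x" and "v = exp y"
  have uv: "1 \<le> u" "u \<le> v" using xy by (auto simp: u_def v_def)
  \<comment> \<open>This product is u (v + 1)^2 - v (u + 1)^2, so its sign gives the monotonicity of
    the derivative.\<close>
  have "(v - u) * (u * v - 1) \<ge> 0" using uv mult_mono[of 1 u 1 v] by (intro mult_nonneg_nonneg) auto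
  then have "v * (u + 1)\<^sup>2 \<le> u * (v + 1)\<^sup>2" by (simp add: power2_eq_square algebra_simps)
  then have "v / (v + 1)\<^sup>2 \<le> u / (u + 1)\<^sup>2" using uv by (simp add: divide_simps)
  then show "- exp x / (exp x + 1)\<^sup>2 \<le> - exp y / (exp y + 1)\<^sup>2" by (simp add: u_def v_def)
qed (auto simp: is_interval_connected)

text \<open>Both series are the absolutely convergent double series of \<psi>(d) z^(d k) with z =
  exp (-t), grouped by n = d k or by d.\<close>

lemma lambert_series_has_sum:
  fixes \<psi> :: "nat \<Rightarrow> real" and t :: real
  assumes chi: "\<And>n. \<bar>\<psi> n\<bar> \<le> 1" and t: "t > 0"
  obtains A where "((\<lambda>n. (\<Sum>d | d dvd n. \<psi> d) * exp (- t * real n)) has_sum A) {1..}"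
    and "((\<lambda>d. \<psi> d * (exp (- t * real d) / (1 - exp (- t * real d)))) has_sum A) {1..}"
proof -
  define z where "z = exp (- t)"
  have z: "0 < z" "z < 1" using t by (auto simp: z_def)
  have pow: "exp (- t * real n) = z ^ n" for n
    by (simp add: z_def exp_of_nat_mult[symmetric] mult.commute)
  have geo: "((\<lambda>k. w ^ k) has_sum (w / (1 - w))) {1..}" if "0 < w" "w < 1" for w :: real
    using has_sum_geometric_from_1[of w] that by auto
  define F where "F = (\<lambda>(d::nat, k::nat). \<psi> d * z ^ (d * k))"
  have inner: "((\<lambda>k. z ^ (d * k)) has_sum (z ^ d / (1 - z ^ d))) {1..}" if "d \<in> {1..}" for d
    using geo[of "z ^ d"] z power_strict_decreasing[of 0 d z] that by (simp add: power_mult)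
  have "(\<lambda>(d, k). z ^ (d * k)) summable_on {1..} \<times> {1..}"
  proof (rule summable_on_SigmaI)
    show "((\<lambda>k. case (d, k) of (d, k) \<Rightarrow> z ^ (d * k)) has_sum (z ^ d / (1 - z ^ d))) {1..}" if "d \<in> {1..}" for d
      using inner[OF that] by simp
    have "(\<lambda>d. z ^ d * (1 / (1 - z))) summable_on {1..}"
      using geo[OF z] by (intro summable_on_cmult_left) (auto simp: summable_on_def)
    then show "(\<lambda>d. z ^ d / (1 - z ^ d)) summable_on {1..}"
    proof (rule summable_on_comparison_test)
      fix d :: nat assume d: "d \<in> {1..}"
      have zd: "z ^ d \<le> z ^ 1" using z d by (intro power_decreasing) auto
      then show "z ^ d / (1 - z ^ d) \<le> z ^ d * (1 / (1 - z))"
        using z by (auto intro!: divide_left_mono mult_pos_pos)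
      show "0 \<le> z ^ d / (1 - z ^ d)" using z zd by auto
    qed
  qed (use z in auto)
  then have "(\<lambda>x. norm (F x)) summable_on {1..} \<times> {1..}"
    by (rule summable_on_comparison_test)
      (use z chi in \<open>auto simp: F_def abs_mult intro!: mult_left_le_one_le\<close>)
  then have Fs: "F summable_on {1..} \<times> {1..}" by (rule abs_summable_summable)
  define A where "A = infsum F ({1..} \<times> {1..})"
  have FA: "(F has_sum A) ({1..} \<times> {1..})" using Fs by (simp add: A_def)
  have 1: "((\<lambda>d. \<psi> d * (z ^ d / (1 - z ^ d))) has_sum A) {1..}"
    by (rule has_sum_SigmaD[OF FA]) (unfold F_def prod.case, intro has_sum_cmult_right inner)
  have dv: "1 \<le> d" "1 \<le> n div d" if "d dvd n" "1 \<le> n" for n d :: nat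
    using that by (auto elim!: dvdE)
  have "((\<lambda>(n, d). \<psi> d * z ^ n) has_sum A) (SIGMA n:{1..}. {d. d dvd n})"
    by (subst has_sum_reindex_bij_witness[where T = "{1..} \<times> {1..}" and h = F and s' = A
          and j = "\<lambda>(n, d). (d, n div d)" and i = "\<lambda>(d, k). (d * k, d)"])
      (use FA dv in \<open>auto simp: F_def\<close>)
  then have 2: "((\<lambda>n. \<Sum>d | d dvd n. \<psi> d * z ^ n) has_sum A) {1..}"
    by (rule has_sum_SigmaD) (auto intro!: has_sum_finiteI)
  show ?thesis
    using that[of A] 1 2 unfolding pow sum_distrib_right by blast
qed

text \<open>The scale 4 is reached by doubling twice: A(t) - 4 A(4t) is A(t) - 2 A(2t) plus twice
  the same expression at 2t. The limit is therefore 1 + 2 = 3 times that of the single doubling, and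
  the remaining half is the value of 1/(exp x + 1) at 0.\<close>

lemma lambert_series_limit:
  fixes \<psi> :: "nat \<Rightarrow> real"
  assumes chi: "\<And>n. \<bar>\<psi> n\<bar> \<le> 1" "\<psi> 0 = 0"
    and per: "\<And>n. \<psi> (n + p) = \<psi> n" and p: "p > 0" and zero: "(\<Sum>k<p. \<psi> k) = 0"
  defines "A \<equiv> \<lambda>t::real. \<Sum>\<^sub>\<infinity>n\<in>{1..}. (\<Sum>d | d dvd n. \<psi> d) * exp (- t * real n)"
  shows "((\<lambda>t::real. A t - 4 * A (4 * t)) \<longlongrightarrow> - (3 / 2) * (\<Sum>k<p. k * \<psi> k) / p) (at_right 0)"
proof -
  define f where "f x = 1 / (exp x + 1)" for x :: real
  have conv: "convex_on {0..} f" unfolding f_def by (rule fermi_function_convex)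
  have mono: "f y \<le> f x" if "0 \<le> x" "x \<le> y" for x y
    unfolding f_def using that by (intro divide_left_mono mult_pos_pos) (auto intro: add_pos_pos)
  have lim: "(f \<longlongrightarrow> 0) at_top"
    unfolding f_def
    by (intro tendsto_divide_0[OF tendsto_const] filterlim_at_top_imp_at_infinity
        filterlim_at_top_mono[OF exp_at_top]) auto
  have cont: "isCont f 0" unfolding f_def by (intro continuous_intros) auto
  have diff: "(\<lambda>d. \<psi> d * f (d * t)) sums (A t - 2 * A (2 * t))" if t: "t > 0" for t :: real
  proof -
    have t2: "2 * t > 0" using t by simp
    obtain A1 where A1: "((\<lambda>n. (\<Sum>d | d dvd n. \<psi> d) * exp (- t * real n)) has_sum A1) {1..}"
      "((\<lambda>d. \<psi> d * (exp (- t * real d) / (1 - exp (- t * real d)))) has_sum A1) {1..}"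
      using lambert_series_has_sum[where \<psi> = \<psi> and t = t] chi(1) t by blast
    obtain A2 where A2: "((\<lambda>n. (\<Sum>d | d dvd n. \<psi> d) * exp (- (2 * t) * real n)) has_sum A2) {1..}"
      "((\<lambda>d. \<psi> d * (exp (- (2 * t) * real d) / (1 - exp (- (2 * t) * real d)))) has_sum A2) {1..}"
      using lambert_series_has_sum[where \<psi> = \<psi> and t = "2 * t"] chi(1) t2 by blast
    have "((\<lambda>d. \<psi> d * (exp (- t * real d) / (1 - exp (- t * real d)))
        + (-2) * (\<psi> d * (exp (- (2 * t) * real d) / (1 - exp (- (2 * t) * real d))))) has_sum A1 + (-2) * A2) {1..}"
      by (intro has_sum_add has_sum_cmult_right A1 A2)
    also have "?this \<longleftrightarrow> ((\<lambda>d. \<psi> d * f (d * t)) has_sum A1 + (-2) * A2) UNIV"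
    proof (rule has_sum_cong_neutral)
      fix d :: nat assume "d \<in> UNIV - {1..}"
      then show "\<psi> d * f (d * t) = 0" using chi(2) by (auto simp: not_le)
    next
      fix d :: nat assume "d \<in> {1..} \<inter> UNIV"
      then have "d > 0" by auto
      define w where "w = exp (- t * real d)"
      have w: "0 < w" "w < 1" using \<open>d > 0\<close> t by (auto simp: w_def)
      have w2: "exp (- (2 * t) * real d) = w\<^sup>2" by (simp add: w_def power2_eq_square flip: exp_add)
      have fw: "f (d * t) = w / (1 + w)"
        by (simp add: f_def w_def exp_minus divide_simps mult.commute)
      have lin: "x * a + (-2) * (x * b) = x * (a - 2 * b)" for x a b :: real
        by (simp add: algebra_simps)
      have fac: "1 - w\<^sup>2 = (1 - w) * (1 + w)" by (simp add: power2_eq_square algebra_simps)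
      have "w / (1 - w) - 2 * (w\<^sup>2 / (1 - w\<^sup>2)) = w / (1 + w)"
        unfolding fac using w by (simp add: divide_simps) (simp add: power2_eq_square algebra_simps)
      then show "\<psi> d * (exp (- t * real d) / (1 - exp (- t * real d)))
        + (-2) * (\<psi> d * (exp (- (2 * t) * real d) / (1 - exp (- (2 * t) * real d)))) = \<psi> d * f (d * t)"
        unfolding w2 fw w_def[symmetric] by (simp only: lin)
    qed auto
    finally have "(\<lambda>d. \<psi> d * f (d * t)) sums (A1 + (-2) * A2)" by (rule has_sum_imp_sums)
    moreover have "A t = A1" "A (2 * t) = A2" unfolding A_def using A1(1) A2(1) by (auto intro: infsumI)
    ultimately show ?thesis by simp
  qed
  define l where "l = - (\<Sum>k<p. k * \<psi> k) / p * f 0"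
  have "((\<lambda>t::real. \<Sum>d. \<psi> d * f (d * t)) \<longlongrightarrow> l) (at_right 0)"
    unfolding l_def
    by (rule periodic_convex_sum_limit[OF conv _ lim cont per p zero])
      (use mono sums_summable[OF diff] in auto)
  moreover have "eventually (\<lambda>t::real. (\<Sum>d. \<psi> d * f (d * t)) = A t - 2 * A (2 * t)) (at_right 0)"
    using eventually_at_right_less[of "0::real"]
    by eventually_elim (rule sums_unique[OF diff, symmetric])
  ultimately have L: "((\<lambda>t. A t - 2 * A (2 * t)) \<longlongrightarrow> l) (at_right 0)"
    by (rule Lim_transform_eventually)
  have F: "filterlim (\<lambda>t::real. 2 * t) (at_right 0) (at_right 0)"
    unfolding filterlim_at by (auto simp: eventually_at_filter intro!: tendsto_eq_intros)
  have "((\<lambda>t. (A t - 2 * A (2 * t)) + 2 * (A (2 * t) - 2 * A (2 * (2 * t)))) \<longlongrightarrow> l + 2 * l) (at_right 0)"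
    by (intro tendsto_intros L filterlim_compose[OF L F])
  then show ?thesis by (simp add: l_def f_def algebra_simps)
qed

section \<open>The Legendre symbol and roots of a quadratic polynomial\<close>

lemma legendre_values: "Legendre a p \<in> {0, 1, -1}"
  by (auto simp: Legendre_def)

text \<open>Turns the congruences of Euler's criterion into equalities: 0, 1 and -1 are distinct
  modulo any p > 2.\<close>

lemma legendre_cong_unique:
  assumes "2 < (p::nat)" "x \<in> {0, 1, -1}" "y \<in> {0, 1, -1::int}" "[x = y] (mod int p)"
  shows "x = y"
proof -
  have "int p dvd x - y" using assms(4) by (simp add: cong_iff_dvd_diff)
  moreover have "\<bar>x - y\<bar> < int p" using assms by auto
  ultimately show ?thesis using dvd_imp_le_int[of "x - y" "int p"] by force
qed

lemma legendre_mult: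
  assumes p: "prime (p::nat)" "2 < p"
  shows "Legendre (a * b) (int p) = Legendre a (int p) * Legendre b (int p)"
proof (rule legendre_cong_unique[OF p(2)])
  let ?m = "(p - 1) div 2"
  have "[Legendre (a * b) (int p) = (a * b) ^ ?m] (mod int p)" by (rule euler_criterion[OF p])
  also have "(a * b) ^ ?m = a ^ ?m * b ^ ?m" by (rule power_mult_distrib)
  also have "[\<dots> = Legendre a (int p) * Legendre b (int p)] (mod int p)"
    by (intro cong_mult cong_sym[OF euler_criterion[OF p]])
  finally show "[Legendre (a * b) (int p) = Legendre a (int p) * Legendre b (int p)] (mod int p)" .
  show "Legendre a (int p) * Legendre b (int p) \<in> {0, 1, -1}"
    using legendre_values[of a "int p"] legendre_values[of b "int p"] by auto
qed (rule legendre_values)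

lemma legendre_one: "1 < p \<Longrightarrow> Legendre 1 p = 1"
proof -
  assume "1 < p"
  moreover have "QuadRes p 1" unfolding QuadRes_def by (intro exI[of _ 1]) simp
  ultimately show ?thesis by (auto simp: Legendre_def cong_0_iff dest: zdvd_imp_le)
qed

lemma legendre_power:
  assumes p: "prime (p::nat)" "2 < p"
  shows "Legendre (a ^ n) (int p) = Legendre a (int p) ^ n"
  using p by (induction n) (auto simp: legendre_mult legendre_one)

lemma legendre_cong:
  assumes "[a = b] (mod p)"
  shows "Legendre a p = Legendre b p"
proof -
  have "[a = 0] (mod p) \<longleftrightarrow> [b = 0] (mod p)" using assms by (metis cong_sym cong_trans)
  moreover have "QuadRes p a \<longleftrightarrow> QuadRes p b" unfolding QuadRes_def using assms by (metis cong_sym cong_trans)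
  ultimately show ?thesis by (simp add: Legendre_def)
qed

lemma legendre_neg_one:
  assumes p: "prime (p::nat)" "2 < p"
  shows "Legendre (-1) (int p) = (-1) ^ ((p - 1) div 2)"
  by (rule legendre_cong_unique[OF p(2) legendre_values _ euler_criterion[OF p]])
    (auto simp: minus_one_power_iff)

lemma legendre_two:
  assumes p: "prime (p::nat)" "p mod 4 = 3"
  shows "Legendre 2 (int p) = (if p mod 8 = 7 then 1 else -1)"
proof -
  have p2: "2 < p" using p by (cases "p = 2") (auto dest: prime_ge_2_nat)
  interpret G: GAUSS p 2
    using p p2 by unfold_locales (auto simp: cong_0_iff dest: zdvd_imp_le)
  define m where "m = (int p - 1) div 2"
  have pm: "int p = 2 * m + 1" using p(2) unfolding m_def by presburger
  have A: "G.A = {0<..m}" by (auto simp: G.A_def m_def)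
  have C: "G.C = (\<lambda>x. x * 2) ` {0<..m}"
  proof -
    have "(x * 2) mod int p = x * 2" if "x \<in> {0<..m}" for x
      using that pm by (intro mod_pos_pos_trivial) auto
    then show ?thesis unfolding G.C_def G.B_def A by (auto simp: image_image)
  qed
  \<comment> \<open>Gauss's lemma counts the products exceeding p/2. The doubles of 1, ..., m stay
    below p and need no reduction, so these are exactly the doubles of x > m div 2.\<close>
  have "G.E = (\<lambda>x. x * 2) ` {m div 2<..m}"
    unfolding G.E_def C m_def[symmetric] using pm p2 by (auto simp: image_iff)
  then have "card G.E = card {m div 2<..m}"
    by (simp add: card_image inj_on_def)
  also have "\<dots> = nat (m - m div 2)" by simp
  finally have E: "Legendre 2 (int p) = (-1) ^ nat (m - m div 2)"
    using G.gauss_lemma by simp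
  have m0: "m \<ge> 0" using pm p2 by simp
  have p8: "p mod 8 = 3 \<or> p mod 8 = 7" using p(2) by presburger
  have "even (nat (m - m div 2)) \<longleftrightarrow> even (m - m div 2)"
    using m0 by (simp add: even_nat_iff)
  moreover have "even (m - m div 2) \<longleftrightarrow> p mod 8 = 7"
    using p8 pm m0 by presburger
  ultimately show ?thesis using E by (simp add: minus_one_power_iff)
qed

text \<open>X^2 + X + D with 4 D = p + 1 has discriminant -p. For odd q completing the square asks
  whether -p is a square modulo q, which reciprocity turns around; for q = 2 the question is the
  parity of D, that is the second supplementary law.\<close>

lemma quadratic_root_iff_legendre:
  fixes p q :: nat
  assumes p: "prime p" "p mod 4 = 3" and q: "prime q" "q \<noteq> p"
  shows "(\<exists>b. int q dvd b\<^sup>2 + b + (int p + 1) div 4) \<longleftrightarrow> Legendre (int q) (int p) = 1"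
proof (cases "q = 2")
  case True
  have "int q dvd b\<^sup>2 + b + (int p + 1) div 4 \<longleftrightarrow> even ((int p + 1) div 4)" for b
    using True by simp
  moreover have "even ((int p + 1) div 4) \<longleftrightarrow> p mod 8 = 7" using p(2) by presburger
  ultimately show ?thesis using True legendre_two[OF p] by simp
next
  case False
  have p2: "2 < p" using p by (cases "p = 2") (auto dest: prime_ge_2_nat)
  have q2: "2 < q" using False prime_ge_2_nat[OF q(1)] by simp
  have oddq: "odd q" using q2 q(1) prime_odd_nat by blast
  have D: "4 * ((int p + 1) div 4) = int p + 1" using p(2) by presburger
  have sq: "4 * (b\<^sup>2 + b + (int p + 1) div 4) = (2 * b + 1)\<^sup>2 + int p" for b
    using D by (simp add: power2_eq_square algebra_simps)
  have cop4: "coprime (int q) 4"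
  proof -
    have "coprime (int q) (2 * 2)" using oddq by (subst coprime_mult_right_iff) auto
    then show ?thesis by simp
  qed
  have "(\<exists>b. int q dvd b\<^sup>2 + b + (int p + 1) div 4) \<longleftrightarrow> (\<exists>b. int q dvd (2 * b + 1)\<^sup>2 + int p)"
    using sq cop4 by (metis coprime_dvd_mult_right_iff)
  also have "\<dots> \<longleftrightarrow> (\<exists>y. int q dvd y\<^sup>2 + int p)"
  proof
    assume "\<exists>y. int q dvd y\<^sup>2 + int p"
    then obtain y where y: "int q dvd y\<^sup>2 + int p" by blast
    show "\<exists>b. int q dvd (2 * b + 1)\<^sup>2 + int p"
    proof (cases "odd y")
      case True
      then have "2 * ((y - 1) div 2) + 1 = y" by presburger
      then show ?thesis using y by metis
    next
      case False
      \<comment> \<open>Adding the odd number q keeps the residue class of y but makes y odd, hence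
        of the form 2 b + 1.\<close>
      then have "2 * ((y + int q - 1) div 2) + 1 = y + int q" using oddq by presburger
      moreover have "(y + int q)\<^sup>2 + int p = (y\<^sup>2 + int p) + int q * (2 * y + int q)"
        by (simp add: power2_eq_square algebra_simps)
      then have "int q dvd (y + int q)\<^sup>2 + int p" using y by (metis dvd_add dvd_triv_left)
      ultimately show ?thesis by metis
    qed
  qed blast
  also have "\<dots> \<longleftrightarrow> QuadRes (int q) (- int p)"
    by (simp add: QuadRes_def cong_iff_dvd_diff)
  also have "\<dots> \<longleftrightarrow> Legendre (- int p) (int q) = 1"
  proof -
    have "\<not> q dvd p" using p q by (auto simp: primes_dvd_imp_eq)
    then have "\<not> [- int p = 0] (mod int q)" by (simp add: cong_0_iff)
    then show ?thesis by (simp add: Legendre_def)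
  qed
  also have "Legendre (- int p) (int q) = Legendre (int q) (int p)"
  proof -
    \<comment> \<open>As (p - 1)/2 is odd, the reciprocity sign is that of -1 modulo q and cancels
      the sign in -p.\<close>
    have "odd ((p - 1) div 2)" using p(2) by presburger
    then have "Legendre (int p) (int q) * Legendre (int q) (int p) = (-1) ^ ((q - 1) div 2)"
      using Quadratic_Reciprocity[OF p(1) p2 q(1) q2] q(2) by (auto simp: minus_one_power_iff)
    then have 1: "Legendre (int p) (int q) * Legendre (int q) (int p) = Legendre (-1) (int q)"
      by (simp add: legendre_neg_one[OF q(1) q2])
    have "Legendre (- int p) (int q) = Legendre (-1) (int q) * Legendre (int p) (int q)"
      using legendre_mult[OF q(1) q2, of "-1" "int p"] by simp
    moreover have "Legendre (int p) (int q) \<noteq> 0"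
      using p q by (auto simp: Legendre_def cong_0_iff primes_dvd_imp_eq)
    then have "Legendre (int p) (int q) * Legendre (int p) (int q) = 1"
      using legendre_values[of "int p" "int q"] by auto
    ultimately show ?thesis using 1 by (metis mult.assoc mult.commute mult_1)
  qed
  finally show ?thesis .
qed

section \<open>Roots of X^2 + X + D modulo a\<close>

text \<open>The polynomial value at b will be the norm of b + \<omega> in the ring of integers, so
  these roots parametrise the primitive ideals of norm a.\<close>

definition quad_roots :: "int \<Rightarrow> nat \<Rightarrow> int set" where
  "quad_roots D a = {b \<in> {0..<int a}. int a dvd b\<^sup>2 + b + D}"

lemma finite_quad_roots [simp]: "finite (quad_roots D a)"
  by (rule finite_subset[of _ "{0..<int a}"]) (auto simp: quad_roots_def)

lemma quad_root_mod:
  "int a dvd (b mod int a)\<^sup>2 + b mod int a + D \<longleftrightarrow> int a dvd b\<^sup>2 + b + D"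
proof -
  have "[(b mod int a)\<^sup>2 + b mod int a + D = b\<^sup>2 + b + D] (mod int a)"
    by (intro cong_add cong_pow cong_refl) auto
  then show ?thesis by (rule cong_dvd_iff)
qed

lemma mod_mem_quad_roots:
  "a > 0 \<Longrightarrow> b mod int a \<in> quad_roots D a \<longleftrightarrow> int a dvd b\<^sup>2 + b + D"
  by (simp add: quad_roots_def quad_root_mod)

lemma card_quad_roots_one: "card (quad_roots D 1) = 1"
proof -
  have "quad_roots D 1 = {0}" by (auto simp: quad_roots_def)
  then show ?thesis by simp
qed

lemma card_quad_roots_mult:
  assumes "a > 0" "b > 0" "coprime a b"
  shows "card (quad_roots D (a * b)) = card (quad_roots D a) * card (quad_roots D b)"
proof -
  have cop: "coprime (int a) (int b)" using assms by simp
  have "bij_betw (\<lambda>x. (x mod int a, x mod int b)) (quad_roots D (a * b)) (quad_roots D a \<times> quad_roots D b)"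
  proof (rule bij_betw_imageI)
    show "inj_on (\<lambda>x. (x mod int a, x mod int b)) (quad_roots D (a * b))"
    proof (rule inj_onI)
      fix x y assume xy: "x \<in> quad_roots D (a * b)" "y \<in> quad_roots D (a * b)"
        "(x mod int a, x mod int b) = (y mod int a, y mod int b)"
      then have "int a dvd x - y" "int b dvd x - y" by (simp_all add: mod_eq_dvd_iff)
      then have "int a * int b dvd x - y" using cop by (rule divides_mult)
      moreover have "\<bar>x - y\<bar> < int a * int b" using xy by (auto simp: quad_roots_def)
      ultimately show "x = y" using dvd_imp_le_int[of "x - y" "int a * int b"] by force
    qed
    show "(\<lambda>x. (x mod int a, x mod int b)) ` quad_roots D (a * b) = quad_roots D a \<times> quad_roots D b"
    proof (intro equalityI subsetI)
      fix z assume "z \<in> (\<lambda>x. (x mod int a, x mod int b)) ` quad_roots D (a * b)"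
      then obtain x where x: "x \<in> quad_roots D (a * b)" "z = (x mod int a, x mod int b)" by blast
      then have "int a * int b dvd x\<^sup>2 + x + D" by (simp add: quad_roots_def)
      then have "int a dvd x\<^sup>2 + x + D" "int b dvd x\<^sup>2 + x + D"
        using dvd_mult_left dvd_mult_right by blast+
      then show "z \<in> quad_roots D a \<times> quad_roots D b"
        using x assms by (simp add: mod_mem_quad_roots)
    next
      fix z assume "z \<in> quad_roots D a \<times> quad_roots D b"
      then obtain u v where z: "z = (u, v)" and u: "u \<in> quad_roots D a" and v: "v \<in> quad_roots D b" by blast
      obtain x where x: "[x = u] (mod int a)" "[x = v] (mod int b)"
        using binary_chinese_remainder_int[OF cop] by blast
      then have xm: "x mod int a = u" "x mod int b = v"
        using u v by (auto simp: unique_euclidean_semiring_class.cong_def quad_roots_def)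
      then have "int a dvd x\<^sup>2 + x + D" "int b dvd x\<^sup>2 + x + D"
        using u v assms by (metis mod_mem_quad_roots)+
      then have "int a * int b dvd x\<^sup>2 + x + D" using cop by (rule divides_mult)
      then have "x mod int (a * b) \<in> quad_roots D (a * b)"
        using assms by (subst mod_mem_quad_roots) auto
      moreover have "(x mod int (a * b)) mod int a = u" "(x mod int (a * b)) mod int b = v"
        using xm by (simp_all add: mod_mod_cancel)
      ultimately show "z \<in> (\<lambda>x. (x mod int a, x mod int b)) ` quad_roots D (a * b)"
        using z by (metis (no_types, lifting) image_eqI)
    qed
  qed
  then show ?thesis by (simp add: bij_betw_same_card card_cartesian_product)
qed

lemma quad_roots_prime_power_empty:
  assumes "\<nexists>b. int q dvd b\<^sup>2 + b + D" "e > 0"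
  shows "quad_roots D (q ^ e) = {}"
proof -
  have "int q dvd int (q ^ e)" using assms(2) by (cases e) auto
  then show ?thesis using assms(1) by (auto simp: quad_roots_def dest: dvd_trans)
qed

text \<open>Hensel lifting. The derivative 2 b + 1 is invertible modulo q at every root, because its
  square is 4 (b^2 + b + D) - (4 D - 1).\<close>

lemma quad_root_prime_power_exists:
  assumes q: "prime (q::nat)" and r: "int q dvd b\<^sup>2 + b + D" and disc: "\<not> int q dvd 4 * D - 1"
  shows "\<exists>b. int q ^ Suc e dvd b\<^sup>2 + b + D"
proof (induction e)
  case 0 then show ?case using r by auto
next
  case (Suc e)
  then obtain b where b: "int q ^ Suc e dvd b\<^sup>2 + b + D" by blast
  then obtain c where c: "b\<^sup>2 + b + D = int q ^ Suc e * c" by blast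
  have "\<not> int q dvd 2 * b + 1"
  proof
    assume d: "int q dvd 2 * b + 1"
    have "int q dvd 4 * (b\<^sup>2 + b + D)" using c by simp
    moreover have "4 * D - 1 = 4 * (b\<^sup>2 + b + D) - (2 * b + 1) * (2 * b + 1)"
      by (simp add: power2_eq_square algebra_simps)
    ultimately show False using d disc by (metis dvd_diff dvd_mult)
  qed
  then have "coprime (2 * b + 1) (int q)"
    using q by (metis coprime_commute prime_imp_coprime prime_nat_int_transfer)
  then obtain i where i: "[(2 * b + 1) * i = 1] (mod int q)" using cong_solve_coprime_int by blast
  \<comment> \<open>The Newton correction: i inverts the derivative modulo q, and s solves the
    linear congruence left after dividing by the current power of q.\<close>
  define s where "s = - c * i"
  have "[c + (2 * b + 1) * s = c - c * 1] (mod int q)"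
    using cong_diff[OF cong_refl cong_mult[OF cong_refl i, of c], of c]
    by (simp add: s_def algebra_simps)
  then have d: "int q dvd c + (2 * b + 1) * s" by (simp add: cong_0_iff)
  have "(b + s * int q ^ Suc e)\<^sup>2 + (b + s * int q ^ Suc e) + D
    = int q ^ Suc e * (c + (2 * b + 1) * s) + int q ^ Suc e * int q * (s\<^sup>2 * int q ^ e)"
    using c by (simp add: power2_eq_square algebra_simps)
  moreover have "int q ^ Suc e * int q dvd int q ^ Suc e * (c + (2 * b + 1) * s)"
    using d by (intro mult_dvd_mono) auto
  ultimately have "int q ^ Suc e * int q dvd (b + s * int q ^ Suc e)\<^sup>2 + (b + s * int q ^ Suc e) + D"
    by simp
  then show ?case by (metis power_Suc2)
qed

text \<open>The roots are r and -1 - r. For another root x the prime q cannot divide both x - r and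
  x + r + 1, whose difference 2 r + 1 is prime to q, so the full power of q divides one of
  them.\<close>

lemma card_quad_roots_prime_power:
  assumes q: "prime (q::nat)" and r: "int q dvd b\<^sup>2 + b + D" and disc: "\<not> int q dvd 4 * D - 1"
    and e: "e > 0"
  shows "card (quad_roots D (q ^ e)) = 2"
proof -
  define Q where "Q = q ^ e"
  have Q0: "Q > 0" using q prime_gt_0_nat by (simp add: Q_def)
  have qQ: "int q dvd int Q" using e by (cases e) (auto simp: Q_def)
  obtain r where r: "int Q dvd r\<^sup>2 + r + D"
    using quad_root_prime_power_exists[OF q r disc, of "e - 1"] e by (auto simp: Q_def)
  have nd: "\<not> int q dvd 2 * r + 1"
  proof
    assume d: "int q dvd 2 * r + 1"
    have "int q dvd 4 * (r\<^sup>2 + r + D)" using r qQ by (metis dvd_mult dvd_trans)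
    moreover have "4 * D - 1 = 4 * (r\<^sup>2 + r + D) - (2 * r + 1) * (2 * r + 1)"
      by (simp add: power2_eq_square algebra_simps)
    ultimately show False using d disc by (metis dvd_diff dvd_mult)
  qed
  have "quad_roots D Q = {r mod int Q, (- 1 - r) mod int Q}"
  proof (intro equalityI subsetI)
    fix x assume x: "x \<in> quad_roots D Q"
    then have xr: "0 \<le> x" "x < int Q" "int Q dvd x\<^sup>2 + x + D" by (auto simp: quad_roots_def)
    have "(x - r) * (x + r + 1) = (x\<^sup>2 + x + D) - (r\<^sup>2 + r + D)"
      by (simp add: power2_eq_square algebra_simps)
    then have dv: "int Q dvd (x - r) * (x + r + 1)" using xr r by (metis dvd_diff)
    have "int Q dvd x - r \<or> int Q dvd x + r + 1"
    proof (cases "int q dvd x - r")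
      case True
      then have "\<not> int q dvd x + r + 1"
        using nd dvd_diff[of "int q" "x + r + 1" "x - r"] by (auto simp: algebra_simps)
      then have "coprime (int q) (x + r + 1)"
        using q by (metis prime_imp_coprime prime_nat_int_transfer)
      then have "coprime (int Q) (x + r + 1)" by (simp add: Q_def)
      then show ?thesis using dv by (simp add: coprime_dvd_mult_left_iff)
    next
      case False
      then have "coprime (int q) (x - r)"
        using q by (metis prime_imp_coprime prime_nat_int_transfer)
      then have "coprime (int Q) (x - r)" by (simp add: Q_def)
      then show ?thesis using dv by (simp add: coprime_dvd_mult_right_iff)
    qed
    then have "x mod int Q = r mod int Q \<or> x mod int Q = (- 1 - r) mod int Q"
      by (auto simp: mod_eq_dvd_iff algebra_simps)
    then show "x \<in> {r mod int Q, (- 1 - r) mod int Q}" using xr by simp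
  next
    have "(- 1 - r)\<^sup>2 + (- 1 - r) + D = r\<^sup>2 + r + D" by (simp add: power2_eq_square algebra_simps)
    then show "x \<in> quad_roots D Q" if "x \<in> {r mod int Q, (- 1 - r) mod int Q}" for x
      using that r mod_mem_quad_roots[OF Q0] by fastforce
  qed
  moreover have "r mod int Q \<noteq> (- 1 - r) mod int Q"
  proof
    assume "r mod int Q = (- 1 - r) mod int Q"
    then have "int Q dvd 2 * r + 1" by (simp add: mod_eq_dvd_iff algebra_simps)
    then show False using nd qQ dvd_trans by blast
  qed
  ultimately show ?thesis by (simp add: Q_def)
qed

text \<open>Here 4 (b^2 + b + D) = (2 b + 1)^2 + p. It is divisible by p for the single class with 2
  b + 1 divisible by p, and then never by p^2.\<close>

lemma card_quad_roots_ramified: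
  assumes p: "prime (p::nat)" "p mod 4 = 3" and D: "4 * D = int p + 1" and e: "e > 0"
  shows "card (quad_roots D (p ^ e)) = (if e = 1 then 1 else 0)"
proof -
  have p2: "2 < p" using p by (cases "p = 2") (auto dest: prime_ge_2_nat)
  have primep: "prime (int p)" using p by simp
  have sq: "4 * (b\<^sup>2 + b + D) = (2 * b + 1)\<^sup>2 + int p" for b
    using D by (simp add: power2_eq_square algebra_simps)
  have cop4: "coprime (int p) 4"
  proof -
    have "coprime (int p) (2 * 2)" using p(2) by (subst coprime_mult_right_iff) (auto, presburger+)
    then show ?thesis by simp
  qed
  have root: "int p dvd b\<^sup>2 + b + D \<longleftrightarrow> int p dvd 2 * b + 1" for b
  proof -
    have "int p dvd b\<^sup>2 + b + D \<longleftrightarrow> int p dvd 4 * (b\<^sup>2 + b + D)"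
      using cop4 by (metis coprime_dvd_mult_right_iff)
    also have "\<dots> \<longleftrightarrow> int p dvd (2 * b + 1)\<^sup>2" unfolding sq by simp
    also have "\<dots> \<longleftrightarrow> int p dvd 2 * b + 1" using primep by (simp add: prime_dvd_power_iff)
    finally show ?thesis .
  qed
  show ?thesis
  proof (cases "e = 1")
    case True
    have "quad_roots D p = {(int p - 1) div 2}"
    proof (intro equalityI subsetI)
      fix b assume "b \<in> quad_roots D p"
      then have b: "0 \<le> b" "b < int p" "int p dvd 2 * b + 1" by (auto simp: quad_roots_def root)
      then obtain k where k: "2 * b + 1 = int p * k" by blast
      have "k > 0"
      proof (rule ccontr)
        assume "\<not> k > 0"
        then have "int p * k \<le> 0" by (simp add: mult_nonneg_nonpos)
        then show False using k b by simp
      qed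
      moreover have "k < 2"
      proof (rule ccontr)
        assume "\<not> k < 2"
        then have "int p * 2 \<le> int p * k" by (intro mult_left_mono) auto
        then show False using k b by linarith
      qed
      ultimately have "k = 1" by simp
      then show "b \<in> {(int p - 1) div 2}" using k by simp
    next
      fix b assume "b \<in> {(int p - 1) div 2}"
      moreover have "2 * ((int p - 1) div 2) + 1 = int p" using p(2) by presburger
      ultimately show "b \<in> quad_roots D p" using p2 by (auto simp: quad_roots_def root)
    qed
    then show ?thesis using True by simp
  next
    case False
    then have pp: "int p * int p dvd int (p ^ e)"
      using e by (metis One_nat_def Suc_leI le_imp_power_dvd less_one linorder_neqE_nat not_less_eq of_nat_dvd_iff
          of_nat_mult power2_eq_square Suc_1)
    have "\<not> int (p ^ e) dvd b\<^sup>2 + b + D" for b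
    proof
      assume "int (p ^ e) dvd b\<^sup>2 + b + D"
      then have d: "int p * int p dvd b\<^sup>2 + b + D" using pp dvd_trans by blast
      then have "int p dvd 2 * b + 1" using root dvd_mult_left by blast
      then have "int p * int p dvd (2 * b + 1)\<^sup>2" unfolding power2_eq_square by (blast intro: mult_dvd_mono)
      moreover have "int p * int p dvd (2 * b + 1)\<^sup>2 + int p" using d sq[of b] by (metis dvd_mult)
      ultimately have "int p * int p dvd int p" by (metis add_diff_cancel_left' dvd_diff)
      then show False using p2 by (simp add: dvd_mult_cancel_left)
    qed
    then have "quad_roots D (p ^ e) = {}" by (auto simp: quad_roots_def)
    then show ?thesis using False by simp
  qed
qed

section \<open>Divisor sums of the Legendre symbol\<close>

lemma prime_power_divisors_insert:
  assumes q: "prime (q::nat)" and m: "\<not> q dvd m"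
  shows "{d. d dvd q ^ Suc e * m} = {d. d dvd q ^ e * m} \<union> (\<lambda>d. q ^ Suc e * d) ` {d. d dvd m}"
    and "{d. d dvd q ^ e * m} \<inter> (\<lambda>d. q ^ Suc e * d) ` {d. d dvd m} = {}"
proof -
  have q0: "q > 0" using q prime_gt_0_nat by blast
  show "{d. d dvd q ^ Suc e * m} = {d. d dvd q ^ e * m} \<union> (\<lambda>d. q ^ Suc e * d) ` {d. d dvd m}"
  proof (intro equalityI subsetI)
    fix d assume "d \<in> {d. d dvd q ^ Suc e * m}"
    then have d: "d dvd q ^ Suc e * m" by simp
    then obtain u v where uv: "d = u * v" "u dvd q ^ Suc e" "v dvd m" by (rule dvd_productE)
    then obtain i where i: "i \<le> Suc e" "u = q ^ i" using divides_primepow_nat[OF q] by blast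
    show "d \<in> {d. d dvd q ^ e * m} \<union> (\<lambda>d. q ^ Suc e * d) ` {d. d dvd m}"
    proof (cases "i = Suc e")
      case True then show ?thesis using uv i by auto
    next
      case False
      then have "u dvd q ^ e" using i by (auto intro: le_imp_power_dvd)
      then show ?thesis using uv by (auto intro: mult_dvd_mono)
    qed
  next
    fix d assume "d \<in> {d. d dvd q ^ e * m} \<union> (\<lambda>d. q ^ Suc e * d) ` {d. d dvd m}"
    then show "d \<in> {d. d dvd q ^ Suc e * m}" by (auto simp: mult.assoc intro: dvd_mult)
  qed
  have "\<not> q ^ Suc e * d dvd q ^ e * m" for d
  proof
    assume "q ^ Suc e * d dvd q ^ e * m"
    then have "q ^ e * (q * d) dvd q ^ e * m" by (simp add: mult_ac)
    then have "q * d dvd m" using q0 by simp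
    then show False using m dvd_mult_left by blast
  qed
  then show "{d. d dvd q ^ e * m} \<inter> (\<lambda>d. q ^ Suc e * d) ` {d. d dvd m} = {}" by auto
qed

lemma legendre_divisor_sum_prime_power:
  assumes p: "prime (p::nat)" "2 < p" and q: "prime (q::nat)" and m: "\<not> q dvd m" "m > 0"
  shows "(\<Sum>d | d dvd q ^ e * m. Legendre (int d) (int p))
    = (\<Sum>j\<le>e. Legendre (int q) (int p) ^ j) * (\<Sum>d | d dvd m. Legendre (int d) (int p))"
proof (induction e)
  case (Suc e)
  have q0: "q > 0" using q prime_gt_0_nat by blast
  have fin: "finite {d. d dvd q ^ e * m}" "finite {d. d dvd m}" using q0 m by auto
  have "(\<Sum>d | d dvd q ^ Suc e * m. Legendre (int d) (int p))
    = (\<Sum>d | d dvd q ^ e * m. Legendre (int d) (int p))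
      + (\<Sum>d\<in>(\<lambda>d. q ^ Suc e * d) ` {d. d dvd m}. Legendre (int d) (int p))"
    unfolding prime_power_divisors_insert(1)[OF q m(1)]
    by (rule sum.union_disjoint) (use fin prime_power_divisors_insert(2)[OF q m(1)] in auto)
  also have "(\<Sum>d\<in>(\<lambda>d. q ^ Suc e * d) ` {d. d dvd m}. Legendre (int d) (int p))
    = (\<Sum>d | d dvd m. Legendre (int q ^ Suc e * int d) (int p))"
    by (subst sum.reindex) (use q0 in \<open>auto simp: inj_on_def\<close>)
  also have "\<dots> = Legendre (int q) (int p) ^ Suc e * (\<Sum>d | d dvd m. Legendre (int d) (int p))"
    by (simp only: legendre_mult[OF p] legendre_power[OF p] sum_distrib_left)
  finally show ?case unfolding Suc by (simp add: algebra_simps)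
qed simp

text \<open>This will turn out to be the number of integral ideals of norm n: such an ideal is an
  integer k times a primitive ideal of norm n/k^2.\<close>

definition root_count :: "int \<Rightarrow> nat \<Rightarrow> int" where
  "root_count D n = (\<Sum>k | k\<^sup>2 dvd n. int (card (quad_roots D (n div k\<^sup>2))))"

lemma finite_square_divisors: "n > 0 \<Longrightarrow> finite {k::nat. k\<^sup>2 dvd n}"
proof (rule finite_subset[of _ "{..n}"])
  assume n: "n > 0"
  show "{k. k\<^sup>2 dvd n} \<subseteq> {..n}"
  proof
    fix k assume "k \<in> {k. k\<^sup>2 dvd n}"
    then have "k\<^sup>2 \<le> n" using n by (auto dest: dvd_imp_le)
    moreover have "k \<le> k\<^sup>2" by (simp add: power2_eq_square)
    ultimately show "k \<in> {..n}" by simp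
  qed
qed simp

text \<open>Split the k by divisibility by q. The k prime to q only see m, and the Chinese remainder
  theorem separates the factor for the power of q; the multiples of q correspond to square divisors
  of the number divided by q^2.\<close>

lemma root_count_prime_power:
  assumes q: "prime (q::nat)" and m: "\<not> q dvd m" "m > 0"
  shows "root_count D (q ^ e * m) = int (card (quad_roots D (q ^ e))) * root_count D m
    + (if e \<ge> 2 then root_count D (q ^ (e - 2) * m) else 0)"
proof -
  have q0: "q > 0" using q prime_gt_0_nat by blast
  define N where "N = q ^ e * m"
  have N0: "N > 0" using q0 m by (simp add: N_def)
  have cop: "coprime (q ^ e) n" if "\<not> q dvd n" for n
    using q that by (simp add: prime_imp_coprime)
  have split: "{k. k\<^sup>2 dvd N} = {k. k\<^sup>2 dvd m} \<union> {k. k\<^sup>2 dvd N \<and> q dvd k}"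
  proof -
    have "k\<^sup>2 dvd m" if "k\<^sup>2 dvd N" "\<not> q dvd k" for k
    proof -
      have "\<not> q dvd k\<^sup>2" using that q by (simp add: prime_dvd_power_iff)
      then have "coprime (k\<^sup>2) (q ^ e)" using cop coprime_commute by blast
      then show ?thesis using that(1) by (simp add: N_def coprime_dvd_mult_right_iff)
    qed
    then show ?thesis by (auto simp: N_def)
  qed
  have nq: "\<not> q dvd k" if "k\<^sup>2 dvd m" for k
    using that m by (metis dvd_trans dvd_triv_left power2_eq_square)
  have "root_count D N = (\<Sum>k | k\<^sup>2 dvd m. int (card (quad_roots D (N div k\<^sup>2))))
    + (\<Sum>k | k\<^sup>2 dvd N \<and> q dvd k. int (card (quad_roots D (N div k\<^sup>2))))"
    unfolding root_count_def by (subst split, rule sum.union_disjoint)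
      (use finite_square_divisors[OF N0] finite_square_divisors[OF m(2)] nq in auto)
  also have "(\<Sum>k | k\<^sup>2 dvd m. int (card (quad_roots D (N div k\<^sup>2))))
    = (\<Sum>k | k\<^sup>2 dvd m. int (card (quad_roots D (q ^ e))) * int (card (quad_roots D (m div k\<^sup>2))))"
  proof (rule sum.cong)
    fix k assume "k \<in> {k. k\<^sup>2 dvd m}"
    then have k: "k\<^sup>2 dvd m" by simp
    then have "N div k\<^sup>2 = q ^ e * (m div k\<^sup>2)" by (simp add: N_def div_mult_swap)
    moreover have "m div k\<^sup>2 dvd m" using k by (metis dvd_div_mult_self dvd_triv_left)
    then have "\<not> q dvd m div k\<^sup>2" "m div k\<^sup>2 > 0" using m by (auto dest: dvd_trans dvd_pos_nat)
    ultimately show "int (card (quad_roots D (N div k\<^sup>2)))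
      = int (card (quad_roots D (q ^ e))) * int (card (quad_roots D (m div k\<^sup>2)))"
      using card_quad_roots_mult[of "q ^ e" "m div k\<^sup>2" D] cop q0 by simp
  qed simp
  also have "\<dots> = int (card (quad_roots D (q ^ e))) * root_count D m"
    by (simp add: root_count_def sum_distrib_left)
  also have "(\<Sum>k | k\<^sup>2 dvd N \<and> q dvd k. int (card (quad_roots D (N div k\<^sup>2))))
    = (if e \<ge> 2 then root_count D (q ^ (e - 2) * m) else 0)"
  proof (cases "e \<ge> 2")
    case True
    have Ne: "N = q\<^sup>2 * (q ^ (e - 2) * m)"
    proof -
      have "q ^ e = q\<^sup>2 * q ^ (e - 2)" using True by (metis le_add_diff_inverse power_add)
      then show ?thesis by (simp add: N_def)
    qed
    have set: "{k. k\<^sup>2 dvd N \<and> q dvd k} = (\<lambda>k. q * k) ` {k. k\<^sup>2 dvd q ^ (e - 2) * m}"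
      using q0 by (auto simp: Ne power_mult_distrib elim!: dvdE[of q])
    have "(\<Sum>k | k\<^sup>2 dvd N \<and> q dvd k. int (card (quad_roots D (N div k\<^sup>2))))
      = (\<Sum>k | k\<^sup>2 dvd q ^ (e - 2) * m. int (card (quad_roots D (N div (q * k)\<^sup>2))))"
      unfolding set by (subst sum.reindex) (use q0 in \<open>auto simp: inj_on_def\<close>)
    also have "\<dots> = root_count D (q ^ (e - 2) * m)"
      unfolding root_count_def by (intro sum.cong) (use q0 in \<open>auto simp: Ne power_mult_distrib\<close>)
    finally show ?thesis using True by simp
  next
    case False
    have "\<not> k\<^sup>2 dvd N" if "q dvd k" for k
    proof
      assume "k\<^sup>2 dvd N"
      moreover have "q\<^sup>2 dvd k\<^sup>2" using that by simp
      ultimately have "q\<^sup>2 dvd q ^ e * m" unfolding N_def by (rule dvd_trans[rotated])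
      moreover have "e = 0 \<or> e = 1" using False by auto
      ultimately have "q dvd m" using q0 by (auto simp: power2_eq_square dest: dvd_mult_left)
      then show False using m by simp
    qed
    then have "{k. k\<^sup>2 dvd N \<and> q dvd k} = {}" by auto
    then show ?thesis using False by (simp only: sum.empty) simp
  qed
  finally show ?thesis by (simp add: N_def)
qed

text \<open>The right side is shaped for the recursion of \<open>root_count\<close> from e to e - 2.
  With the symbol equal to 0, 1 or -1 it encodes the ramified, split and inert counts for e > 0: one
  root only for e = 1, two roots, no root.\<close>

lemma card_quad_roots_prime_power_legendre:
  fixes p q :: nat
  assumes p: "prime p" "p mod 4 = 3" and q: "prime q" and D: "D = (int p + 1) div 4"
  shows "int (card (quad_roots D (q ^ e)))
    = (\<Sum>j\<le>e. Legendre (int q) (int p) ^ j)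
      - (if e \<ge> 2 then \<Sum>j\<le>e - 2. Legendre (int q) (int p) ^ j else 0)"
proof (cases "e = 0")
  case True then show ?thesis using card_quad_roots_one[of D] by simp
next
  case False
  have D4: "4 * D = int p + 1" using p(2) D by presburger
  have p2: "2 < p" using p by (cases "p = 2") (auto dest: prime_ge_2_nat)
  consider "q = p" | "q \<noteq> p" "Legendre (int q) (int p) = 1" | "q \<noteq> p" "Legendre (int q) (int p) = -1"
  proof -
    have "Legendre (int q) (int p) \<noteq> 0" if "q \<noteq> p"
      using that primes_dvd_imp_eq[OF p(1) q] by (auto simp: Legendre_def cong_0_iff)
    then show ?thesis using that legendre_values[of "int q" "int p"] by auto
  qed
  then show ?thesis
  proof cases
    case 1
    then have "Legendre (int q) (int p) = 0" by (simp add: Legendre_def cong_0_iff)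
    moreover have "(\<Sum>j\<le>n. (0::int) ^ j) = 1" for n by (induction n) auto
    ultimately show ?thesis
      using card_quad_roots_ramified[OF p D4] False 1 by auto
  next
    case 2
    then obtain b where "int q dvd b\<^sup>2 + b + D"
      using quadratic_root_iff_legendre[OF p q 2(1)] D by blast
    moreover have "\<not> int q dvd 4 * D - 1"
      using p q 2 D4 by (auto dest: primes_dvd_imp_eq)
    ultimately have "card (quad_roots D (q ^ e)) = 2"
      using card_quad_roots_prime_power[OF q] False by blast
    then show ?thesis using 2 False by auto
  next
    case 3
    then have "\<nexists>b. int q dvd b\<^sup>2 + b + D"
      using quadratic_root_iff_legendre[OF p q 3(1)] D by simp
    then have "card (quad_roots D (q ^ e)) = 0"
      using quad_roots_prime_power_empty[of q D e] False by simp
    moreover have alt: "(\<Sum>j\<le>n. (-1::int) ^ j) = (if even n then 1 else 0)" for n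
      by (induction n) auto
    moreover have "even (e - 2) = even e" if "e \<ge> 2" using that by simp
    ultimately show ?thesis using 3 False by (auto simp: not_le less_2_cases_iff)
  qed
qed

text \<open>The coefficientwise form of the factorisation of the Dedekind zeta function into the
  zeta function and an L-series. Both sides split off the same factor at each prime; for the left
  side the differences in the local root counts telescope along the recursion in the
  exponent.\<close>

lemma root_count_eq_legendre_sum:
  fixes p :: nat
  assumes p: "prime p" "p mod 4 = 3" and D: "D = (int p + 1) div 4" and n: "n > 0"
  shows "root_count D n = (\<Sum>d | d dvd n. Legendre (int d) (int p))"
  using n
proof (induction n rule: less_induct)
  case (less n)
  have p2: "2 < p" using p by (cases "p = 2") (auto dest: prime_ge_2_nat)
  show ?case
  proof (cases "n = 1")
    case True
    have "root_count D 1 = (\<Sum>k\<in>{1::nat}. int (card (quad_roots D (1 div k\<^sup>2))))"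
      unfolding root_count_def by (rule sum.cong) auto
    then show ?thesis using True p2 card_quad_roots_one[of D] by (simp add: legendre_one)
  next
    case False
    then obtain q where q: "prime q" "q dvd n" using prime_factor_nat by blast
    obtain m where m: "n = q ^ multiplicity q n * m" "\<not> q dvd m"
      using multiplicity_decompose'[of n q] q less.prems by (metis mult.commute not_prime_unit not_less0)
    define e where "e = multiplicity q n"
    have e: "e > 0" using q less.prems by (simp add: e_def prime_multiplicity_gt_zero_iff)
    have m0: "m > 0" using m less.prems by (cases m) auto
    have "m < n"
    proof -
      have "1 < q ^ e" by (rule one_less_power[OF prime_gt_1_nat[OF q(1)] e])
      then show ?thesis using m(1) m0 unfolding e_def[symmetric] by simp
    qed
    then have IH: "root_count D m = (\<Sum>d | d dvd m. Legendre (int d) (int p))" using less m0 by blast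
    have "root_count D (q ^ i * m) = (\<Sum>j\<le>i. Legendre (int q) (int p) ^ j) * root_count D m" for i
    proof (induction i rule: less_induct)
      case (less i)
      have IH': "root_count D (q ^ (i - 2) * m) = (\<Sum>j\<le>i - 2. Legendre (int q) (int p) ^ j) * root_count D m"
        if "i \<ge> 2" using that by (intro less) simp
      show ?case
        by (subst root_count_prime_power[OF q(1) m(2) m0],
            subst card_quad_roots_prime_power_legendre[OF p q(1) D])
          (simp add: IH' left_diff_distrib)
    qed
    from this[of e] show ?thesis
      using legendre_divisor_sum_prime_power[OF p(1) p2 q(1) m(2) m0, of e]
      unfolding IH e_def m(1)[symmetric] by simp
  qed
qed

section \<open>Ideals of the ring of integers\<close>

text \<open>If b is the reduced denominator, every power of b divides the fixed number M, so b = 1.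
  This will yield the integrality of norms.\<close>

lemma rat_integral_if_powers_bounded_denominator:
  fixes q :: rat and M :: int
  assumes M: "M \<noteq> 0" and pow: "\<And>n. of_int M * q ^ n \<in> \<int>"
  shows "q \<in> \<int>"
proof -
  obtain a b where ab: "quotient_of q = (a, b)" by (cases "quotient_of q")
  have b: "b > 0" and cop: "coprime a b" and q: "q = of_int a / of_int b"
    using ab quotient_of_denom_pos quotient_of_coprime quotient_of_div by blast+
  have dvd: "b ^ n dvd M" for n
  proof -
    obtain k where "of_int M * q ^ n = of_int k" using pow[of n] by (auto elim: Ints_cases)
    then have "(of_int (M * a ^ n) :: rat) = of_int (k * b ^ n)"
      using b by (simp add: q power_divide divide_simps)
    then have "M * a ^ n = k * b ^ n" using of_int_eq_iff by blast
    then have "b ^ n dvd M * a ^ n" by simp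
    moreover have "coprime (b ^ n) (a ^ n)" using cop by (simp add: coprime_commute)
    ultimately show ?thesis by (simp add: coprime_dvd_mult_left_iff)
  qed
  have "b = 1"
  proof (rule ccontr)
    assume "b \<noteq> 1"
    then have b2: "b \<ge> 2" using b by simp
    define n where "n = nat \<bar>M\<bar>"
    have "b ^ n \<le> \<bar>M\<bar>" using dvd_imp_le_int[OF M dvd[of n]] by simp
    moreover have "(2::int) ^ n \<le> b ^ n" using b2 by (intro power_mono) auto
    moreover have "int n < 2 ^ n" by (metis less_exp of_nat_less_iff of_nat_numeral of_nat_power)
    ultimately show False by (simp add: n_def)
  qed
  then show ?thesis using q by simp
qed

text \<open>The bound p > 3 excludes the field with six units; beyond it the units are 1 and
  -1.\<close>

locale prime_discriminant =
  fixes p :: nat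
  assumes prime_p: "prime p" and p_mod_4: "p mod 4 = 3" and p_gt_3: "3 < p"
begin

definition D :: int where "D = (int p + 1) div 4"

definition sp :: complex where "sp = csqrt (of_int (- int p))"

definition \<omega> :: complex where "\<omega> = (1 + sp) / 2"

definition elt :: "int \<Rightarrow> int \<Rightarrow> complex" where "elt x y = of_int x + of_int y * \<omega>"

definition OK :: "complex set" where "OK = {elt x y | x y. True}"

abbreviation "R \<equiv> ring_of_integers (quadratic_field (- int p))"

lemma four_D: "4 * D = int p + 1" using p_mod_4 unfolding D_def by presburger

lemma sp_eq: "sp = \<i> * of_real (sqrt p)"
  unfolding sp_def using csqrt_of_real_nonpos[of "- real p"] by (simp add: mult.commute)

lemma sp_sq: "sp * sp = - of_nat p"
proof -
  have "sp * sp = (\<i> * \<i>) * of_real (sqrt p * sqrt p)"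
    unfolding sp_eq of_real_mult by (simp only: mult_ac)
  also have "sqrt p * sqrt p = real p" by simp
  finally show ?thesis by simp
qed

lemma cnj_sp: "cnj sp = - sp" by (simp add: sp_eq)

lemma cnj_omega: "cnj \<omega> = 1 - \<omega>" by (simp add: \<omega>_def cnj_sp field_simps)

lemma omega_sq: "\<omega> * \<omega> = \<omega> - of_int D"
proof -
  have "\<omega> * \<omega> = (1 + 2 * sp + sp * sp) / 4" by (simp add: \<omega>_def field_simps)
  also have "\<dots> = \<omega> - (of_nat p + 1) / 4" by (simp add: sp_sq \<omega>_def field_simps)
  also have "(of_nat p + 1 :: complex) = of_int (4 * D)" by (simp add: four_D)
  finally show ?thesis by simp
qed

lemma Im_omega: "Im \<omega> = sqrt p / 2" by (simp add: \<omega>_def sp_eq)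

lemma p_pos: "p > 0" using p_gt_3 by simp

lemma elt_inject: "elt x y = elt x' y' \<longleftrightarrow> x = x' \<and> y = y'"
proof
  assume e: "elt x y = elt x' y'"
  then have "Im (elt x y) = Im (elt x' y')" by simp
  then have "y = y'" using p_pos by (simp add: elt_def Im_omega)
  with e show "x = x' \<and> y = y'" by (simp add: elt_def)
qed simp

lemma elt_add: "elt x y + elt x' y' = elt (x + x') (y + y')"
  by (simp add: elt_def algebra_simps)

lemma elt_diff: "elt x y - elt x' y' = elt (x - x') (y - y')"
  by (simp add: elt_def algebra_simps)

lemma elt_minus: "- elt x y = elt (- x) (- y)"
  by (simp add: elt_def)

lemma elt_mult: "elt x y * elt x' y' = elt (x * x' - D * y * y') (x * y' + y * x' + y * y')"
proof -
  have "elt x y * elt x' y' = of_int (x * x') + of_int (x * y' + y * x') * \<omega> + of_int (y * y') * (\<omega> * \<omega>)"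
    by (simp add: elt_def algebra_simps)
  then show ?thesis by (simp add: omega_sq elt_def algebra_simps)
qed

lemma cnj_elt: "cnj (elt x y) = elt (x + y) (- y)"
  by (simp add: elt_def cnj_omega algebra_simps)

lemma elt_int: "of_int x = elt x 0" by (simp add: elt_def)

lemma norm_elt: "elt x y * cnj (elt x y) = of_int (x\<^sup>2 + x * y + D * y\<^sup>2)"
  unfolding cnj_elt elt_mult elt_int elt_inject by (simp add: power2_eq_square algebra_simps)

lemma OK_int [simp]: "of_int x \<in> OK" unfolding OK_def elt_int by blast
lemma OK_0 [simp]: "0 \<in> OK" using OK_int[of 0] by simp
lemma OK_1 [simp]: "1 \<in> OK" using OK_int[of 1] by simp
lemma OK_elt [simp]: "elt x y \<in> OK" unfolding OK_def by blast
lemma OK_omega [simp]: "\<omega> \<in> OK" using OK_elt[of 0 1] by (simp add: elt_def)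
lemma OK_add: "x \<in> OK \<Longrightarrow> y \<in> OK \<Longrightarrow> x + y \<in> OK" unfolding OK_def by (auto simp: elt_add elt_inject)
lemma OK_minus: "x \<in> OK \<Longrightarrow> - x \<in> OK" unfolding OK_def by (auto simp: elt_minus elt_inject)
lemma OK_mult: "x \<in> OK \<Longrightarrow> y \<in> OK \<Longrightarrow> x * y \<in> OK" unfolding OK_def by (auto simp: elt_mult elt_inject)
lemma OK_cnj: "x \<in> OK \<Longrightarrow> cnj x \<in> OK" unfolding OK_def by (auto simp: cnj_elt elt_inject)

lemma OK_rational_is_int:
  assumes "of_real x \<in> OK"
  shows "x \<in> \<int>"
proof -
  obtain u v where uv: "of_real x = elt u v" using assms by (auto simp: OK_def)
  then have "Im (elt u v) = 0" by (metis Im_complex_of_real)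
  then have "v = 0" using p_pos by (simp add: elt_def Im_omega)
  then have "x = Re (of_int u)" using uv by (metis Re_complex_of_real elt_int)
  then show ?thesis by simp
qed

lemma OK_algebraic_int: "z \<in> OK \<Longrightarrow> algebraic_int z"
proof -
  assume "z \<in> OK"
  then obtain x y where z: "z = elt x y" by (auto simp: OK_def)
  define N where "N = x\<^sup>2 + x * y + D * y\<^sup>2"
  define P where "P = [:N, - (2 * x + y), 1:]"
  have "z + cnj z = of_int (2 * x + y)" unfolding z cnj_elt elt_add elt_int elt_inject by simp
  moreover have "z * cnj z = of_int N" unfolding z norm_elt N_def ..
  ultimately have "z * z - of_int (2 * x + y) * z + of_int N = 0"
    by (metis add.commute add_diff_cancel_left' distrib_right left_diff_distrib mult.commute cancel_comm_monoid_add_class.diff_cancel diff_add_eq_diff_diff_swap diff_diff_eq2)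
  then have "poly (map_poly of_int P) z = 0"
    by (simp add: P_def map_poly_pCons algebra_simps)
  moreover have "lead_coeff P = 1" by (simp add: P_def)
  ultimately show ?thesis unfolding algebraic_int_altdef_ipoly by blast
qed

lemma OK_subset_field: "OK \<subseteq> quadratic_field (- int p)"
proof
  fix z assume "z \<in> OK"
  then obtain x y where z: "z = elt x y" by (auto simp: OK_def)
  have "z = of_rat (of_int x + of_int y / 2) + of_rat (of_int y / 2) * sp"
    by (simp add: z elt_def \<omega>_def of_rat_add of_rat_divide of_rat_mult field_simps)
  then show "z \<in> quadratic_field (- int p)" unfolding quadratic_field_def sp_def by blast
qed

text \<open>The powers of an algebraic integer have a common denominator, hence so do the powers of
  its norm, which is therefore an integer. Applied to z and z + 1 this gives an integral norm and
  trace; that p is an odd prime then restricts z to half-integral coordinates, and a parity argument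
  finishes.\<close>

lemma algebraic_int_imp_OK:
  assumes K: "z \<in> quadratic_field (- int p)" and alg: "algebraic_int z"
  shows "z \<in> OK"
proof -
  obtain r s where z: "z = of_rat r + of_rat s * sp"
    using K unfolding quadratic_field_def sp_def by blast
  \<comment> \<open>The order generated by sqrt (-p) over the integers, used as the reference for
    denominators.\<close>
  define L where "L = {of_int x + of_int y * sp | x y. True}"
  have L_add: "u + v \<in> L" if uL: "u \<in> L" "v \<in> L" for u v
  proof -
    obtain x y x' y' where "u = of_int x + of_int y * sp" "v = of_int x' + of_int y' * sp"
      using uL unfolding L_def by blast
    then have "u + v = of_int (x + x') + of_int (y + y') * sp" by (simp add: algebra_simps)
    then show ?thesis unfolding L_def by blast
  qed
  have L_int: "of_int c * u \<in> L" if uL: "u \<in> L" for c u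
  proof -
    obtain x y where "u = of_int x + of_int y * sp" using uL unfolding L_def by blast
    then have "of_int c * u = of_int (c * x) + of_int (c * y) * sp" by (simp add: algebra_simps)
    then show ?thesis unfolding L_def by blast
  qed
  have L_mult: "u * v \<in> L" if uL: "u \<in> L" "v \<in> L" for u v
  proof -
    obtain x y x' y' where uv: "u = of_int x + of_int y * sp" "v = of_int x' + of_int y' * sp"
      using uL unfolding L_def by blast
    have "u * v = of_int (x * x') + of_int (x * y' + y * x') * sp + of_int (y * y') * (sp * sp)"
      by (simp add: uv algebra_simps)
    also have "\<dots> = of_int (x * x' - int p * y * y') + of_int (x * y' + y * x') * sp"
      by (simp add: sp_sq algebra_simps)
    finally show ?thesis unfolding L_def by blast
  qed
  have L_0: "0 \<in> L" and L_1: "1 \<in> L"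
    by (auto simp: L_def intro: exI[of _ 0] exI[of _ 1])
  have L_sum: "(\<Sum>i\<in>A. f i) \<in> L" if "\<And>i. i \<in> A \<Longrightarrow> f i \<in> L" for A :: "nat set" and f
    using that by (induction A rule: infinite_finite_induct) (auto simp: L_0 L_add)
  obtain r1 r2 where r12: "quotient_of r = (r1, r2)" by (cases "quotient_of r")
  have r2: "r2 > 0" and r: "r = of_int r1 / of_int r2"
    using r12 quotient_of_denom_pos quotient_of_div by blast+
  obtain s1 s2 where s12: "quotient_of s = (s1, s2)" by (cases "quotient_of s")
  have s2: "s2 > 0" and s: "s = of_int s1 / of_int s2"
    using s12 quotient_of_denom_pos quotient_of_div by blast+
  define e where "e = r2 * s2"
  have e: "e \<noteq> 0" using r2 s2 by (simp add: e_def)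
  have ez: "of_int e * z \<in> L"
  proof -
    have "of_int e * z = of_int (r1 * s2) + of_int (s1 * r2) * sp"
      using r2 s2 by (simp add: z r s e_def of_rat_divide field_simps)
    then show ?thesis unfolding L_def by blast
  qed
  have ezn: "of_int e ^ n * z ^ n \<in> L" for n
  proof (induction n)
    case (Suc n)
    have "of_int e ^ Suc n * z ^ Suc n = (of_int e * z) * (of_int e ^ n * z ^ n)" by (simp add: mult_ac)
    then show ?case using L_mult[OF ez Suc] by (simp only:)
  qed (simp add: L_1)
  obtain P :: "int poly" where P: "poly (map_poly of_int P) z = 0" "lead_coeff P = 1"
    using alg unfolding algebraic_int_altdef_ipoly by blast
  define d where "d = degree P"
  \<comment> \<open>This clears the denominators of z^n for n up to the degree of the monic
    relation; all higher powers reduce to those through the relation, without new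
    denominators.\<close>
  define M where "M = e ^ d"
  have M: "M \<noteq> 0" using e by (simp add: M_def)
  have low: "of_int M * z ^ n \<in> L" if "n \<le> d" for n
  proof -
    have "M = e ^ (d - n) * e ^ n" unfolding M_def using that by (simp flip: power_add)
    then have "of_int M * z ^ n = of_int (e ^ (d - n)) * (of_int e ^ n * z ^ n)"
      by (simp add: mult_ac)
    then show ?thesis using L_int[OF ezn] by metis
  qed
  have zd: "z ^ d = - (\<Sum>i<d. of_int (coeff P i) * z ^ i)"
  proof -
    have "0 = (\<Sum>i\<le>d. of_int (coeff P i) * z ^ i)"
      using P(1) by (simp add: poly_altdef d_def degree_map_poly coeff_map_poly)
    also have "\<dots> = (\<Sum>i<d. of_int (coeff P i) * z ^ i) + z ^ d"
      using P(2) by (simp add: d_def flip: lessThan_Suc_atMost)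
    finally show ?thesis by (simp add: eq_neg_iff_add_eq_0 add.commute)
  qed
  have all: "of_int M * z ^ n \<in> L" for n
  proof (induction n rule: less_induct)
    case (less n)
    show ?case
    proof (cases "n \<le> d")
      case False
      then have "z ^ n = z ^ (n - d) * z ^ d" by (simp flip: power_add)
      also have "\<dots> = - (\<Sum>i<d. of_int (coeff P i) * z ^ (n - d + i))"
        unfolding zd by (simp add: sum_distrib_left power_add mult_ac)
      finally have "of_int M * z ^ n = (\<Sum>i<d. of_int (- coeff P i) * (of_int M * z ^ (n - d + i)))"
        by (simp add: sum_distrib_left sum_negf mult_ac)
      also have "\<dots> \<in> L"
        by (intro L_sum L_int less) (use False in auto)
      finally show ?thesis .
    qed (rule low)
  qed
  \<comment> \<open>The norm of z + 1 exceeds that of z by 2 r + 1, so its integrality gives that of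
    the trace 2 r.\<close>
  have all1: "of_int M * (z + 1) ^ n \<in> L" for n
  proof -
    have "of_int M * (z + 1) ^ n = (\<Sum>k\<le>n. of_int (int (n choose k)) * (of_int M * z ^ k))"
      by (simp add: binomial_ring sum_distrib_left mult_ac)
    also have "\<dots> \<in> L" by (intro L_sum L_int all)
    finally show ?thesis .
  qed
  have norm_int: "(r' + s')  \<in> \<int>"
    if w: "w = of_rat a + of_rat b * sp" and wL: "\<And>n. of_int M * w ^ n \<in> L"
      and rs: "r' = a * a" "s' = of_nat p * b * b" for w a b r' s'
  proof (rule rat_integral_if_powers_bounded_denominator[of "M * M"])
    show "M * M \<noteq> 0" using M by simp
    fix n
    obtain x y where xy: "of_int M * w ^ n = of_int x + of_int y * sp" using wL[of n] by (auto simp: L_def)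
    have cr: "cnj (of_rat c) = (of_rat c :: complex)" for c
      by (cases c) (simp add: of_rat_rat)
    have nw: "w * cnj w = of_rat (r' + s')"
    proof -
      have "w * cnj w = of_rat a * of_rat a - of_rat b * of_rat b * (sp * sp)"
        by (simp add: w cr cnj_sp algebra_simps)
      then show ?thesis by (simp add: sp_sq rs of_rat_add of_rat_mult algebra_simps)
    qed
    have "of_rat (of_int (M * M) * (r' + s') ^ n) = (of_int M * w ^ n) * cnj (of_int M * w ^ n)"
      by (simp add: of_rat_mult of_rat_power nw[symmetric] power_mult_distrib mult_ac)
    also have "\<dots> = of_int x * of_int x - of_int y * of_int y * (sp * sp)"
      unfolding xy by (simp add: cnj_sp algebra_simps)
    also have "\<dots> = of_rat (of_int (x * x + int p * y * y))"
      by (simp add: sp_sq algebra_simps of_rat_add of_rat_mult)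
    finally have "of_int (M * M) * (r' + s') ^ n = of_int (x * x + int p * y * y)"
      by (simp only: of_rat_eq_iff)
    then show "of_int (M * M) * (r' + s') ^ n \<in> \<int>" by (metis Ints_of_int)
  qed
  have n1: "r * r + of_nat p * s * s \<in> \<int>" using norm_int[OF z all] by simp
  have "z + 1 = of_rat (r + 1) + of_rat s * sp" by (simp add: z of_rat_add)
  from norm_int[OF this all1] have n2: "(r + 1) * (r + 1) + of_nat p * s * s \<in> \<int>" by simp
  have "2 * r = ((r + 1) * (r + 1) + of_nat p * s * s) - (r * r + of_nat p * s * s) - 1"
    by (simp add: algebra_simps)
  then have "2 * r \<in> \<int>" using n1 n2 by (metis Ints_1 Ints_diff)
  then obtain u where u: "2 * r = of_int u" by (auto elim: Ints_cases)
  obtain n where n: "r * r + of_nat p * s * s = of_int n" using n1 by (auto elim: Ints_cases)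
  \<comment> \<open>With s = s1/s2 in lowest terms this forces s2^2 to divide 4 p. Since p is an odd
    prime, s2 divides 2.\<close>
  have key: "u * u * (s2 * s2) + int p * (4 * (s1 * s1)) = 4 * n * (s2 * s2)"
  proof -
    have "(2 * r) * (2 * r) + of_nat p * (4 * (s * s)) = 4 * (of_int n :: rat)"
      using n by (simp add: algebra_simps)
    then have "(of_int (u * u * (s2 * s2) + int p * (4 * (s1 * s1))) :: rat) = of_int (4 * n * (s2 * s2))"
      unfolding u using s2 by (simp add: s field_simps)
    then show ?thesis using of_int_eq_iff by blast
  qed
  have cop: "coprime s1 s2" using s12 quotient_of_coprime by blast
  have "s2 * s2 dvd int p * (4 * (s1 * s1))"
  proof -
    have "int p * (4 * (s1 * s1)) = (s2 * s2) * (4 * n - u * u)" using key by (simp add: algebra_simps)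
    then show ?thesis by simp
  qed
  then have d1: "s2 * s2 dvd (int p * 4) * (s1 * s1)" by (simp add: mult_ac)
  have "coprime (s2 * s2) (s1 * s1)" using cop by (simp add: coprime_commute)
  then have d2: "s2 * s2 dvd int p * 4" using d1 by (simp add: coprime_dvd_mult_left_iff)
  have "s2 dvd 2"
  proof -
    have pi: "prime (int p)" using prime_p by simp
    have "\<not> int p dvd s2"
    proof
      assume "int p dvd s2"
      then have "int p * int p dvd s2 * s2" by (intro mult_dvd_mono)
      then have "int p * int p dvd int p * 4" using d2 dvd_trans by blast
      then have "int p dvd 4" using p_pos by simp
      then have "int p \<le> 4" by (rule zdvd_imp_le) simp
      then have "p = 4" using p_gt_3 by simp
      then show False using p_mod_4 by simp
    qed
    then have "coprime s2 (int p)" using pi by (metis coprime_commute prime_imp_coprime)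
    then have "coprime (s2 * s2) (int p)" by simp
    then have "s2 * s2 dvd 4" using d2 by (simp add: coprime_dvd_mult_right_iff)
    then have "s2\<^sup>2 dvd 2\<^sup>2" by (simp add: power2_eq_square)
    then show ?thesis by (metis pow_divides_pow_iff zero_less_numeral)
  qed
  then obtain t where t: "2 = s2 * t" by blast
  define v where "v = s1 * t"
  have vs: "2 * s = of_int v"
  proof -
    have "(2::rat) = of_int s2 * of_int t" using t by (metis of_int_mult of_int_numeral)
    then have "2 * s = of_int s2 * of_int t * (of_int s1 / of_int s2)" by (simp add: s)
    then show ?thesis using s2 by (simp add: v_def)
  qed
  have uv: "u * u + int p * (v * v) = 4 * n"
  proof -
    have "(2 * r) * (2 * r) + of_nat p * ((2 * s) * (2 * s)) = 4 * (of_int n :: rat)"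
      using n by (simp add: algebra_simps)
    then have "(of_int (u * u + int p * (v * v)) :: rat) = of_int (4 * n)"
      unfolding u vs by simp
    then show ?thesis using of_int_eq_iff by blast
  qed
  \<comment> \<open>Equal parity is what allows (u + v sqrt (-p))/2 to be rewritten as (u - v)/2 + v
    \<omega>.\<close>
  have "even (u - v)"
  proof -
    have "odd p" using p_mod_4 by presburger
    moreover have "even (u * u + int p * (v * v))" unfolding uv by simp
    ultimately show ?thesis by simp
  qed
  then obtain x where x: "u - v = 2 * x" by blast
  have "2 * z = of_rat (2 * r) + of_rat (2 * s) * sp" by (simp add: z of_rat_mult algebra_simps)
  also have "\<dots> = of_int u + of_int v * sp" unfolding u vs by simp
  also have "u = 2 * x + v" using x by simp
  finally have "z = elt x v" by (simp add: elt_def \<omega>_def field_simps)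
  then show ?thesis by simp
qed

lemma carrier_R: "carrier R = OK"
  unfolding ring_of_integers_def
  using OK_subset_field OK_algebraic_int algebraic_int_imp_OK by auto

lemma R_simps [simp]: "mult R = (*)" "add R = (+)" "one R = 1" "zero R = 0"
  by (simp_all add: ring_of_integers_def)

end

section \<open>Ideals as lattices\<close>

lemma int_subgroup_generator:
  fixes S :: "int set"
  assumes add: "\<And>x y. x \<in> S \<Longrightarrow> y \<in> S \<Longrightarrow> x - y \<in> S" and x0: "x0 \<in> S" "x0 \<noteq> 0"
  obtains g where "g > 0" "S = {g * u | u. True}"
proof -
  have z: "0 \<in> S" using add[OF x0(1) x0(1)] by simp
  have neg: "- x \<in> S" if "x \<in> S" for x using add[OF z that] by simp
  have plus: "x + y \<in> S" if "x \<in> S" "y \<in> S" for x y using add[OF that(1) neg[OF that(2)]] by simp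
  define g where "g = int (LEAST n. n > 0 \<and> int n \<in> S)"
  have "\<exists>n>0. int n \<in> S"
    by (rule exI[of _ "nat \<bar>x0\<bar>"]) (use x0 neg in \<open>auto simp: abs_if\<close>)
  then have g: "g > 0 \<and> g \<in> S"
    unfolding g_def using LeastI_ex[of "\<lambda>n. n > 0 \<and> int n \<in> S"] by auto
  have least: "g \<le> x" if "x \<in> S" "x > 0" for x
    unfolding g_def using Least_le[of "\<lambda>n. n > 0 \<and> int n \<in> S" "nat x"] that by simp
  have natmult: "g * int n \<in> S" for n by (induction n) (auto simp: z distrib_left g intro: plus)
  have mult: "g * u \<in> S" for u
    using natmult[of "nat u"] neg[OF natmult[of "nat (- u)"]] by (cases "u \<ge> 0") auto
  have "\<exists>u. x = g * u" if "x \<in> S" for x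
  proof -
    have "x mod g = x - g * (x div g)" by (simp add: minus_mult_div_eq_mod)
    then have "x mod g \<in> S" using add[OF that mult] by simp
    moreover have "x mod g < g" "x mod g \<ge> 0" using g by auto
    ultimately have "x mod g = 0" using least[of "x mod g"] by force
    then show ?thesis by (auto simp: mod_eq_0_iff_dvd)
  qed
  then show ?thesis using that[of g] g mult by auto
qed

context prime_discriminant
begin

lemma ring_R: "ring R"
proof (rule ringI)
  show "abelian_group R"
  proof (rule abelian_groupI)
    show "\<exists>y\<in>carrier R. y \<oplus>\<^bsub>R\<^esub> x = \<zero>\<^bsub>R\<^esub>" if "x \<in> carrier R" for x
      using that by (intro bexI[of _ "- x"]) (auto simp: carrier_R OK_minus)
  qed (auto simp: carrier_R OK_add algebra_simps)
  show "monoid R" by (rule monoidI) (auto simp: carrier_R OK_mult algebra_simps)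
qed (auto simp: algebra_simps)

text \<open>Ideals in plain complex arithmetic. There is no clause for negatives, since -1 lies in
  \<open>OK\<close>, and none for right multiplication, since the ring is commutative.\<close>

definition idl :: "complex set \<Rightarrow> bool" where
  "idl I \<longleftrightarrow> I \<subseteq> OK \<and> 0 \<in> I \<and> (\<forall>x\<in>I. \<forall>y\<in>I. x + y \<in> I) \<and> (\<forall>r\<in>OK. \<forall>x\<in>I. r * x \<in> I)"

lemma idl_sub: "idl I \<Longrightarrow> x \<in> I \<Longrightarrow> x \<in> OK" by (auto simp: idl_def)
lemma idl_add: "idl I \<Longrightarrow> x \<in> I \<Longrightarrow> y \<in> I \<Longrightarrow> x + y \<in> I" by (auto simp: idl_def)
lemma idl_mult: "idl I \<Longrightarrow> r \<in> OK \<Longrightarrow> x \<in> I \<Longrightarrow> r * x \<in> I" by (auto simp: idl_def)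
lemma idl_0: "idl I \<Longrightarrow> 0 \<in> I" by (auto simp: idl_def)
lemma idl_int: "idl I \<Longrightarrow> x \<in> I \<Longrightarrow> of_int n * x \<in> I" by (simp add: idl_mult)
lemma idl_minus: "idl I \<Longrightarrow> x \<in> I \<Longrightarrow> - x \<in> I" using idl_int[of I x "-1"] by simp
lemma idl_diff: "idl I \<Longrightarrow> x \<in> I \<Longrightarrow> y \<in> I \<Longrightarrow> x - y \<in> I"
  using idl_add[of I x "- y"] idl_minus[of I y] by simp

lemma ideal_iff_idl: "ideal I R \<longleftrightarrow> idl I"
proof
  assume I: "ideal I R"
  then have A: "additive_subgroup I R" by (rule ideal.axioms(1))
  show "idl I"
    unfolding idl_def
    using additive_subgroup.a_subset[OF A] additive_subgroup.zero_closed[OF A]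
      additive_subgroup.a_closed[OF A] ideal.I_l_closed[OF I]
    by (simp add: carrier_R)
next
  assume I: "idl I"
  interpret ring R by (rule ring_R)
  show "ideal I R"
  proof (rule idealI[OF ring_R])
    show "subgroup I (add_monoid R)"
    proof (rule group.subgroupI[OF a_group])
      show "I \<subseteq> carrier (add_monoid R)" using idl_sub[OF I] by (auto simp: carrier_R)
      show "I \<noteq> {}" using idl_0[OF I] by auto
      fix x assume x: "x \<in> I"
      have "\<ominus>\<^bsub>R\<^esub> x = - x"
        by (rule minus_equality) (use idl_sub[OF I x] in \<open>auto simp: carrier_R OK_minus\<close>)
      then show "inv\<^bsub>add_monoid R\<^esub> x \<in> I" using idl_minus[OF I x] by (simp add: a_inv_def)
      fix y assume "y \<in> I"
      then show "x \<otimes>\<^bsub>add_monoid R\<^esub> y \<in> I" using idl_add[OF I x] by simp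
    qed
    fix a x assume "a \<in> I" "x \<in> carrier R"
    then have "x * a \<in> I" using idl_mult[OF I] by (simp add: carrier_R)
    then show "x \<otimes>\<^bsub>R\<^esub> a \<in> I" "a \<otimes>\<^bsub>R\<^esub> x \<in> I" by (simp_all add: mult.commute)
  qed
qed

lemma nonzero_ideals_R: "nonzero_ideals R = {I. idl I \<and> I \<noteq> {0}}"
  by (simp add: nonzero_ideals_def ideal_iff_idl)

text \<open>Every nonzero ideal is \<open>lat k a b\<close>, that is \<open>k (\<int> a + \<int> (b + \<omega>))\<close>, with \<open>a\<close> dividing the norm of \<open>b + \<omega>\<close>.\<close>

definition lat :: "int \<Rightarrow> int \<Rightarrow> int \<Rightarrow> complex set" where
  "lat k a b = {elt (k * (a * u + b * v)) (k * v) | u v. True}"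

lemma latI: "x = elt (k * (a * u + b * v)) (k * v) \<Longrightarrow> x \<in> lat k a b"
  unfolding lat_def by blast

lemma latE:
  assumes "x \<in> lat k a b"
  obtains u v where "x = elt (k * (a * u + b * v)) (k * v)"
  using assms unfolding lat_def by blast

lemma idl_lat:
  assumes "a dvd b\<^sup>2 + b + D"
  shows "idl (lat k a b)"
  unfolding idl_def
proof (intro conjI ballI subsetI)
  obtain c where c: "b\<^sup>2 + b + D = a * c" using assms by blast
  show "0 \<in> lat k a b" using latI[of "elt 0 0" k a 0 b 0] by (simp add: elt_def)
  fix x assume "x \<in> lat k a b"
  then obtain u v where x: "x = elt (k * (a * u + b * v)) (k * v)" by (rule latE)
  show "x \<in> OK" by (simp add: x)
  {
    fix y assume "y \<in> lat k a b"
    then obtain u' v' where y: "y = elt (k * (a * u' + b * v')) (k * v')" by (rule latE)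
    show "x + y \<in> lat k a b"
      by (rule latI[of _ _ _ "u + u'" _ "v + v'"]) (simp add: x y elt_add elt_inject algebra_simps)
  }
  fix r assume "r \<in> OK"
  then obtain s t where r: "r = elt s t" by (auto simp: OK_def)
  have Dabc: "D = a * c - b\<^sup>2 - b" using c by simp
  \<comment> \<open>The coordinates are read off from the action of \<omega> on the basis: \<omega>
    a = -b a + a (b + \<omega>), and \<omega> (b + \<omega>) = -c a + (b + 1) (b +
    \<omega>).\<close>
  show "r * x \<in> lat k a b"
    by (intro latI[of _ _ _ "s * u - t * (b * u + c * v)" _ "s * v + t * (a * u + b * v + v)"])
      (simp add: x r elt_mult elt_inject Dabc algebra_simps power2_eq_square)
qed

lemma lat_nonzero: "k > 0 \<Longrightarrow> a > 0 \<Longrightarrow> lat k a b \<noteq> {0}"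
proof
  assume k: "k > 0" "a > 0" and l: "lat k a b = {0}"
  have "elt (k * (a * 1 + b * 0)) (k * 0) \<in> lat k a b" by (rule latI) (rule refl)
  then have "elt (k * a) 0 = elt 0 0" using l by (simp add: elt_def)
  then show False using k by (simp only: elt_inject) simp
qed

lemma lat_shift: "lat k a (b + a * n) = lat k a b"
proof (intro equalityI subsetI)
  fix x assume "x \<in> lat k a (b + a * n)"
  then obtain u v where "x = elt (k * (a * u + (b + a * n) * v)) (k * v)" by (rule latE)
  then show "x \<in> lat k a b"
    by (intro latI[of _ _ _ "u + n * v" _ v]) (simp add: elt_inject algebra_simps)
next
  fix x assume "x \<in> lat k a b"
  then obtain u v where "x = elt (k * (a * u + b * v)) (k * v)" by (rule latE)
  then show "x \<in> lat k a (b + a * n)"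
    by (intro latI[of _ _ _ "u - n * v" _ v]) (simp add: elt_inject algebra_simps)
qed

lemma lat_mod: "lat k a (b mod a) = lat k a b"
  using lat_shift[of k a "b mod a" "b div a"] by simp

text \<open>A Hermite normal form: A generates the integers in I and k generates the coefficients of
  \<omega>. Closure under \<omega> then makes k divide all coordinates. A nonzero integer in I comes
  from the norm of a nonzero element.\<close>

lemma idl_is_lat:
  assumes I: "idl I" "I \<noteq> {0}"
  obtains k a b where "k > 0" "a > 0" "0 \<le> b" "b < a" "a dvd b\<^sup>2 + b + D" "I = lat k a b"
proof -
  obtain z where z: "z \<in> I" "z \<noteq> 0" using I idl_0 by blast
  define X where "X = {x. elt x 0 \<in> I}"
  define Y where "Y = {y. \<exists>x. elt x y \<in> I}"
  obtain s t where st: "z = elt s t" using idl_sub[OF I(1) z(1)] by (auto simp: OK_def)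
  define n where "n = s\<^sup>2 + s * t + D * t\<^sup>2"
  have zz: "cnj z * z = elt n 0" using norm_elt[of s t] by (simp add: st n_def elt_int mult.commute)
  have nX: "n \<in> X"
    unfolding X_def using idl_mult[OF I(1) OK_cnj[OF idl_sub[OF I(1) z(1)]] z(1)] zz by simp
  have n0: "n \<noteq> 0"
  proof
    assume "n = 0"
    then have "cnj z * z = 0" using zz by (simp add: elt_def)
    then show False using z by simp
  qed
  obtain A where A: "A > 0" "X = {A * u | u. True}"
  proof (rule int_subgroup_generator[OF _ nX n0])
    show "x - y \<in> X" if "x \<in> X" "y \<in> X" for x y
      using that idl_diff[OF I(1), of "elt x 0" "elt y 0"] by (simp add: X_def elt_diff)
  qed blast
  have AX: "A \<in> X" using A(2) by (auto intro: exI[of _ 1])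
  have "\<omega> * elt A 0 = elt 0 A" by (simp add: elt_def mult.commute)
  then have AY: "A \<in> Y"
    using AX idl_mult[OF I(1) OK_omega, of "elt A 0"] by (auto simp: X_def Y_def)
  obtain k where k: "k > 0" "Y = {k * u | u. True}"
  proof (rule int_subgroup_generator[OF _ AY])
    show "x - y \<in> Y" if xy: "x \<in> Y" "y \<in> Y" for x y
    proof -
      obtain u v where "elt u x \<in> I" "elt v y \<in> I" using xy by (auto simp: Y_def)
      then have "elt (u - v) (x - y) \<in> I" using idl_diff[OF I(1)] by (simp flip: elt_diff)
      then show ?thesis by (auto simp: Y_def)
    qed
    show "A \<noteq> 0" using A by simp
  qed blast
  obtain a where a: "A = k * a" using AY k(2) by blast
  have a0: "a > 0" using A k a by (metis zero_less_mult_pos)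
  have "k \<in> Y" using k(2) by (auto intro: exI[of _ 1])
  then obtain x0 where x0: "elt x0 k \<in> I" by (auto simp: Y_def)
  \<comment> \<open>The coefficient of \<omega> in this product is x0 + k, which must be a multiple
    of k; hence k divides x0.\<close>
  have "\<omega> * elt x0 k = elt (- D * k) (x0 + k)"
    using elt_mult[of 0 1 x0 k] by (simp add: elt_def)
  then have "x0 + k \<in> Y" unfolding Y_def using idl_mult[OF I(1) OK_omega x0] by auto
  then obtain u0 where "x0 + k = k * u0" using k(2) by blast
  then have "k dvd x0 + k" by simp
  then have "k dvd x0" by simp
  then obtain b0 where b0: "x0 = k * b0" by blast
  have IX: "I = lat k a b0"
  proof (intro equalityI subsetI)
    fix x assume x: "x \<in> I"
    obtain c d where cd: "x = elt c d" using idl_sub[OF I(1) x] by (auto simp: OK_def)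
    have "d \<in> Y" using x cd by (auto simp: Y_def)
    then obtain v where v: "d = k * v" using k(2) by blast
    have "x - of_int v * elt x0 k \<in> I" by (intro idl_diff[OF I(1) x] idl_int[OF I(1) x0])
    moreover have "x - of_int v * elt x0 k = elt (c - v * x0) 0"
      unfolding cd elt_int elt_mult elt_diff elt_inject v by simp
    ultimately have "c - v * x0 \<in> X" by (simp add: X_def)
    then obtain u where "c - v * x0 = A * u" using A(2) by blast
    then have "c = k * (a * u + b0 * v)" by (simp add: a b0 algebra_simps)
    then show "x \<in> lat k a b0" using cd v by (auto intro: latI)
  next
    fix x assume "x \<in> lat k a b0"
    then obtain u v where x: "x = elt (k * (a * u + b0 * v)) (k * v)" by (rule latE)
    have "x = of_int u * elt A 0 + of_int v * elt x0 k"
      unfolding x elt_int elt_mult elt_add elt_inject by (simp add: a b0 algebra_simps)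
    then show "x \<in> I" using AX x0 by (auto simp: X_def intro!: idl_add[OF I(1)] idl_int[OF I(1)])
  qed
  have dv: "a dvd b0\<^sup>2 + b0 + D"
  proof -
    \<comment> \<open>The factor is the conjugate of b0 + \<omega>, so the product is k times the
      norm of b0 + \<omega>, an integer in I.\<close>
    have "elt (b0 + 1) (- 1) * elt x0 k \<in> I" by (rule idl_mult[OF I(1) _ x0]) simp
    moreover have "elt (b0 + 1) (- 1) * elt x0 k = elt (k * (b0\<^sup>2 + b0 + D)) 0"
      unfolding elt_mult elt_inject b0 by (simp add: algebra_simps power2_eq_square)
    ultimately have "k * (b0\<^sup>2 + b0 + D) \<in> X" by (simp add: X_def)
    then obtain u where "k * (b0\<^sup>2 + b0 + D) = A * u" using A(2) by blast
    then have "k * (b0\<^sup>2 + b0 + D) = k * (a * u)" by (simp add: a)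
    then have "b0\<^sup>2 + b0 + D = a * u" using k by simp
    then show ?thesis by simp
  qed
  have "[(b0 mod a)\<^sup>2 + b0 mod a + D = b0\<^sup>2 + b0 + D] (mod a)"
    by (intro cong_add cong_pow cong_refl) auto
  then have "a dvd (b0 mod a)\<^sup>2 + b0 mod a + D" using dv by (simp add: cong_dvd_iff)
  then show ?thesis
    using that[of k a "b0 mod a"] k a0 IX lat_mod[of k a b0] by simp
qed

lemma lat_inject:
  assumes "k > 0" "a > 0" "0 \<le> b" "b < a" "k' > 0" "a' > 0" "0 \<le> b'" "b' < a'"
    and eq: "lat k a b = lat k' a' b'"
  shows "k = k' \<and> a = a' \<and> b = b'"
proof -
  have k_dvd: "k2 dvd k1" and ka_dvd: "k2 * a2 dvd k1 * a1" if "lat k1 a1 b1 = lat k2 a2 b2" "k2 > 0"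
    for k1 a1 b1 k2 a2 b2
  proof -
    have "elt (k1 * (a1 * 0 + b1 * 1)) (k1 * 1) \<in> lat k2 a2 b2" using that(1) latI by blast
    then obtain u v where "elt (k1 * (a1 * 0 + b1 * 1)) (k1 * 1) = elt (k2 * (a2 * u + b2 * v)) (k2 * v)"
      by (rule latE)
    then have "k1 = k2 * v" by (simp add: elt_inject)
    then show "k2 dvd k1" by simp
    have "elt (k1 * (a1 * 1 + b1 * 0)) (k1 * 0) \<in> lat k2 a2 b2" using that(1) latI by blast
    then obtain u v where e: "elt (k1 * (a1 * 1 + b1 * 0)) (k1 * 0) = elt (k2 * (a2 * u + b2 * v)) (k2 * v)"
      by (rule latE)
    then have "v = 0" using that(2) by (simp add: elt_inject)
    then have "k1 * a1 = k2 * a2 * u" using e by (simp add: elt_inject)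
    then show "k2 * a2 dvd k1 * a1" by simp
  qed
  have k: "k = k'"
    using k_dvd[OF eq] k_dvd[OF eq[symmetric]] assms by (simp add: zdvd_antisym_nonneg)
  have "k * a = k' * a'"
    using ka_dvd[OF eq] ka_dvd[OF eq[symmetric]] assms by (simp add: zdvd_antisym_nonneg)
  then have a: "a = a'" using k assms by simp
  have "elt (k * (a * 0 + b * 1)) (k * 1) \<in> lat k' a' b'" using eq latI by blast
  then obtain u v where e: "elt (k * (a * 0 + b * 1)) (k * 1) = elt (k' * (a' * u + b' * v)) (k' * v)"
    by (rule latE)
  then have "v = 1" using k assms by (simp add: elt_inject)
  then have "b = a * u + b'" using e k a assms by (simp add: elt_inject)
  then have "b mod a = b' mod a" by (simp add: add.commute)
  then have "b = b'" using a assms by simp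
  with k a show ?thesis by simp
qed

text \<open>
  The norm of \<open>I\<close> is the positive generator \<open>n\<close> of the ideal \<open>I (cnj ` I)\<close>. That \<open>n\<close> is already an integral
  combination of three norms of elements reflects the primitivity of the norm form.
\<close>

definition inorm :: "complex set \<Rightarrow> int \<Rightarrow> bool" where
  "inorm I n \<longleftrightarrow> n > 0 \<and> (\<forall>x\<in>I. \<forall>y\<in>I. \<exists>r\<in>OK. x * cnj y = of_int n * r) \<and>
     (\<exists>x\<in>I. \<exists>y\<in>I. \<exists>z\<in>I. \<exists>i j l. of_int n = of_int i * (x * cnj x) + of_int j * (y * cnj y) + of_int l * (z * cnj z))"

text \<open>The form of the lattice is (a, 2 b + 1, c), of discriminant -p. The square of a common
  divisor of its coefficients would divide the prime p, so the form is primitive, and Bezout writes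
  1 through the coefficients.\<close>

lemma inorm_lat:
  assumes k: "k > 0" and a: "a > 0" and dv: "a dvd b\<^sup>2 + b + D"
  shows "inorm (lat k a b) (k\<^sup>2 * a)"
  unfolding inorm_def
proof (intro conjI ballI)
  show "0 < k\<^sup>2 * a" using k a by simp
  obtain c where c: "b\<^sup>2 + b + D = a * c" using dv by blast
  then have D: "D = a * c - b\<^sup>2 - b" by simp
  {
    fix x y assume "x \<in> lat k a b" "y \<in> lat k a b"
    then obtain u v u' v' where xy: "x = elt (k * (a * u + b * v)) (k * v)" "y = elt (k * (a * u' + b * v')) (k * v')"
      by (auto elim!: latE)
    have "x * cnj y = of_int (k\<^sup>2 * a) * elt (a * u * u' + u * v' * (b + 1) + v * u' * b + v * v' * c) (v * u' - u * v')"
      unfolding xy cnj_elt elt_int elt_mult elt_inject by (simp add: D power2_eq_square algebra_simps)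
    then show "\<exists>r\<in>OK. x * cnj y = of_int (k\<^sup>2 * a) * r" using OK_elt by blast
  }
  define g where "g = gcd a (gcd c (2 * b + 1))"
  have "g * g dvd int p"
  proof -
    have g: "g dvd a" "g dvd c" "g dvd 2 * b + 1"
      unfolding g_def by (meson dvd_trans gcd_dvd1 gcd_dvd2)+
    have "int p = 4 * (a * c) - (2 * b + 1) * (2 * b + 1)"
      unfolding c[symmetric] using four_D by (simp add: power2_eq_square algebra_simps)
    moreover have "g * g dvd 4 * (a * c)" using g by (simp add: mult_dvd_mono)
    moreover have "g * g dvd (2 * b + 1) * (2 * b + 1)" using g by (simp add: mult_dvd_mono)
    ultimately show ?thesis by simp
  qed
  have "g = 1"
  proof -
    have pp: "prime (int p)" using prime_p by simp
    have g0: "g > 0" using a by (simp add: g_def)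
    obtain h where h: "int p = g * (g * h)" using \<open>g * g dvd int p\<close> by (metis dvdE mult.assoc)
    then have "is_unit g \<or> is_unit (g * h)" using pp by (metis irreducibleD prime_elem_imp_irreducible prime_imp_prime_elem)
    then have "is_unit g" using dvd_mult_left by blast
    then show ?thesis using g0 by simp
  qed
  then obtain r s t where rst: "r * a + s * c + t * (2 * b + 1) = 1"
  proof -
    obtain r s where 1: "r * a + s * gcd c (2 * b + 1) = g" unfolding g_def using bezout_int by blast
    obtain s' t where 2: "s' * c + t * (2 * b + 1) = gcd c (2 * b + 1)" using bezout_int by blast
    have "r * a + (s * s') * c + (s * t) * (2 * b + 1) = g"
      unfolding 1[symmetric] 2[symmetric] by (simp add: algebra_simps)
    then show ?thesis using that \<open>g = 1\<close> by blast
  qed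
  \<comment> \<open>The two basis vectors and their sum. The sum is included because its norm brings
    in the middle coefficient 2 b + 1.\<close>
  let ?x = "elt (k * (a * 1 + b * 0)) (k * 0)"
  let ?y = "elt (k * (a * 0 + b * 1)) (k * 1)"
  let ?z = "elt (k * (a * 1 + b * 1)) (k * 1)"
  have mem: "?x \<in> lat k a b" "?y \<in> lat k a b" "?z \<in> lat k a b" using latI by blast+
  have N: "?x * cnj ?x = of_int (k\<^sup>2 * a * a)" "?y * cnj ?y = of_int (k\<^sup>2 * a * c)"
    "?z * cnj ?z = of_int (k\<^sup>2 * a * (a + (2 * b + 1) + c))"
    unfolding norm_elt of_int_eq_iff by (simp_all add: D power2_eq_square algebra_simps)
  have "k\<^sup>2 * a = k\<^sup>2 * a * (r * a + s * c + t * (2 * b + 1))" unfolding rst by simp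
  also have "\<dots> = (r - t) * (k\<^sup>2 * a * a) + (s - t) * (k\<^sup>2 * a * c) + t * (k\<^sup>2 * a * (a + (2 * b + 1) + c))"
    by (simp add: algebra_simps)
  finally have "of_int (k\<^sup>2 * a) = of_int (r - t) * (?x * cnj ?x) + of_int (s - t) * (?y * cnj ?y) + of_int t * (?z * cnj ?z)"
    unfolding N by (metis of_int_add of_int_mult)
  then show "\<exists>x\<in>lat k a b. \<exists>y\<in>lat k a b. \<exists>z\<in>lat k a b. \<exists>i j l. of_int (k\<^sup>2 * a)
    = of_int i * (x * cnj x) + of_int j * (y * cnj y) + of_int l * (z * cnj z)"
    using mem by blast
qed


section \<open>Ideal classes, conjugation and norms\<close>

abbreviation scale :: "complex \<Rightarrow> complex set \<Rightarrow> complex set" where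
  "scale z I \<equiv> (\<lambda>x. z * x) ` I"

abbreviation rel :: "(complex set \<times> complex set) set" where
  "rel \<equiv> ideal_class_rel R"

lemma scale_scale: "scale z (scale w I) = scale (z * w) I"
  by (simp add: image_image mult.assoc)

lemma rel_iff: "(I, J) \<in> rel \<longleftrightarrow> idl I \<and> I \<noteq> {0} \<and> idl J \<and> J \<noteq> {0} \<and>
    (\<exists>z\<in>OK - {0}. \<exists>w\<in>OK - {0}. scale z I = scale w J)"
  by (auto simp: ideal_class_rel_def nonzero_ideals_R carrier_R)

lemma equiv_rel: "equiv (nonzero_ideals R) rel"
proof (rule equivI)
  show "rel \<subseteq> nonzero_ideals R \<times> nonzero_ideals R" by (auto simp: ideal_class_rel_def)
  show "refl_on (nonzero_ideals R) rel"
    by (auto simp: refl_on_def rel_iff nonzero_ideals_R intro!: bexI[of _ 1])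
  show "sym rel"
  proof (rule symI)
    fix I J assume "(I, J) \<in> rel"
    then obtain z w where "z \<in> OK - {0}" "w \<in> OK - {0}" "scale z I = scale w J"
      and "idl I" "I \<noteq> {0}" "idl J" "J \<noteq> {0}"
      unfolding rel_iff by blast
    then show "(J, I) \<in> rel" unfolding rel_iff by (intro conjI bexI[of _ w] bexI[of _ z]) auto
  qed
  show "trans rel"
  proof (rule transI)
    fix I J K assume IJ: "(I, J) \<in> rel" and JK: "(J, K) \<in> rel"
    from IJ obtain z w where I: "idl I" "I \<noteq> {0}"
      and zw: "z \<in> OK - {0}" "w \<in> OK - {0}" "scale z I = scale w J"
      unfolding rel_iff by blast
    from JK obtain z' w' where K: "idl K" "K \<noteq> {0}"
      and zw': "z' \<in> OK - {0}" "w' \<in> OK - {0}" "scale z' J = scale w' K"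
      unfolding rel_iff by blast
    have "scale (z' * z) I = scale z' (scale w J)" by (simp only: scale_scale[symmetric] zw(3))
    also have "\<dots> = scale w (scale z' J)" unfolding scale_scale by (simp only: mult.commute[of z' w])
    also have "\<dots> = scale (w * w') K" by (simp only: zw'(3) scale_scale)
    finally have "scale (z' * z) I = scale (w * w') K" .
    moreover have "z' * z \<in> OK - {0}" "w * w' \<in> OK - {0}" using zw zw' by (auto simp: OK_mult)
    ultimately show "(I, K) \<in> rel"
      unfolding rel_iff using I K by (intro conjI bexI[of _ "z' * z"] bexI[of _ "w * w'"])
  qed
qed

lemma rel_trans: "(I, J) \<in> rel \<Longrightarrow> (J, K) \<in> rel \<Longrightarrow> (I, K) \<in> rel"
  using equiv_rel by (meson equivE transD)

lemma idl_cnj: "idl I \<Longrightarrow> idl (cnj ` I)"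
  unfolding idl_def
proof (intro conjI ballI subsetI; elim conjE)
  assume I: "I \<subseteq> OK" "0 \<in> I" "\<forall>x\<in>I. \<forall>y\<in>I. x + y \<in> I" "\<forall>r\<in>OK. \<forall>x\<in>I. r * x \<in> I"
  show "x \<in> OK" if "x \<in> cnj ` I" for x using that I OK_cnj by auto
  show "0 \<in> cnj ` I" using I(2) by force
  show "x + y \<in> cnj ` I" if "x \<in> cnj ` I" "y \<in> cnj ` I" for x y
    using that I(3) by (auto simp flip: complex_cnj_add)
  show "r * x \<in> cnj ` I" if rx: "r \<in> OK" "x \<in> cnj ` I" for r x
  proof -
    obtain y where y: "y \<in> I" "x = cnj y" using rx by blast
    have "r * x = cnj (cnj r * y)" by (simp add: y)
    moreover have "cnj r * y \<in> I" using I(4) y OK_cnj[OF rx(1)] by blast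
    ultimately show ?thesis by blast
  qed
qed

lemma cnj_image_cnj_image [simp]: "cnj ` cnj ` I = I"
  by (simp add: image_image)

lemma cnj_image_zero_iff: "cnj ` I = {0} \<longleftrightarrow> I = {0}"
proof
  assume "cnj ` I = {0}"
  then have "cnj ` cnj ` I = cnj ` {0}" by simp
  then show "I = {0}" unfolding cnj_image_cnj_image by simp
qed simp

lemma cnj_scale: "cnj ` scale z I = scale (cnj z) (cnj ` I)"
  by (simp add: image_image)

lemma rel_cnj: "(I, J) \<in> rel \<Longrightarrow> (cnj ` I, cnj ` J) \<in> rel"
  unfolding rel_iff
proof (elim conjE bexE, intro conjI)
  fix z w assume zw: "z \<in> OK - {0}" "w \<in> OK - {0}" "scale z I = scale w J"
  then have "scale (cnj z) (cnj ` I) = scale (cnj w) (cnj ` J)" by (metis cnj_scale)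
  moreover have "cnj z \<in> OK - {0}" "cnj w \<in> OK - {0}" using zw OK_cnj by auto
  ultimately show "\<exists>z\<in>OK - {0}. \<exists>w\<in>OK - {0}. scale z (cnj ` I) = scale w (cnj ` J)" by blast
qed (simp_all add: idl_cnj cnj_image_zero_iff)

text \<open>The integral combination for n, evaluated with the divisibility property of m, gives n =
  m r with r in \<open>OK\<close>; being rational, r is an integer.\<close>

lemma inorm_dvd:
  assumes "inorm I m" "inorm I n"
  shows "m dvd n"
proof -
  obtain x y z i j l where xyz: "x \<in> I" "y \<in> I" "z \<in> I"
    and n: "of_int n = of_int i * (x * cnj x) + of_int j * (y * cnj y) + of_int l * (z * cnj z)"
    using assms(2) unfolding inorm_def by blast
  obtain r1 r2 r3 where r: "r1 \<in> OK" "r2 \<in> OK" "r3 \<in> OK"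
    "x * cnj x = of_int m * r1" "y * cnj y = of_int m * r2" "z * cnj z = of_int m * r3"
    using assms(1) xyz unfolding inorm_def by meson
  have m0: "m > 0" using assms(1) by (simp add: inorm_def)
  define r where "r = of_int i * r1 + of_int j * r2 + of_int l * r3"
  have "r \<in> OK" unfolding r_def using r by (intro OK_add OK_mult) auto
  moreover have nr: "of_int n = of_int m * r" unfolding n r r_def by (simp add: algebra_simps)
  then have "r = of_real (of_int n / of_int m)" using m0 by (simp add: field_simps)
  ultimately have "(of_int n / of_int m :: real) \<in> \<int>" using OK_rational_is_int by metis
  then obtain q where "(of_int n / of_int m :: real) = of_int q" by (auto elim: Ints_cases)
  then have "(of_int n :: real) = of_int (m * q)" using m0 by (simp add: field_simps)
  then have "n = m * q" using of_int_eq_iff by blast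
  then show ?thesis by simp
qed

lemma inorm_unique: "inorm I m \<Longrightarrow> inorm I n \<Longrightarrow> m = n"
  using inorm_dvd[of I m n] inorm_dvd[of I n m] by (simp add: inorm_def zdvd_antisym_nonneg)

lemma inorm_cnj:
  assumes "inorm I n"
  shows "inorm (cnj ` I) n"
  unfolding inorm_def
proof (intro conjI ballI)
  show "n > 0" using assms by (simp add: inorm_def)
  {
    fix x y assume "x \<in> cnj ` I" "y \<in> cnj ` I"
    then obtain x' y' where xy: "x' \<in> I" "y' \<in> I" "x = cnj x'" "y = cnj y'" by blast
    then obtain r where "r \<in> OK" "y' * cnj x' = of_int n * r" using assms unfolding inorm_def by blast
    then show "\<exists>r\<in>OK. x * cnj y = of_int n * r" using xy by (auto simp: mult.commute)
  }
  obtain x y z i j l where "x \<in> I" "y \<in> I" "z \<in> I"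
    and "of_int n = of_int i * (x * cnj x) + of_int j * (y * cnj y) + of_int l * (z * cnj z)"
    using assms unfolding inorm_def by blast
  then show "\<exists>x\<in>cnj ` I. \<exists>y\<in>cnj ` I. \<exists>z\<in>cnj ` I. \<exists>i j l.
      of_int n = of_int i * (x * cnj x) + of_int j * (y * cnj y) + of_int l * (z * cnj z)"
    by (intro bexI[of _ "cnj x"] bexI[of _ "cnj y"] bexI[of _ "cnj z"] exI[of _ i] exI[of _ j] exI[of _ l])
      (auto simp: mult.commute)
qed

text \<open>The scalar may be any nonzero complex number, integral or not, since it will be an
  element of an ideal divided by the norm.\<close>

lemma inorm_scale:
  assumes n: "inorm I n" and z: "z \<noteq> 0" and m: "of_int m = z * cnj z * of_int n"
  shows "inorm (scale z I) m"
  unfolding inorm_def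
proof (intro conjI ballI)
  have "(of_int m :: complex) = of_real ((cmod z)\<^sup>2 * of_int n)"
    unfolding m of_real_mult complex_norm_square by simp
  then have "(of_int m :: real) = (cmod z)\<^sup>2 * of_int n"
    by (metis of_real_eq_iff of_real_of_int_eq)
  moreover have "(cmod z)\<^sup>2 * of_int n > 0" using n z by (simp add: inorm_def)
  ultimately have "(0::real) < of_int m" by simp
  then show "m > 0" by simp
  {
    fix x y assume "x \<in> scale z I" "y \<in> scale z I"
    then obtain x' y' where xy: "x' \<in> I" "y' \<in> I" "x = z * x'" "y = z * y'" by blast
    then obtain r where r: "r \<in> OK" "x' * cnj y' = of_int n * r" using n unfolding inorm_def by blast
    have "x * cnj y = z * cnj z * (x' * cnj y')" by (simp add: xy)
    also have "\<dots> = of_int m * r" unfolding r(2) m by (simp add: mult_ac)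
    finally show "\<exists>r\<in>OK. x * cnj y = of_int m * r" using r(1) by blast
  }
  obtain x y w i j l where xyz: "x \<in> I" "y \<in> I" "w \<in> I"
    and n': "of_int n = of_int i * (x * cnj x) + of_int j * (y * cnj y) + of_int l * (w * cnj w)"
    using n unfolding inorm_def by blast
  have "of_int m = of_int i * (z * x * cnj (z * x)) + of_int j * (z * y * cnj (z * y)) + of_int l * (z * w * cnj (z * w))"
    unfolding m n' by (simp add: algebra_simps)
  then show "\<exists>x\<in>scale z I. \<exists>y\<in>scale z I. \<exists>w\<in>scale z I. \<exists>i j l.
      of_int m = of_int i * (x * cnj x) + of_int j * (y * cnj y) + of_int l * (w * cnj w)"
    using xyz by blast
qed

text \<open>A unit x + y \<omega> has norm 1, that is (2 x + y)^2 + p y^2 = 4. As p exceeds 4, this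
  leaves y = 0.\<close>

lemma OK_unit:
  assumes u: "u \<in> OK" "w \<in> OK" "u * w = 1"
  shows "u = 1 \<or> u = -1"
proof -
  have nonneg: "x\<^sup>2 + x * y + D * y\<^sup>2 \<ge> 0" for x y
  proof -
    define m where "m = x\<^sup>2 + x * y + D * y\<^sup>2"
    have "4 * m = (2 * x + y)\<^sup>2 + int p * y\<^sup>2"
      unfolding m_def using four_D by (simp add: power2_eq_square algebra_simps)
    moreover have "(2 * x + y)\<^sup>2 + int p * y\<^sup>2 \<ge> 0" by simp
    ultimately have "m \<ge> 0" by linarith
    then show ?thesis by (simp add: m_def)
  qed
  obtain x y x' y' where xy: "u = elt x y" "w = elt x' y'" using u unfolding OK_def by blast
  define N where "N = x\<^sup>2 + x * y + D * y\<^sup>2"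
  define N' where "N' = x'\<^sup>2 + x' * y' + D * y'\<^sup>2"
  have "of_int (N * N') = (u * cnj u) * (w * cnj w)"
    unfolding xy norm_elt N_def N'_def by simp
  also have "\<dots> = (u * w) * cnj (u * w)" by simp
  finally have "N * N' = 1" unfolding u(3) by (metis complex_cnj_one mult_1 of_int_1 of_int_eq_iff)
  moreover have "N \<ge> 0" using nonneg[of x y] by (simp add: N_def)
  ultimately have "N = 1" by (auto simp: zmult_eq_1_iff)
  moreover have "4 * N = (2 * x + y)\<^sup>2 + int p * y\<^sup>2"
    unfolding N_def using four_D by (simp add: power2_eq_square algebra_simps)
  ultimately have eq: "(2 * x + y)\<^sup>2 + int p * y\<^sup>2 = 4" by simp
  have "y = 0"
  proof (rule ccontr)
    assume "y \<noteq> 0"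
    then have "1 \<le> y\<^sup>2" by (simp add: int_one_le_iff_zero_less)
    then have "int p * 1 \<le> int p * y\<^sup>2" by (intro mult_left_mono) auto
    moreover have "(2 * x + y)\<^sup>2 \<ge> 0" by simp
    ultimately have "int p \<le> 4" using eq by linarith
    then have "p = 4" using p_gt_3 by simp
    then show False using p_mod_4 by simp
  qed
  then have "x\<^sup>2 = 1" using eq by (simp add: power_mult_distrib)
  then have "x = 1 \<or> x = -1" by (simp add: power2_eq_1_iff)
  then show ?thesis using \<open>y = 0\<close> xy by (auto simp: elt_def)
qed

text \<open>Multiplication by \<open>v\<close> carries \<open>I\<^sup>-\<^sup>1\<close>, which is \<open>cnj ` I\<close> divided by the norm \<open>N\<close> of \<open>I\<close>, to an integral ideal
  exactly when \<open>v \<in> I\<close>.\<close>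

lemma idl_quotient:
  assumes I: "idl I" "inorm I N" "I \<noteq> {0}" and v: "v \<in> I" "v \<noteq> 0"
  shows "idl (scale (v / of_int N) (cnj ` I))" "scale (v / of_int N) (cnj ` I) \<noteq> {0}"
    "(scale (v / of_int N) (cnj ` I), cnj ` I) \<in> rel"
proof -
  have N: "N > 0" using I by (simp add: inorm_def)
  have cI: "idl (cnj ` I)" by (rule idl_cnj[OF I(1)])
  show J: "idl (scale (v / of_int N) (cnj ` I))"
    unfolding idl_def
  proof (intro conjI ballI subsetI)
    show "0 \<in> scale (v / of_int N) (cnj ` I)" using idl_0[OF cI] by force
    fix x assume "x \<in> scale (v / of_int N) (cnj ` I)"
    then obtain y where y: "y \<in> I" "x = v / of_int N * cnj y" by blast
    obtain r where "r \<in> OK" "v * cnj y = of_int N * r" using I(2) v(1) y(1) unfolding inorm_def by blast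
    then show "x \<in> OK" using y N by (simp add: field_simps)
    {
      fix x' assume "x' \<in> scale (v / of_int N) (cnj ` I)"
      then obtain y' where y': "y' \<in> cnj ` I" "x' = v / of_int N * y'" by blast
      have "x + x' = v / of_int N * (cnj y + y')" using y y' by (simp only: distrib_left)
      moreover have "cnj y + y' \<in> cnj ` I" using idl_add[OF cI] y y' by blast
      ultimately show "x + x' \<in> scale (v / of_int N) (cnj ` I)" by blast
    }
    fix r assume "r \<in> OK"
    then have "r * cnj y \<in> cnj ` I" using idl_mult[OF cI] y by blast
    moreover have "r * x = v / of_int N * (r * cnj y)" by (simp add: y)
    ultimately show "r * x \<in> scale (v / of_int N) (cnj ` I)" by blast
  qed
  show nz: "scale (v / of_int N) (cnj ` I) \<noteq> {0}"
  proof -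
    have "v / of_int N * cnj v \<in> scale (v / of_int N) (cnj ` I)" using v by blast
    moreover have "v / of_int N * cnj v \<noteq> 0" using v N by simp
    ultimately show ?thesis by blast
  qed
  have "scale (of_int N) (scale (v / of_int N) (cnj ` I)) = scale v (cnj ` I)"
    unfolding scale_scale using N by simp
  moreover have "of_int N \<in> OK - {0}" "v \<in> OK - {0}" using N v idl_sub[OF I(1)] by auto
  ultimately show "(scale (v / of_int N) (cnj ` I), cnj ` I) \<in> rel"
    unfolding rel_iff using J nz cI I(3) by (auto simp: cnj_image_zero_iff)
qed

text \<open>Since N is an integral combination of norms from I, u is an integral combination of the
  numbers u x (cnj x) / N. Membership of u in an additive group can thus be tested after multiplying
  by single norms, a substitute for the ideal identity that I times its conjugate is generated by
  N.\<close>

lemma inorm_combination: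
  assumes "inorm I N" and "\<And>x. x \<in> I \<Longrightarrow> u * (x * cnj x) / of_int N \<in> A"
    and "\<And>x y. x \<in> A \<Longrightarrow> y \<in> A \<Longrightarrow> x + y \<in> A" and "\<And>n x. x \<in> A \<Longrightarrow> of_int n * x \<in> A"
  shows "u \<in> A"
proof -
  obtain x y z i j l where xyz: "x \<in> I" "y \<in> I" "z \<in> I"
    and n: "of_int N = of_int i * (x * cnj x) + of_int j * (y * cnj y) + of_int l * (z * cnj z)"
    using assms(1) unfolding inorm_def by blast
  have "u = u * of_int N / of_int N" using assms(1) by (simp add: inorm_def)
  also have "\<dots> = of_int i * (u * (x * cnj x) / of_int N) + of_int j * (u * (y * cnj y) / of_int N)
      + of_int l * (u * (z * cnj z) / of_int N)"
    unfolding n by (simp only: distrib_left add_divide_distrib times_divide_eq_right mult.left_commute)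
  finally have u: "u = of_int i * (u * (x * cnj x) / of_int N) + of_int j * (u * (y * cnj y) / of_int N)
      + of_int l * (u * (z * cnj z) / of_int N)" .
  show ?thesis by (subst u) (intro assms(2-4) xyz)
qed

lemma quotient_mem:
  assumes I: "idl I" "inorm I N" and J: "idl (scale (v / of_int N) (cnj ` I))"
  shows "v \<in> I"
proof (rule inorm_combination[OF I(2)])
  fix x assume x: "x \<in> I"
  have "v / of_int N * cnj x \<in> OK" using idl_sub[OF J] x by blast
  then have "(v / of_int N * cnj x) * x \<in> I" using idl_mult[OF I(1) _ x] by blast
  then show "v * (x * cnj x) / of_int N \<in> I" by (simp add: mult_ac)
qed (auto intro: idl_add[OF I(1)] idl_int[OF I(1)])

lemma quotient_exists:
  assumes I: "inorm I N" and J: "(J, cnj ` I) \<in> rel"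
  obtains v where "v \<noteq> 0" "J = scale (v / of_int N) (cnj ` I)"
proof -
  have N: "N > 0" using I by (simp add: inorm_def)
  obtain z w where zw: "z \<in> OK - {0}" "w \<in> OK - {0}" "scale z J = scale w (cnj ` I)"
    using J unfolding rel_iff by blast
  have "J = scale (1 / z) (scale z J)" unfolding scale_scale using zw(1) by simp
  also have "\<dots> = scale (of_int N * w / z / of_int N) (cnj ` I)"
    unfolding zw(3) scale_scale using N by simp
  finally show ?thesis using that[of "of_int N * w / z"] zw N by simp
qed

text \<open>The ratio w/v and its inverse both preserve a fractional ideal, so both lie in
  \<open>OK\<close>, and \<open>OK_unit\<close> applies.\<close>

lemma quotient_unique:
  assumes I: "idl I" "inorm I N" and v: "v \<noteq> 0" "w \<noteq> 0"
    and eq: "scale (v / of_int N) (cnj ` I) = scale (w / of_int N) (cnj ` I)"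
  shows "w = v \<or> w = - v"
proof -
  have N: "N > 0" using I by (simp add: inorm_def)
  have unit: "y / x \<in> OK" if "x \<noteq> 0" "scale (x / of_int N) (cnj ` I) = scale (y / of_int N) (cnj ` I)" for x y
  proof (rule inorm_combination[OF I(2)])
    fix t assume t: "t \<in> I"
    have "y / of_int N * cnj t \<in> scale (x / of_int N) (cnj ` I)" using that(2) t by blast
    then obtain s where s: "s \<in> I" "y / of_int N * cnj t = x / of_int N * cnj s" by blast
    obtain r where r: "r \<in> OK" "t * cnj s = of_int N * r" using I(2) t s(1) unfolding inorm_def by blast
    have "y / x * cnj t = cnj s" using s(2) N that(1) by (simp add: field_simps)
    then have "y / x * (t * cnj t) = t * cnj s" by (metis mult.left_commute)
    then have "y / x * (t * cnj t) / of_int N = r" using r(2) N by simp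
    then show "y / x * (t * cnj t) / of_int N \<in> OK" using r by simp
  qed (auto intro: OK_add OK_mult)
  have "w / v \<in> OK" "v / w \<in> OK" using unit[OF v(1) eq] unit[OF v(2) eq[symmetric]] by auto
  moreover have "(w / v) * (v / w) = 1" using v by simp
  ultimately have "w / v = 1 \<or> w / v = -1" by (rule OK_unit)
  then show ?thesis using v by (auto simp: field_simps)
qed

lemma card_ideals_of_norm:
  assumes n: "n > 0"
  shows "finite {J. idl J \<and> J \<noteq> {0} \<and> inorm J (int n)}"
    and "int (card {J. idl J \<and> J \<noteq> {0} \<and> inorm J (int n)}) = root_count D n"
proof -
  define S where "S = (SIGMA k:{k. k\<^sup>2 dvd n}. quad_roots D (n div k\<^sup>2))"
  define \<Phi> where "\<Phi> = (\<lambda>(k::nat, b). lat (int k) (int (n div k\<^sup>2)) b)"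
  have pos: "k > 0" "n div k\<^sup>2 > 0" "n = k\<^sup>2 * (n div k\<^sup>2)" if "k\<^sup>2 dvd n" for k
    using that n by (auto intro!: Nat.gr0I elim!: dvdE)
  have "bij_betw \<Phi> S {J. idl J \<and> J \<noteq> {0} \<and> inorm J (int n)}"
  proof (rule bij_betw_imageI)
    show "inj_on \<Phi> S"
    proof (rule inj_onI)
      fix x y assume xy: "x \<in> S" "y \<in> S" "\<Phi> x = \<Phi> y"
      obtain k b k' b' where kb: "x = (k, b)" "y = (k', b')" by (cases x, cases y)
      have k: "k\<^sup>2 dvd n" "k'\<^sup>2 dvd n" and b: "b \<in> quad_roots D (n div k\<^sup>2)" "b' \<in> quad_roots D (n div k'\<^sup>2)"
        using xy kb by (auto simp: S_def)
      have "int k = int k' \<and> int (n div k\<^sup>2) = int (n div k'\<^sup>2) \<and> b = b'"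
        by (rule lat_inject) (use xy kb b pos[OF k(1)] pos[OF k(2)] in \<open>auto simp: \<Phi>_def quad_roots_def\<close>)
      then show "x = y" using kb by simp
    qed
    show "\<Phi> ` S = {J. idl J \<and> J \<noteq> {0} \<and> inorm J (int n)}"
    proof (intro equalityI subsetI)
      fix J assume "J \<in> \<Phi> ` S"
      then obtain k b where kb: "J = lat (int k) (int (n div k\<^sup>2)) b" "k\<^sup>2 dvd n" "b \<in> quad_roots D (n div k\<^sup>2)"
        by (auto simp: S_def \<Phi>_def)
      have p: "int k > 0" "int (n div k\<^sup>2) > 0" using pos[OF kb(2)] by (auto simp only: of_nat_0_less_iff)
      have d: "int (n div k\<^sup>2) dvd b\<^sup>2 + b + D" using kb(3) by (simp add: quad_roots_def)
      have "int n = (int k)\<^sup>2 * int (n div k\<^sup>2)" using pos(3)[OF kb(2)] by (metis of_nat_mult of_nat_power)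
      then show "J \<in> {J. idl J \<and> J \<noteq> {0} \<and> inorm J (int n)}"
        using inorm_lat[OF p d] idl_lat[OF d] lat_nonzero[OF p] kb(1) by simp
    next
      fix J assume "J \<in> {J. idl J \<and> J \<noteq> {0} \<and> inorm J (int n)}"
      then have J: "idl J" "J \<noteq> {0}" "inorm J (int n)" by auto
      obtain k a b where kab: "k > 0" "a > 0" "0 \<le> b" "b < a" "a dvd b\<^sup>2 + b + D" "J = lat k a b"
        using idl_is_lat[OF J(1,2)] by blast
      have "int n = k\<^sup>2 * a" using inorm_unique[OF J(3)] inorm_lat[OF kab(1,2,5)] kab(6) by simp
      moreover have "int ((nat k)\<^sup>2 * nat a) = k\<^sup>2 * a" using kab by simp
      ultimately have nn: "n = (nat k)\<^sup>2 * nat a" by linarith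
      have k0: "nat k > 0" using kab by simp
      have "J = \<Phi> (nat k, b)" using kab k0 by (simp add: \<Phi>_def nn)
      moreover have "(nat k, b) \<in> S" using kab k0 by (simp add: S_def nn quad_roots_def)
      ultimately show "J \<in> \<Phi> ` S" by blast
    qed
  qed
  moreover have "finite S" unfolding S_def using finite_square_divisors[OF n] by auto
  moreover have "int (card S) = root_count D n"
    unfolding S_def root_count_def using finite_square_divisors[OF n] by (simp add: card_SigmaI)
  ultimately show "finite {J. idl J \<and> J \<noteq> {0} \<and> inorm J (int n)}"
    "int (card {J. idl J \<and> J \<noteq> {0} \<and> inorm J (int n)}) = root_count D n"
    by (simp_all add: bij_betw_finite bij_betw_same_card)
qed

end

section \<open>The class number formula\<close>

context prime_discriminant
begin

abbreviation ideal_classes :: "complex set set set" where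
  "ideal_classes \<equiv> nonzero_ideals R // rel"

lemma class_number_eq: "class_number (quadratic_field (- int p)) = card ideal_classes"
  by (simp add: class_number_def Let_def)

lemma lat_scale: "lat k a b = scale (of_int k) (lat 1 a b)"
proof (intro equalityI subsetI)
  fix x assume "x \<in> lat k a b"
  then obtain u v where "x = elt (k * (a * u + b * v)) (k * v)" by (rule latE)
  then have "x = of_int k * elt (1 * (a * u + b * v)) (1 * v)"
    by (simp add: elt_int elt_mult elt_inject)
  then show "x \<in> scale (of_int k) (lat 1 a b)" using latI by blast
next
  fix x assume "x \<in> scale (of_int k) (lat 1 a b)"
  then obtain y where y: "y \<in> lat 1 a b" "x = of_int k * y" by blast
  obtain u v where "y = elt (1 * (a * u + b * v)) (1 * v)" using y(1) by (rule latE)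
  then have "x = elt (k * (a * u + b * v)) (k * v)"
    unfolding y(2) by (simp add: elt_int elt_mult elt_inject)
  then show "x \<in> lat k a b" by (rule latI)
qed

lemma class_primitive:
  assumes "C \<in> ideal_classes"
  shows "\<exists>a b. a > 0 \<and> a dvd b\<^sup>2 + b + D \<and> lat 1 a b \<in> C"
proof -
  obtain I where I: "I \<in> nonzero_ideals R" "C = rel `` {I}" using assms by (auto elim: quotientE)
  then have i: "idl I" "I \<noteq> {0}" by (auto simp: nonzero_ideals_R)
  obtain k a b where kab: "k > 0" "a > 0" "a dvd b\<^sup>2 + b + D" "I = lat k a b"
    using idl_is_lat[OF i] by blast
  have "scale 1 I = scale (of_int k) (lat 1 a b)" using lat_scale[of k a b] kab(4) by simp
  moreover have "of_int k \<in> OK - {0}" "1 \<in> OK - {0}" using kab by auto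
  ultimately have "(I, lat 1 a b) \<in> rel"
    unfolding rel_iff using i idl_lat[OF kab(3), of 1] lat_nonzero[of 1 a b] kab(2)
    by (intro conjI bexI[of _ 1] bexI[of _ "of_int k"]) auto
  then show ?thesis using kab I(2) by blast
qed

lemma form_pos:
  assumes "a > 0" "b\<^sup>2 + b + D = a * c"
  shows "4 * a * c - (2 * b + 1)\<^sup>2 = int p" "c > 0"
proof -
  have "4 * (b\<^sup>2 + b + D) - (2 * b + 1)\<^sup>2 = int p"
    using four_D by (simp add: power2_eq_square algebra_simps)
  then show e: "4 * a * c - (2 * b + 1)\<^sup>2 = int p" unfolding assms(2) by simp
  have "(2 * b + 1)\<^sup>2 \<ge> 0" by simp
  then have "0 < 4 * a * c" using e p_pos by linarith
  then show "c > 0" using assms(1) by (simp add: zero_less_mult_iff)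
qed

text \<open>Multiplication by -1 - b + \<omega>, the negative conjugate of b + \<omega>, sends b +
  \<omega> to -a c. The image is a times the other lattice. On forms this is the step of Gauss
  reduction that exchanges the outer coefficients.\<close>

lemma lat_reduction:
  assumes a: "a > 0" and c: "b\<^sup>2 + b + D = a * c"
  shows "(lat 1 a b, lat 1 c (- 1 - b)) \<in> rel"
proof -
  define b' where "b' = - 1 - b"
  have c0: "c > 0" using form_pos[OF assms] by simp
  have c': "b'\<^sup>2 + b' + D = c * a" using c by (simp add: b'_def power2_eq_square algebra_simps)
  have D: "D = a * c - b\<^sup>2 - b" using c by simp
  have mul: "elt b' 1 * elt (1 * (a * u + b * v)) (1 * v) = of_int a * elt (1 * (c * (- v) + b' * u)) (1 * u)" for u v
    unfolding elt_int elt_mult elt_inject by (simp add: b'_def D power2_eq_square algebra_simps)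
  have "scale (elt b' 1) (lat 1 a b) = scale (of_int a) (lat 1 c b')"
  proof (intro equalityI subsetI)
    fix x assume "x \<in> scale (elt b' 1) (lat 1 a b)"
    then obtain y where y: "y \<in> lat 1 a b" "x = elt b' 1 * y" by blast
    obtain u v where "y = elt (1 * (a * u + b * v)) (1 * v)" using y(1) by (rule latE)
    then have "x = of_int a * elt (1 * (c * (- v) + b' * u)) (1 * u)" using y(2) mul by simp
    then show "x \<in> scale (of_int a) (lat 1 c b')" using latI by blast
  next
    fix x assume "x \<in> scale (of_int a) (lat 1 c b')"
    then obtain y where y: "y \<in> lat 1 c b'" "x = of_int a * y" by blast
    obtain u v where "y = elt (1 * (c * u + b' * v)) (1 * v)" using y(1) by (rule latE)
    then have "x = elt b' 1 * elt (1 * (a * v + b * (- u))) (1 * (- u))"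
      using y(2) mul[of v "- u"] by simp
    then show "x \<in> scale (elt b' 1) (lat 1 a b)" using latI by blast
  qed
  moreover have "elt b' 1 \<noteq> 0" using elt_inject[of b' 1 0 0] by (simp add: elt_def)
  then have "elt b' 1 \<in> OK - {0}" "of_int a \<in> OK - {0}" using a by auto
  moreover have "idl (lat 1 a b)" "idl (lat 1 c b')"
    using c c' by (auto intro!: idl_lat)
  moreover have "lat 1 a b \<noteq> {0}" "lat 1 c b' \<noteq> {0}" using lat_nonzero a c0 by auto
  ultimately show ?thesis unfolding rel_iff b'_def[symmetric] by blast
qed

text \<open>Choose the least a in the class and shift b until |2 b + 1| \<le> a. The exchange of a
  and c gives a \<le> c by minimality, so p = 4 a c - (2 b + 1)^2 \<ge> 3 a^2 bounds a.\<close>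

lemma class_reduced:
  assumes C: "C \<in> ideal_classes"
  shows "\<exists>a b. 0 < a \<and> a \<le> int p \<and> 0 \<le> b \<and> b < a \<and> C = rel `` {lat 1 a b}"
proof -
  define P where "P n \<longleftrightarrow> n > 0 \<and> (\<exists>b. int n dvd b\<^sup>2 + b + D \<and> lat 1 (int n) b \<in> C)" for n
  have "\<exists>n. P n"
  proof -
    obtain a b where "a > 0" "a dvd b\<^sup>2 + b + D" "lat 1 a b \<in> C" using class_primitive[OF C] by blast
    then have "P (nat a)" by (auto simp: P_def)
    then show ?thesis by blast
  qed
  define n where "n = (LEAST n. P n)"
  have Pn: "P n" unfolding n_def using \<open>\<exists>n. P n\<close> by (rule LeastI_ex)
  have least: "n \<le> n'" if "P n'" for n' unfolding n_def using that by (rule Least_le)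
  define a where "a = int n"
  have a: "a > 0" using Pn by (simp add: P_def a_def)
  obtain b where b: "a dvd b\<^sup>2 + b + D" "lat 1 a b \<in> C" using Pn by (auto simp: P_def a_def)
  define h where "h = a div 2"
  \<comment> \<open>The representative of b modulo a for which 2 b1 + 1 lies between -a and
    a.\<close>
  define b1 where "b1 = (b + h) mod a - h"
  have "0 \<le> b1 + h" "b1 + h < a" using a by (auto simp: b1_def)
  moreover have "2 * h \<le> a" "a \<le> 2 * h + 1" unfolding h_def by presburger+
  ultimately have bd: "\<bar>2 * b1 + 1\<bar> \<le> a" by presburger
  have b1: "b1 = b + a * (- ((b + h) div a))"
    using mult_div_mod_eq[of a "b + h"] by (simp add: b1_def algebra_simps)
  have lat1: "lat 1 a b1 = lat 1 a b" unfolding b1 by (rule lat_shift)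
  have "[b1 = b] (mod a)" unfolding b1 by (simp add: cong_iff_dvd_diff)
  then have "[b1\<^sup>2 + b1 + D = b\<^sup>2 + b + D] (mod a)" by (intro cong_add cong_pow cong_refl)
  then have "a dvd b1\<^sup>2 + b1 + D" using b by (simp add: cong_dvd_iff)
  then obtain c where c: "b1\<^sup>2 + b1 + D = a * c" by blast
  have c0: "c > 0" and disc: "4 * a * c - (2 * b1 + 1)\<^sup>2 = int p" using form_pos[OF a c] by auto
  obtain I where I: "I \<in> nonzero_ideals R" "C = rel `` {I}" using C by (auto elim: quotientE)
  have r1: "(I, lat 1 a b1) \<in> rel" using b(2) I lat1 by simp
  then have "(I, lat 1 c (- 1 - b1)) \<in> rel" using lat_reduction[OF a c] rel_trans by blast
  then have "lat 1 c (- 1 - b1) \<in> C" using I by blast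
  moreover have "c dvd (- 1 - b1)\<^sup>2 + (- 1 - b1) + D"
  proof -
    have "(- 1 - b1)\<^sup>2 + (- 1 - b1) + D = c * a" using c by (simp add: power2_eq_square algebra_simps)
    then show ?thesis by simp
  qed
  ultimately have "P (nat c)" using c0 by (auto simp: P_def)
  then have ac: "a \<le> c" using least[of "nat c"] c0 by (simp add: a_def)
  have "a \<le> int p"
  proof -
    have "(2 * b1 + 1)\<^sup>2 \<le> a\<^sup>2" using bd a by (metis abs_le_square_iff abs_of_pos)
    moreover have "a * a \<le> a * c" using a ac by (intro mult_left_mono) auto
    moreover have "a \<le> a * a" using a by (simp add: mult_le_cancel_left1)
    ultimately show ?thesis using disc by (simp add: power2_eq_square)
  qed
  moreover have "C = rel `` {lat 1 a (b1 mod a)}"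
    using I r1 equiv_class_eq[OF equiv_rel r1] by (simp add: lat_mod)
  ultimately show ?thesis using a by (intro exI[of _ a] exI[of _ "b1 mod a"]) auto
qed

lemma finite_classes: "finite ideal_classes"
proof (rule finite_subset)
  show "ideal_classes \<subseteq> (\<lambda>(a, b). rel `` {lat 1 a b}) ` ({0..int p} \<times> {0..int p})"
  proof
    fix C assume "C \<in> ideal_classes"
    then obtain a b where ab: "0 < a" "a \<le> int p" "0 \<le> b" "b < a" "C = rel `` {lat 1 a b}"
      using class_reduced by blast
    then have "(a, b) \<in> {0..int p} \<times> {0..int p}" by auto
    then show "C \<in> (\<lambda>(a, b). rel `` {lat 1 a b}) ` ({0..int p} \<times> {0..int p})"
      using ab(5) by blast
  qed
qed auto

text \<open>The map \<open>(C, v) \<mapsto> v I\<^sup>-\<^sup>1\<close>, with \<open>I\<close> the representative of \<open>C\<close>, is two-to-one onto the integral ideals.\<close>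

lemma class_count:
  fixes A B :: "complex set set \<Rightarrow> int"
  assumes rep: "\<And>C. C \<in> ideal_classes \<Longrightarrow> A C > 0 \<and> A C dvd (B C)\<^sup>2 + B C + D \<and> lat 1 (A C) (B C) \<in> C"
    and n: "n > 0"
  shows "int (\<Sum>C\<in>ideal_classes. card {v \<in> lat 1 (A C) (B C). v * cnj v = of_int (int n * A C)}) = 2 * root_count D n"
proof -
  define I where "I C = lat 1 (A C) (B C)" for C
  define V where "V = (SIGMA C:ideal_classes. {v \<in> I C. v * cnj v = of_int (int n * A C)})"
  define T where "T = {J. idl J \<and> J \<noteq> {0} \<and> inorm J (int n)}"
  \<comment> \<open>The norm of I C is A C, so this scaled conjugate is v times the inverse of I
    C.\<close>
  define \<Phi> where "\<Phi> = (\<lambda>(C, v). scale (v / of_int (A C)) (cnj ` I C))"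
  have finT: "finite T" and cardT: "int (card T) = root_count D n"
    unfolding T_def using card_ideals_of_norm[OF n] by auto
  have AI: "A C > 0" "idl (I C)" "I C \<noteq> {0}" "inorm (I C) (A C)" "I C \<in> C" if "C \<in> ideal_classes" for C
    using rep[OF that] idl_lat[of "A C" "B C" 1] lat_nonzero[of 1 "A C" "B C"] inorm_lat[of 1 "A C" "B C"]
    by (auto simp: I_def)
  have V: "C \<in> ideal_classes" "v \<in> I C" "v * cnj v = of_int (int n * A C)" "v \<noteq> 0" if "(C, v) \<in> V" for C v
  proof -
    show 1: "C \<in> ideal_classes" "v \<in> I C" "v * cnj v = of_int (int n * A C)" using that by (auto simp: V_def)
    show "v \<noteq> 0" using 1(3) n AI(1)[OF 1(1)] by auto
  qed
  have PhiT: "\<Phi> ` V \<subseteq> T"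
  proof
    fix J assume "J \<in> \<Phi> ` V"
    then obtain C v where Cv: "(C, v) \<in> V" "J = scale (v / of_int (A C)) (cnj ` I C)" by (auto simp: \<Phi>_def)
    note C = AI[OF V(1)[OF Cv(1)]]
    have "inorm J (int n)"
      unfolding Cv(2)
    proof (rule inorm_scale[OF inorm_cnj[OF C(4)]])
      show "v / of_int (A C) \<noteq> 0" using V(4)[OF Cv(1)] C(1) by simp
      have "v / of_int (A C) * cnj (v / of_int (A C)) * of_int (A C) = v * cnj v / of_int (A C)"
        using C(1) by (simp add: field_simps)
      also have "\<dots> = of_int (int n)" using V(3)[OF Cv(1)] C(1) by simp
      finally show "of_int (int n) = v / of_int (A C) * cnj (v / of_int (A C)) * of_int (A C)" by simp
    qed
    then show "J \<in> T"
      unfolding T_def using idl_quotient[OF C(2,4,3) V(2,4)[OF Cv(1)]] Cv(2) by simp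
  qed
  have fibre: "finite {x \<in> V. \<Phi> x = J} \<and> card {x \<in> V. \<Phi> x = J} = 2" if JT: "J \<in> T" for J
  proof -
    have J: "idl J" "J \<noteq> {0}" "inorm J (int n)" using JT by (auto simp: T_def)
    \<comment> \<open>The ideal v times the inverse of I is equivalent to the conjugate of I. So J
      can only come from the class of its own conjugate.\<close>
    define C where "C = rel `` {cnj ` J}"
    have cJ: "cnj ` J \<in> nonzero_ideals R"
      unfolding nonzero_ideals_R using idl_cnj[OF J(1)] J(2) by (simp add: cnj_image_zero_iff)
    have C: "C \<in> ideal_classes" unfolding C_def using cJ by (rule quotientI)
    note IC = AI[OF C]
    have "(cnj ` J, I C) \<in> rel" using IC(5) by (simp add: C_def)
    then have "(cnj ` cnj ` J, cnj ` I C) \<in> rel" by (rule rel_cnj)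
    then have "(J, cnj ` I C) \<in> rel" by simp
    then obtain v where v: "v \<noteq> 0" "J = scale (v / of_int (A C)) (cnj ` I C)"
      by (rule quotient_exists[OF IC(4)])
    have vI: "v \<in> I C" using quotient_mem[OF IC(2,4)] J(1) v(2) by simp
    have nv: "v * cnj v = of_int (int n * A C)"
    proof -
      obtain r where r: "r \<in> OK" "v * cnj v = of_int (A C) * r"
        using IC(4) vI unfolding inorm_def by blast
      obtain x y where xy: "v = elt x y" using idl_sub[OF IC(2) vI] by (auto simp: OK_def)
      define M where "M = x\<^sup>2 + x * y + D * y\<^sup>2"
      have M: "v * cnj v = of_int M" unfolding xy norm_elt M_def ..
      have "r = of_real (of_int M / of_int (A C))" using r(2) M IC(1) by (simp add: field_simps)
      then have "(of_int M / of_int (A C) :: real) \<in> \<int>" using OK_rational_is_int r(1) by metis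
      then obtain q where q: "(of_int M / of_int (A C) :: real) = of_int q" by (auto elim: Ints_cases)
      then have rq: "r = of_int q" using \<open>r = _\<close> by simp
      \<comment> \<open>The quotient q of the norm of v by A C is already known to be an integer. It
        is a norm of J as well, hence equal to n.\<close>
      have "inorm J q" unfolding v(2)
      proof (rule inorm_scale[OF inorm_cnj[OF IC(4)]])
        show "v / of_int (A C) \<noteq> 0" using v(1) IC(1) by simp
        have "v / of_int (A C) * cnj (v / of_int (A C)) * of_int (A C) = v * cnj v / of_int (A C)"
          using IC(1) by (simp add: field_simps)
        also have "\<dots> = of_int q" using r(2) rq IC(1) by simp
        finally show "of_int q = v / of_int (A C) * cnj (v / of_int (A C)) * of_int (A C)" by simp
      qed
      then have "q = int n" using inorm_unique J(3) by blast
      then show ?thesis using r(2) rq by (simp add: mult.commute)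
    qed
    have "{x \<in> V. \<Phi> x = J} = {(C, v), (C, - v)}"
    proof (intro equalityI subsetI)
      fix x assume "x \<in> {x \<in> V. \<Phi> x = J}"
      then obtain C' w where x: "x = (C', w)" "(C', w) \<in> V" "scale (w / of_int (A C')) (cnj ` I C') = J"
        by (cases x) (auto simp: \<Phi>_def)
      note C' = AI[OF V(1)[OF x(2)]]
      have "(J, cnj ` I C') \<in> rel"
        using idl_quotient(3)[OF C'(2,4,3) V(2,4)[OF x(2)]] x(3) by simp
      then have "(cnj ` J, cnj ` cnj ` I C') \<in> rel" by (rule rel_cnj)
      then have "(cnj ` J, I C') \<in> rel" by simp
      then have "I C' \<in> C" by (simp add: C_def)
      then have "C' = C"
        using quotient_disj[OF equiv_rel V(1)[OF x(2)] C] C'(5) by blast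
      then have "w = v \<or> w = - v"
        using quotient_unique[OF IC(2,4) v(1) V(4)[OF x(2)]] x(3) v(2) by simp
      then show "x \<in> {(C, v), (C, - v)}" using x(1) \<open>C' = C\<close> by auto
    next
      have neg: "scale (- v / of_int (A C)) (cnj ` I C) = J"
      proof -
        have "scale (- 1) (cnj ` I C) = cnj ` I C"
        proof -
          have m: "- y \<in> cnj ` I C" if "y \<in> cnj ` I C" for y
            using that idl_minus[OF idl_cnj[OF IC(2)]] by blast
          show ?thesis
          proof (intro equalityI subsetI)
            fix x assume "x \<in> scale (- 1) (cnj ` I C)"
            then obtain y where "y \<in> cnj ` I C" "x = - 1 * y" by blast
            then show "x \<in> cnj ` I C" using m[of y] by simp
          next
            fix x assume "x \<in> cnj ` I C"
            then have "- x \<in> cnj ` I C" by (rule m)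
            then have "- 1 * (- x) \<in> scale (- 1) (cnj ` I C)" by (rule imageI)
            then show "x \<in> scale (- 1) (cnj ` I C)" by simp
          qed
        qed
        then have "scale (v / of_int (A C)) (scale (- 1) (cnj ` I C)) = J" using v(2) by simp
        then show ?thesis unfolding scale_scale by simp
      qed
      fix x assume "x \<in> {(C, v), (C, - v)}"
      then show "x \<in> {x \<in> V. \<Phi> x = J}"
      proof (elim insertE emptyE)
        assume "x = (C, v)"
        then show ?thesis using C vI nv v(2) by (simp add: V_def \<Phi>_def)
      next
        assume "x = (C, - v)"
        then show ?thesis using C idl_minus[OF IC(2) vI] nv neg by (simp add: V_def \<Phi>_def)
      qed
    qed
    moreover have "v \<noteq> - v" using v(1) by simp
    ultimately show ?thesis by simp
  qed
  \<comment> \<open>Finiteness of V comes from the target: finitely many ideals, each with two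
    preimages. It in turn makes the set of vectors in each class finite, as required for counting V
    class by class.\<close>
  have "V \<subseteq> (\<Union>J\<in>T. {x \<in> V. \<Phi> x = J})" using PhiT by blast
  moreover have "finite (\<Union>J\<in>T. {x \<in> V. \<Phi> x = J})" using finT fibre by (intro finite_UN_I) auto
  ultimately have finV: "finite V" by (rule finite_subset)
  have "card V = (\<Sum>J\<in>T. \<Sum>x\<in>{x \<in> V. \<Phi> x = J}. 1)"
    using sum.group[OF finV finT PhiT, of "\<lambda>_. 1::nat"] by simp
  also have "\<dots> = (\<Sum>J\<in>T. 2)" using fibre by (intro sum.cong) auto
  finally have "card V = 2 * card T" by simp
  moreover have "card V = (\<Sum>C\<in>ideal_classes. card {v \<in> I C. v * cnj v = of_int (int n * A C)})"
    unfolding V_def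
  proof (rule card_SigmaI[OF finite_classes], rule ballI)
    fix C assume "C \<in> ideal_classes"
    then have "Pair C ` {v \<in> I C. v * cnj v = of_int (int n * A C)} \<subseteq> V" by (auto simp: V_def)
    then have "finite (Pair C ` {v \<in> I C. v * cnj v = of_int (int n * A C)})"
      using finV finite_subset by blast
    then show "finite {v \<in> I C. v * cnj v = of_int (int n * A C)}"
      by (rule finite_imageD) (simp add: inj_on_def)
  qed
  ultimately show ?thesis using cardT by (simp add: I_def)
qed

text \<open>In the basis a, b + \<omega> the norm is a times the form (a, 2 b + 1, c), which links
  norms of lattice elements to the theta series of that form.\<close>

lemma card_lat_norm:
  assumes a: "a > 0" and c: "b\<^sup>2 + b + D = a * c"
  shows "card {v \<in> lat 1 a b. v * cnj v = of_int (n * a)}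
    = card {(x, y). a * x\<^sup>2 + (2 * b + 1) * x * y + c * y\<^sup>2 = n}"
    (is "card ?V = card ?S")
proof -
  define f where "f = (\<lambda>(x, y). elt (a * x + b * y) y)"
  have D: "D = a * c - b\<^sup>2 - b" using c by simp
  have nf: "f (x, y) * cnj (f (x, y)) = of_int ((a * x\<^sup>2 + (2 * b + 1) * x * y + c * y\<^sup>2) * a)" for x y
    unfolding f_def prod.case norm_elt of_int_eq_iff by (simp add: D power2_eq_square algebra_simps)
  have "bij_betw f ?S ?V"
  proof (rule bij_betw_imageI)
    show "inj_on f ?S"
    proof (rule inj_onI)
      fix u v :: "int \<times> int" assume "f u = f v"
      then have "elt (a * fst u + b * snd u) (snd u) = elt (a * fst v + b * snd v) (snd v)"
        by (simp add: f_def case_prod_beta)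
      then have e: "a * fst u + b * snd u = a * fst v + b * snd v \<and> snd u = snd v"
        by (rule elt_inject[THEN iffD1])
      then have "a * fst u = a * fst v" by auto
      then show "u = v" using a e by (simp add: prod_eq_iff)
    qed
    show "f ` ?S = ?V"
    proof (intro equalityI subsetI)
      fix v assume "v \<in> f ` ?S"
      then obtain x y where xy: "v = f (x, y)" "a * x\<^sup>2 + (2 * b + 1) * x * y + c * y\<^sup>2 = n" by blast
      have "v \<in> lat 1 a b" by (rule latI[of _ _ _ x _ y]) (simp add: xy f_def)
      then show "v \<in> ?V" using nf[of x y] xy by simp
    next
      fix v assume "v \<in> ?V"
      then have v: "v \<in> lat 1 a b" "v * cnj v = of_int (n * a)" by auto
      obtain x y where "v = elt (1 * (a * x + b * y)) (1 * y)" using v(1) by (rule latE)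
      then have vf: "v = f (x, y)" by (simp add: f_def)
      then have "of_int ((a * x\<^sup>2 + (2 * b + 1) * x * y + c * y\<^sup>2) * a) = (of_int (n * a) :: complex)"
        using v(2) nf[of x y] by simp
      then have "(a * x\<^sup>2 + (2 * b + 1) * x * y + c * y\<^sup>2) * a = n * a" by (simp only: of_int_eq_iff)
      then have "a * x\<^sup>2 + (2 * b + 1) * x * y + c * y\<^sup>2 = n" using a by simp
      then show "v \<in> f ` ?S" using vf by blast
    qed
  qed
  then show ?thesis by (rule bij_betw_same_card[symmetric])
qed

end

section \<open>Theta series of all classes and the limit at 0\<close>

lemma has_sum_finite_sum:
  fixes f :: "'a \<Rightarrow> 'b \<Rightarrow> 'c::topological_comm_monoid_add"
  assumes "finite I" "\<And>i. i \<in> I \<Longrightarrow> (f i has_sum s i) X"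
  shows "((\<lambda>x. \<Sum>i\<in>I. f i x) has_sum (\<Sum>i\<in>I. s i)) X"
  using assms by (induction I rule: finite_induct) (auto intro: has_sum_add)

text \<open>Group the lattice points by the value of the form; positivity makes the groups finite.
  The subtracted 1 is the origin, and over all classes these origins add up to h.\<close>

lemma theta_has_sum_representation_numbers:
  fixes a b c :: int and t :: real
  assumes a: "a > 0" and disc: "4 * a * c - b\<^sup>2 > 0" and t: "t > 0"
  shows "((\<lambda>n::nat. real (card {(x, y). a * x\<^sup>2 + b * x * y + c * y\<^sup>2 = int n}) * exp (- t * real n))
    has_sum (theta (of_int a) (of_int b) (of_int c) t - 1)) {1..}"
proof -
  have ra: "real_of_int a > 0" using a by simp
  have rd: "4 * real_of_int a * of_int c - (of_int b)\<^sup>2 > 0"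
  proof -
    have "real_of_int (4 * a * c - b\<^sup>2) > 0" using disc by (simp only: of_int_0_less_iff)
    then show ?thesis by simp
  qed
  define q where "q = (\<lambda>(x, y). a * x\<^sup>2 + b * x * y + c * y\<^sup>2)"
  define g where "g v = exp (- (t * real_of_int (q v)))" for v
  obtain \<mu> :: real where \<mu>: "\<mu> > 0" "\<And>x y. of_int a * x\<^sup>2 + of_int b * x * y + of_int c * y\<^sup>2 \<ge> \<mu> * (x\<^sup>2 + y\<^sup>2)"
    using posdef_form_lower_bound[OF ra rd] by blast
  have qge: "real_of_int (q (x, y)) \<ge> \<mu> * ((of_int x)\<^sup>2 + (of_int y)\<^sup>2)" for x y
    using \<mu>(2)[of "of_int x" "of_int y"] by (simp add: q_def)
  have qpos: "q v > 0" if "v \<noteq> (0, 0)" for v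
  proof -
    obtain x y where v: "v = (x, y)" by (cases v)
    have "(real_of_int x)\<^sup>2 + (of_int y)\<^sup>2 > 0" using that v by (simp add: sum_power2_gt_zero_iff)
    then have "\<mu> * ((real_of_int x)\<^sup>2 + (of_int y)\<^sup>2) > 0" using \<mu>(1) by simp
    then have "real_of_int (q (x, y)) > 0" using qge[of x y] by linarith
    then show ?thesis using v by simp
  qed
  have fin: "finite {v. q v = int n}" for n
  proof -
    define M where "M = \<lceil>real n / \<mu>\<rceil>"
    have bound: "\<bar>z\<bar> \<le> M" if "\<mu> * ((of_int z)\<^sup>2 + w) \<le> real n" "w \<ge> 0" for z :: int and w :: real
    proof -
      have "\<mu> * (of_int z)\<^sup>2 \<le> \<mu> * ((of_int z)\<^sup>2 + w)" using that \<mu>(1) by (intro mult_left_mono) auto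
      then have "\<mu> * (of_int z)\<^sup>2 \<le> real n" using that by linarith
      then have "(of_int z)\<^sup>2 \<le> real n / \<mu>" using \<mu>(1) by (simp add: field_simps)
      moreover have "\<bar>z\<bar> \<le> z\<^sup>2"
      proof (cases "z = 0")
        case False
        then have "\<bar>z\<bar> * 1 \<le> \<bar>z\<bar> * \<bar>z\<bar>" by (intro mult_left_mono) auto
        then show ?thesis by (simp add: power2_eq_square)
      qed simp
      then have "real_of_int \<bar>z\<bar> \<le> (of_int z)\<^sup>2" by (metis of_int_le_iff of_int_power)
      ultimately have "real_of_int \<bar>z\<bar> \<le> real n / \<mu>" by linarith
      then have "real_of_int \<bar>z\<bar> \<le> of_int M" unfolding M_def by linarith
      then show ?thesis by (simp only: of_int_le_iff)
    qed
    have "{v. q v = int n} \<subseteq> {-M..M} \<times> {-M..M}"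
    proof
      fix v assume v: "v \<in> {v. q v = int n}"
      obtain x y where xy: "v = (x, y)" by (cases v)
      have "\<mu> * ((of_int x)\<^sup>2 + (of_int y)\<^sup>2) \<le> real n" using qge[of x y] v xy by simp
      then have "\<bar>x\<bar> \<le> M" "\<bar>y\<bar> \<le> M" using bound[of x "(of_int y)\<^sup>2"] bound[of y "(of_int x)\<^sup>2"]
        by (auto simp: add.commute)
      then show "v \<in> {-M..M} \<times> {-M..M}" using xy by auto
    qed
    then show ?thesis by (rule finite_subset) simp
  qed
  have "(g has_sum theta (of_int a) (of_int b) (of_int c) t) UNIV"
  proof -
    have g_eq: "g = (\<lambda>(x, y). exp (- (t * (of_int a * (of_int x)\<^sup>2 + of_int b * of_int x * of_int y + of_int c * (of_int y)\<^sup>2))))"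
      by (auto simp: g_def q_def)
    show ?thesis using theta_summable[OF ra rd t] unfolding theta_def g_eq by (rule has_sum_infsum)
  qed
  moreover have "(g has_sum 1) {(0, 0)}"
    by (rule has_sum_finiteI) (auto simp: g_def q_def)
  ultimately have "(g has_sum (theta (of_int a) (of_int b) (of_int c) t - 1)) (UNIV - {(0, 0)})"
    by (rule has_sum_Diff) simp
  moreover have "bij_betw (\<lambda>v. (nat (q v), v)) (UNIV - {(0, 0)}) (SIGMA n:{1::nat..}. {v. q v = int n})"
  proof (rule bij_betw_byWitness[where f' = snd])
    show "(\<lambda>v. (nat (q v), v)) ` (UNIV - {(0, 0)}) \<subseteq> (SIGMA n:{1::nat..}. {v. q v = int n})"
      using qpos by (force simp: Suc_le_eq)
    have "v \<noteq> (0, 0)" if "q v = int n" "n \<ge> 1" for v n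
      using that by (auto simp: q_def)
    then show "snd ` (SIGMA n:{1::nat..}. {v. q v = int n}) \<subseteq> UNIV - {(0, 0)}" by force
  qed auto
  ultimately have "((\<lambda>(n, v). g v) has_sum (theta (of_int a) (of_int b) (of_int c) t - 1)) (SIGMA n:{1::nat..}. {v. q v = int n})"
    using has_sum_reindex_bij_betw[of "\<lambda>v. (nat (q v), v)" "UNIV - {(0, 0)}" _ "\<lambda>(n, v). g v"] by simp
  then have "((\<lambda>n. real (card {v. q v = int n}) * exp (- t * real n))
    has_sum (theta (of_int a) (of_int b) (of_int c) t - 1)) {1..}"
    by (rule has_sum_SigmaD) (use fin in \<open>auto intro!: has_sum_finiteI simp: g_def\<close>)
  moreover have "{v. q v = int n} = {(x, y). a * x\<^sup>2 + b * x * y + c * y\<^sup>2 = int n}" for n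
    by (auto simp: q_def)
  ultimately show ?thesis by simp
qed

lemma legendre_neg:
  assumes p: "prime (p::nat)" "p mod 4 = 3"
  shows "Legendre (- x) (int p) = - Legendre x (int p)"
proof -
  have p2: "2 < p" using p by (cases "p = 2") (auto dest: prime_ge_2_nat)
  have "odd ((p - 1) div 2)" using p(2) by presburger
  then have "Legendre (-1) (int p) = -1" using legendre_neg_one[OF p(1) p2] by simp
  then show ?thesis using legendre_mult[OF p(1) p2, of "-1" x] by simp
qed

lemma legendre_complement:
  assumes p: "prime (p::nat)" "p mod 4 = 3" and k: "k \<le> p"
  shows "Legendre (int (p - k)) (int p) = - Legendre (int k) (int p)"
proof -
  have "[int (p - k) = - int k] (mod int p)" using k by (simp add: of_nat_diff cong_iff_dvd_diff)
  then have "Legendre (int (p - k)) (int p) = Legendre (- int k) (int p)" by (rule legendre_cong)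
  then show ?thesis by (simp add: legendre_neg[OF p])
qed

lemma sum_legendre_zero:
  assumes p: "prime (p::nat)" "p mod 4 = 3"
  shows "(\<Sum>k<p. Legendre (int k) (int p)) = 0"
proof -
  have p0: "p > 0" using p prime_gt_0_nat by blast
  have z: "Legendre 0 (int p) = 0" by (simp add: Legendre_def)
  have split: "{..<p} = insert 0 {1..<p}" using p0 by auto
  have "(\<Sum>k\<in>{1..<p}. Legendre (int k) (int p)) = (\<Sum>k\<in>{1..<p}. Legendre (int (p - k)) (int p))"
    by (rule sum.reindex_bij_witness[of _ "\<lambda>k. p - k" "\<lambda>k. p - k"]) auto
  also have "\<dots> = - (\<Sum>k\<in>{1..<p}. Legendre (int k) (int p))"
    unfolding sum_negf[symmetric] by (rule sum.cong[OF refl], rule legendre_complement[OF p]) simp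
  finally have "(\<Sum>k\<in>{1..<p}. Legendre (int k) (int p)) = 0" by simp
  then show ?thesis unfolding split by (simp add: z)
qed

context prime_discriminant
begin

theorem class_number_formula:
  "int p * int (class_number (quadratic_field (- int p))) = - (\<Sum>k<p. int k * Legendre (int k) (int p))"
proof -
  have "\<forall>C\<in>ideal_classes. \<exists>ab. fst ab > 0 \<and> fst ab dvd (snd ab)\<^sup>2 + snd ab + D \<and> lat 1 (fst ab) (snd ab) \<in> C"
    using class_primitive by fastforce
  then obtain ab where ab: "\<forall>C\<in>ideal_classes. fst (ab C) > 0 \<and> fst (ab C) dvd (snd (ab C))\<^sup>2 + snd (ab C) + D
      \<and> lat 1 (fst (ab C)) (snd (ab C)) \<in> C"
    by (rule bchoice[THEN exE])
  define A B where "A C = fst (ab C)" and "B C = snd (ab C)" for C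
  define E where "E C = ((B C)\<^sup>2 + B C + D) div A C" for C
  have rep: "A C > 0 \<and> A C dvd (B C)\<^sup>2 + B C + D \<and> lat 1 (A C) (B C) \<in> C" if "C \<in> ideal_classes" for C
    using ab that by (simp add: A_def B_def)
  have form: "A C > 0" "(B C)\<^sup>2 + B C + D = A C * E C" "4 * A C * E C - (2 * B C + 1)\<^sup>2 > 0" if "C \<in> ideal_classes" for C
  proof -
    show 1: "A C > 0" "(B C)\<^sup>2 + B C + D = A C * E C" using rep[OF that] by (auto simp: E_def)
    show "4 * A C * E C - (2 * B C + 1)\<^sup>2 > 0" using form_pos(1)[OF 1] p_pos by simp
  qed
  define \<theta> where "\<theta> C t = theta (of_int (A C)) (of_int (2 * B C + 1)) (of_int (E C)) t" for C t
  define \<psi> where "\<psi> d = real_of_int (Legendre (int d) (int p))" for d :: nat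
  define L where "L t = (\<Sum>\<^sub>\<infinity>n\<in>{1..}. (\<Sum>d | d dvd n. \<psi> d) * exp (- t * real n))" for t :: real
  define h where "h = card ideal_classes"
  have expand: "(\<Sum>C\<in>ideal_classes. \<theta> C t) = real h + 2 * L t" if t: "t > 0" for t
  proof -
    define r where "r C n = card {(x, y). A C * x\<^sup>2 + (2 * B C + 1) * x * y + E C * y\<^sup>2 = int n}" for C n
    have "((\<lambda>n. \<Sum>C\<in>ideal_classes. real (r C n) * exp (- t * real n)) has_sum (\<Sum>C\<in>ideal_classes. \<theta> C t - 1)) {1..}"
      unfolding r_def \<theta>_def
      by (intro has_sum_finite_sum[OF finite_classes] theta_has_sum_representation_numbers form t)
    also have "?this \<longleftrightarrow> ((\<lambda>n. 2 * ((\<Sum>d | d dvd n. \<psi> d) * exp (- t * real n))) has_sum (\<Sum>C\<in>ideal_classes. \<theta> C t - 1)) {1..}"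
    proof (rule has_sum_cong)
      fix n :: nat assume "n \<in> {1..}"
      then have n: "n > 0" by simp
      have "int (\<Sum>C\<in>ideal_classes. r C n)
        = int (\<Sum>C\<in>ideal_classes. card {v \<in> lat 1 (A C) (B C). v * cnj v = of_int (int n * A C)})"
        unfolding r_def by (intro arg_cong[where f = int] sum.cong refl card_lat_norm[symmetric] form)
      also have "\<dots> = 2 * root_count D n" by (rule class_count[OF rep n])
      also have "root_count D n = (\<Sum>d | d dvd n. Legendre (int d) (int p))"
        by (rule root_count_eq_legendre_sum[OF prime_p p_mod_4 D_def n])
      finally have "real_of_int (int (\<Sum>C\<in>ideal_classes. r C n)) = 2 * (\<Sum>d | d dvd n. \<psi> d)"
        by (simp add: \<psi>_def)
      then have "(\<Sum>C\<in>ideal_classes. real (r C n)) = 2 * (\<Sum>d | d dvd n. \<psi> d)" by simp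
      then show "(\<Sum>C\<in>ideal_classes. real (r C n) * exp (- t * real n)) = 2 * ((\<Sum>d | d dvd n. \<psi> d) * exp (- t * real n))"
        by (simp only: sum_distrib_right[symmetric] mult.assoc)
    qed
    finally have "(\<Sum>C\<in>ideal_classes. \<theta> C t - 1) = 2 * L t"
      unfolding L_def infsum_cmult_right'[symmetric] by (rule infsumI[symmetric])
    then show ?thesis by (simp add: sum_subtractf h_def)
  qed
  have "((\<lambda>t. \<Sum>C\<in>ideal_classes. \<theta> C t - 4 * \<theta> C (4 * t)) \<longlongrightarrow> (\<Sum>C\<in>ideal_classes. 0)) (at_right 0)"
  proof (intro tendsto_sum)
    fix C assume C: "C \<in> ideal_classes"
    show "((\<lambda>t. \<theta> C t - 4 * \<theta> C (4 * t)) \<longlongrightarrow> 0) (at_right 0)"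
      unfolding \<theta>_def
    proof (rule theta_scaling_limit)
      show "real_of_int (A C) > 0" using form[OF C] by simp
      have "real_of_int (4 * A C * E C - (2 * B C + 1)\<^sup>2) > 0" using form(3)[OF C] by (simp only: of_int_0_less_iff)
      then show "4 * real_of_int (A C) * real_of_int (E C) - (real_of_int (2 * B C + 1))\<^sup>2 > 0" by simp
    qed
  qed
  \<comment> \<open>The constants combine to h - 4 h = -3 h, and the limit of the Lambert part
    carries the matching factor 2 * (3/2), so the 3 cancels in the end.\<close>
  moreover have "eventually (\<lambda>t. (\<Sum>C\<in>ideal_classes. \<theta> C t - 4 * \<theta> C (4 * t)) = 2 * (L t - 4 * L (4 * t)) - 3 * real h) (at_right 0)"
    using eventually_at_right_less[of "0::real"]
  proof eventually_elim
    case (elim t)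
    have "(\<Sum>C\<in>ideal_classes. \<theta> C t - 4 * \<theta> C (4 * t)) = (\<Sum>C\<in>ideal_classes. \<theta> C t) - 4 * (\<Sum>C\<in>ideal_classes. \<theta> C (4 * t))"
      by (simp add: sum_subtractf sum_distrib_left)
    then show ?case using expand[OF elim] expand[of "4 * t"] elim by simp
  qed
  ultimately have lim1: "((\<lambda>t. 2 * (L t - 4 * L (4 * t)) - 3 * real h) \<longlongrightarrow> 0) (at_right 0)"
    using Lim_transform_eventually by fastforce
  have "((\<lambda>t. L t - 4 * L (4 * t)) \<longlongrightarrow> - (3 / 2) * (\<Sum>k<p. real k * \<psi> k) / real p) (at_right 0)"
    unfolding L_def
  proof (rule lambert_series_limit)
    show "\<bar>\<psi> n\<bar> \<le> 1" for n using legendre_values[of "int n" "int p"] by (auto simp: \<psi>_def)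
    show "\<psi> 0 = 0" by (simp add: \<psi>_def Legendre_def)
    show "\<psi> (n + p) = \<psi> n" for n
    proof -
      have "[int (n + p) = int n] (mod int p)" by (simp add: cong_iff_dvd_diff)
      then show ?thesis unfolding \<psi>_def by (simp only: legendre_cong)
    qed
    show "p > 0" by (rule p_pos)
    have "(\<Sum>k<p. \<psi> k) = real_of_int (\<Sum>k<p. Legendre (int k) (int p))" by (simp add: \<psi>_def)
    then show "(\<Sum>k<p. \<psi> k) = 0" using sum_legendre_zero[OF prime_p p_mod_4] by simp
  qed
  then have lim2: "((\<lambda>t. 2 * (L t - 4 * L (4 * t)) - 3 * real h) \<longlongrightarrow>
      2 * (- (3 / 2) * (\<Sum>k<p. real k * \<psi> k) / real p) - 3 * real h) (at_right 0)"
    by (intro tendsto_intros)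
  define T where "T = (\<Sum>k<p. real k * \<psi> k)"
  have "2 * (- (3 / 2) * T / real p) - 3 * real h = 0"
    unfolding T_def by (rule tendsto_unique[OF _ lim2 lim1]) simp
  then have "real p * real h = - T"
    using p_pos by (simp add: divide_simps)
  also have "- T = - (\<Sum>k<p. real k * \<psi> k)" by (simp only: T_def)
  also have "\<dots> = real_of_int (- (\<Sum>k<p. int k * Legendre (int k) (int p)))"
    by (simp add: \<psi>_def)
  finally have "real_of_int (int p * int h) = real_of_int (- (\<Sum>k<p. int k * Legendre (int k) (int p)))"
    by simp
  then show ?thesis unfolding class_number_eq h_def by (simp only: of_int_eq_iff)
qed

end

section \<open>The sign of the permutation\<close>

definition inversions :: "'a::linorder set \<Rightarrow> ('a \<Rightarrow> 'a) \<Rightarrow> ('a \<times> 'a) set" where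
  "inversions S f = {(x, y) \<in> S \<times> S. x < y \<and> f y < f x}"

text \<open>The parity is a product of signs over pairs x < y. Multiplied by the sign of the pair
  itself, the sign of its image under f is symmetric in the pair, so this product runs over
  unordered pairs, which g permutes.\<close>

lemma inversions_parity_comp:
  fixes S :: "'a::linorder set"
  assumes fin: "finite S" and f: "f permutes S" and g: "g permutes S"
  shows "(-1::int) ^ card (inversions S (f \<circ> g)) = (-1) ^ card (inversions S f) * (-1) ^ card (inversions S g)"
proof -
  define P where "P = {(x, y) \<in> S \<times> S. x < y}"
  have finP: "finite P" using fin by (auto simp: P_def intro: finite_subset[of _ "S \<times> S"])
  define s :: "'a \<Rightarrow> 'a \<Rightarrow> int" where "s x y = (if y < x then -1 else 1)" for x y
  have ss: "s x y * s x y = 1" for x y by (simp add: s_def)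
  have parity: "(-1::int) ^ card (inversions S h) = (\<Prod>(x, y)\<in>P. s (h x) (h y))" for h
  proof -
    have "(\<Prod>(x, y)\<in>P. s (h x) (h y)) = (\<Prod>v\<in>P. if v \<in> inversions S h then -1 else 1)"
      by (rule prod.cong) (auto simp: P_def s_def inversions_def split: if_splits)
    also have "\<dots> = (\<Prod>v\<in>inversions S h. -1)"
      by (subst prod.inter_restrict[OF finP, symmetric])
        (rule prod.cong, auto simp: P_def inversions_def)
    finally show ?thesis by simp
  qed
  define F where "F = (\<lambda>(x, y). s (f x) (f y) * s x y)"
  have injf: "inj f" and injg: "inj g" using f g by (auto simp: permutes_inj)
  have sym: "F (x, y) = F (y, x)" if "x \<noteq> y" for x y
    using that injD[OF injf, of x y] by (auto simp: F_def s_def)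
  \<comment> \<open>The action of g on unordered pairs, each represented by its increasing
    ordering.\<close>
  define \<pi> where "\<pi> = (\<lambda>(x, y). if g x < g y then (g x, g y) else (g y, g x))"
  have inj: "inj_on \<pi> P"
  proof (rule inj_onI)
    fix u v assume "u \<in> P" "v \<in> P" "\<pi> u = \<pi> v"
    then show "u = v"
      by (cases u, cases v) (auto simp: \<pi>_def P_def inj_eq[OF injg] split: if_splits)
  qed
  have im: "\<pi> ` P \<subseteq> P"
  proof
    fix v assume "v \<in> \<pi> ` P"
    then obtain x y where xy: "x \<in> S" "y \<in> S" "x < y" "v = \<pi> (x, y)" by (auto simp: P_def)
    then have "g x \<in> S" "g y \<in> S" "g x \<noteq> g y"
      using g injD[OF injg, of x y] by (auto simp: permutes_in_image)
    then show "v \<in> P" using xy(4) by (auto simp: P_def \<pi>_def)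
  qed
  have bij: "\<pi> ` P = P" using inj im finP by (simp add: endo_inj_surj)
  have "(\<Prod>(x, y)\<in>P. F (g x, g y)) = (\<Prod>v\<in>P. F (\<pi> v))"
  proof (rule prod.cong, goal_cases)
    case (2 v)
    then obtain x y where v: "v = (x, y)" "x < y" by (auto simp: P_def)
    then have "g x \<noteq> g y" using injD[OF injg, of x y] by auto
    then show ?case using v sym[of "g x" "g y"] by (auto simp: \<pi>_def)
  qed simp
  also have "\<dots> = (\<Prod>v\<in>\<pi> ` P. F v)" by (simp add: prod.reindex[OF inj])
  also have "\<dots> = (\<Prod>(x, y)\<in>P. s (f x) (f y))"
    unfolding bij by (rule prod.cong) (auto simp: F_def s_def P_def)
  finally have key: "(\<Prod>(x, y)\<in>P. F (g x, g y)) = (\<Prod>(x, y)\<in>P. s (f x) (f y))" .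
  have "(\<Prod>(x, y)\<in>P. s ((f \<circ> g) x) ((f \<circ> g) y)) = (\<Prod>(x, y)\<in>P. F (g x, g y)) * (\<Prod>(x, y)\<in>P. s (g x) (g y))"
    by (subst prod.distrib[symmetric], rule prod.cong) (auto simp: F_def mult.assoc ss)
  then show ?thesis unfolding parity key .
qed

text \<open>Besides (a, b) itself, every element strictly between contributes two inversions, one
  with a and one with b.\<close>

lemma inversions_transpose_parity:
  fixes S :: "'a::linorder set"
  assumes fin: "finite S" and ab: "a \<in> S" "b \<in> S" "a < b"
  shows "(-1::int) ^ card (inversions S (Transposition.transpose a b)) = -1"
proof -
  define M where "M = {c \<in> S. a < c \<and> c < b}"
  have finM: "finite M" using fin by (simp add: M_def)
  have "inversions S (Transposition.transpose a b) = insert (a, b) (Pair a ` M \<union> (\<lambda>c. (c, b)) ` M)"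
    using ab by (auto simp: inversions_def M_def Transposition.transpose_def split: if_splits)
  moreover have "card (Pair a ` M \<union> (\<lambda>c. (c, b)) ` M) = card M + card M"
    using finM by (subst card_Un_disjoint) (auto simp: card_image inj_on_def M_def)
  moreover have "(a, b) \<notin> Pair a ` M \<union> (\<lambda>c. (c, b)) ` M" by (auto simp: M_def)
  ultimately have "card (inversions S (Transposition.transpose a b)) = Suc (card M + card M)"
    using finM by simp
  then show ?thesis by simp
qed

lemma sign_eq_inversions:
  fixes S :: "'a::linorder set"
  assumes f: "f permutes S" and fin: "finite S"
  shows "sign f = (-1) ^ card (inversions S f)"
  using f fin
proof (induction rule: permutes_induct)
  case id
  have "inversions S id = {}" by (auto simp: inversions_def)
  then show ?case by (simp only: sign_id card.empty power_0)
next
  case (swap a b f)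
  note fS = \<open>f permutes S\<close>
  have perm: "permutation f" using fS fin permutation_permutes by blast
  have t: "Transposition.transpose a b permutes S" using swap by (simp add: permutes_swap_id)
  have tp: "(-1::int) ^ card (inversions S (Transposition.transpose a b)) = -1"
  proof (cases "a < b")
    case True
    then show ?thesis using inversions_transpose_parity[OF fin] swap by blast
  next
    case False
    then have "b < a" using swap by simp
    then show ?thesis using inversions_transpose_parity[OF fin] swap by (metis transpose_commute)
  qed
  have "sign (Transposition.transpose a b) = -1" using \<open>a \<noteq> b\<close> by (simp add: sign_swap_id)
  then show ?case
    unfolding sign_compose[OF permutation_swap_id perm] inversions_parity_comp[OF fin t fS] tp
    using \<open>sign f = _\<close> by simp
qed

section \<open>Half and quarter sums of the Legendre symbol\<close>

lemma sum_even_odd: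
  fixes g :: "nat \<Rightarrow> 'a::comm_monoid_add"
  assumes "finite A"
  shows "sum g A = sum g {k \<in> A. even k} + sum g {k \<in> A. odd k}"
proof -
  have "sum g ({k \<in> A. even k} \<union> {k \<in> A. odd k}) = sum g {k \<in> A. even k} + sum g {k \<in> A. odd k}"
    by (rule sum.union_disjoint) (use assms in auto)
  moreover have "{k \<in> A. even k} \<union> {k \<in> A. odd k} = A" by blast
  ultimately show ?thesis by simp
qed

text \<open>Two pairings of the nonzero residues modulo p = 2 m + 1: j with p - j, and 2 j with p -
  2 j. Comparing them produces relations between sums of Legendre symbols.\<close>

lemma sum_odd_split:
  fixes g :: "nat \<Rightarrow> 'a::comm_monoid_add"
  shows "(\<Sum>k\<in>{1..<2 * m + 1}. g k) = (\<Sum>j\<in>{1..m}. g j + g (2 * m + 1 - j))"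
    and "(\<Sum>k\<in>{1..<2 * m + 1}. g k) = (\<Sum>j\<in>{1..m}. g (2 * j) + g (2 * m + 1 - 2 * j))"
proof -
  have "(\<Sum>k\<in>{1..<2 * m + 1}. g k) = (\<Sum>k\<in>{1..m}. g k) + (\<Sum>k\<in>{m + 1..2 * m}. g k)"
  proof -
    have "{1..<2 * m + 1} = {1..m} \<union> {m + 1..2 * m}" by auto
    then show ?thesis by (simp add: sum.union_disjoint)
  qed
  also have "(\<Sum>k\<in>{m + 1..2 * m}. g k) = (\<Sum>j\<in>{1..m}. g (2 * m + 1 - j))"
    by (rule sum.reindex_bij_witness[of _ "\<lambda>j. 2 * m + 1 - j" "\<lambda>j. 2 * m + 1 - j"]) auto
  finally show "(\<Sum>k\<in>{1..<2 * m + 1}. g k) = (\<Sum>j\<in>{1..m}. g j + g (2 * m + 1 - j))"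
    by (simp add: sum.distrib)
  have "(\<Sum>k\<in>{1..<2 * m + 1}. g k) = (\<Sum>k\<in>{k \<in> {1..<2 * m + 1}. even k}. g k) + (\<Sum>k\<in>{k \<in> {1..<2 * m + 1}. odd k}. g k)"
    by (rule sum_even_odd) simp
  also have "(\<Sum>k\<in>{k \<in> {1..<2 * m + 1}. even k}. g k) = (\<Sum>j\<in>{1..m}. g (2 * j))"
    by (rule sum.reindex_bij_witness[of _ "\<lambda>j. 2 * j" "\<lambda>k. k div 2"]) auto
  also have "(\<Sum>k\<in>{k \<in> {1..<2 * m + 1}. odd k}. g k) = (\<Sum>j\<in>{1..m}. g (2 * m + 1 - 2 * j))"
    by (rule sum.reindex_bij_witness[of _ "\<lambda>j. 2 * m + 1 - 2 * j" "\<lambda>k. (2 * m + 1 - k) div 2"])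
      (auto, presburger+)
  finally show "(\<Sum>k\<in>{1..<2 * m + 1}. g k) = (\<Sum>j\<in>{1..m}. g (2 * j) + g (2 * m + 1 - 2 * j))"
    by (simp add: sum.distrib)
qed

text \<open>Let T be the full moment, and U and S the moment and the sum over the lower half. The
  symbol of 2 is 1, so the two pairings give T = 2 U - p S and T = 4 U - p S; hence U = 0.\<close>

lemma legendre_first_moment:
  fixes p m :: nat
  assumes p: "prime p" "p mod 8 = 7" and m: "p = 2 * m + 1"
  shows "(\<Sum>k<p. int k * Legendre (int k) (int p)) = - int p * (\<Sum>k\<in>{1..m}. Legendre (int k) (int p))"
proof -
  have p4: "p mod 4 = 3" using p(2) by presburger
  have p2: "2 < p" using p by (cases "p = 2") (auto dest: prime_ge_2_nat)
  define S where "S = (\<Sum>k\<in>{1..m}. Legendre (int k) (int p))"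
  define U where "U = (\<Sum>k\<in>{1..m}. int k * Legendre (int k) (int p))"
  define T where "T = (\<Sum>k<p. int k * Legendre (int k) (int p))"
  have T: "T = (\<Sum>k\<in>{1..<2 * m + 1}. int k * Legendre (int k) (int p))"
    unfolding T_def m by (rule sum.mono_neutral_right) (auto simp: Suc_le_eq)
  have two: "Legendre 2 (int p) = 1" using legendre_two[OF p(1) p4] p(2) by simp
  have dbl: "Legendre (int (2 * j)) (int p) = Legendre (int j) (int p)" for j
    using legendre_mult[OF p(1) p2, of 2 "int j"] two by simp
  have 1: "T = 2 * U - int p * S"
  proof -
    have "T = (\<Sum>j\<in>{1..m}. int j * Legendre (int j) (int p) + int (p - j) * Legendre (int (p - j)) (int p))"
      unfolding T sum_odd_split(1) m ..
    also have "\<dots> = (\<Sum>j\<in>{1..m}. 2 * (int j * Legendre (int j) (int p)) - int p * Legendre (int j) (int p))"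
    proof (rule sum.cong)
      fix j assume "j \<in> {1..m}"
      then have j: "j \<le> p" using m by auto
      show "int j * Legendre (int j) (int p) + int (p - j) * Legendre (int (p - j)) (int p)
        = 2 * (int j * Legendre (int j) (int p)) - int p * Legendre (int j) (int p)"
        unfolding legendre_complement[OF p(1) p4 j] using j by (simp add: of_nat_diff algebra_simps)
    qed simp
    finally show ?thesis by (simp add: sum_subtractf sum_distrib_left U_def S_def)
  qed
  have 2: "T = 4 * U - int p * S"
  proof -
    have "T = (\<Sum>j\<in>{1..m}. int (2 * j) * Legendre (int (2 * j)) (int p) + int (p - 2 * j) * Legendre (int (p - 2 * j)) (int p))"
      unfolding T sum_odd_split(2) m ..
    also have "\<dots> = (\<Sum>j\<in>{1..m}. 4 * (int j * Legendre (int j) (int p)) - int p * Legendre (int j) (int p))"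
    proof (rule sum.cong)
      fix j assume "j \<in> {1..m}"
      then have j: "2 * j \<le> p" using m by auto
      show "int (2 * j) * Legendre (int (2 * j)) (int p) + int (p - 2 * j) * Legendre (int (p - 2 * j)) (int p)
        = 4 * (int j * Legendre (int j) (int p)) - int p * Legendre (int j) (int p)"
        unfolding legendre_complement[OF p(1) p4 j] dbl using j by (simp add: of_nat_diff algebra_simps)
    qed simp
    finally show ?thesis by (simp add: sum_subtractf sum_distrib_left U_def S_def)
  qed
  from 1 2 show ?thesis unfolding T_def[symmetric] S_def[symmetric] by simp
qed

text \<open>Sort the sum over the lower half by parity. Even numbers are doubles from the lowest
  quarter, and an odd number is p minus a double from the next quarter, which brings a sign. The
  relation forces B = 0 if the symbol of 2 is 1, and A = 0 if it is -1.\<close>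

lemma legendre_quarter_sums:
  fixes p M :: nat
  assumes p: "prime p" and M: "p = 4 * M + 3"
  defines "A \<equiv> \<Sum>k\<in>{1..M}. Legendre (int k) (int p)"
    and "B \<equiv> \<Sum>k\<in>{M + 1..2 * M + 1}. Legendre (int k) (int p)"
  shows "A + B = Legendre 2 (int p) * (A - B)"
    and "(\<Sum>k\<in>{1..2 * M + 1}. Legendre (int k) (int p)) = A + B"
proof -
  have p4: "p mod 4 = 3" using M by presburger
  have p2: "2 < p" using M by simp
  have dbl: "Legendre (int (2 * j)) (int p) = Legendre 2 (int p) * Legendre (int j) (int p)" for j
    using legendre_mult[OF p p2, of 2 "int j"] by simp
  let ?g = "\<lambda>k. Legendre (int k) (int p)"
  have "{1..2 * M + 1} = {1..M} \<union> {M + 1..2 * M + 1}" by auto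
  then show S: "(\<Sum>k\<in>{1..2 * M + 1}. ?g k) = A + B"
    unfolding A_def B_def by (simp add: sum.union_disjoint)
  have "(\<Sum>k\<in>{1..2 * M + 1}. ?g k) = (\<Sum>k\<in>{k \<in> {1..2 * M + 1}. even k}. ?g k) + (\<Sum>k\<in>{k \<in> {1..2 * M + 1}. odd k}. ?g k)"
    by (rule sum_even_odd) simp
  also have "(\<Sum>k\<in>{k \<in> {1..2 * M + 1}. even k}. ?g k) = (\<Sum>j\<in>{1..M}. ?g (2 * j))"
    by (rule sum.reindex_bij_witness[of _ "\<lambda>j. 2 * j" "\<lambda>k. k div 2"]) auto
  also have "\<dots> = Legendre 2 (int p) * A"
    unfolding dbl A_def sum_distrib_left ..
  also have "(\<Sum>k\<in>{k \<in> {1..2 * M + 1}. odd k}. ?g k) = (\<Sum>j\<in>{M + 1..2 * M + 1}. ?g (p - 2 * j))"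
  proof (rule sum.reindex_bij_witness[of _ "\<lambda>j. p - 2 * j" "\<lambda>k. (p - k) div 2"])
    fix k assume "k \<in> {k \<in> {1..2 * M + 1}. odd k}"
    then have k: "1 \<le> k" "k \<le> 2 * M + 1" "odd k" by auto
    show e: "p - 2 * ((p - k) div 2) = k" using k M by presburger
    show "(p - k) div 2 \<in> {M + 1..2 * M + 1}" unfolding atLeastAtMost_iff using k M by presburger
    show "?g (p - 2 * ((p - k) div 2)) = ?g k" unfolding e ..
  qed (auto simp: M)
  also have "\<dots> = (\<Sum>j\<in>{M + 1..2 * M + 1}. - (Legendre 2 (int p) * ?g j))"
  proof (rule sum.cong)
    fix j assume "j \<in> {M + 1..2 * M + 1}"
    then have "2 * j \<le> p" using M by auto
    then show "?g (p - 2 * j) = - (Legendre 2 (int p) * ?g j)"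
      using legendre_complement[OF p p4, of "2 * j"] dbl[of j] by (simp only:)
  qed simp
  also have "\<dots> = - (Legendre 2 (int p) * B)"
    unfolding B_def sum_distrib_left sum_negf ..
  finally show "A + B = Legendre 2 (int p) * (A - B)" unfolding S by (simp add: algebra_simps)
qed

lemma sum_signs_card:
  fixes f :: "'a \<Rightarrow> int"
  assumes "finite J" "\<And>j. j \<in> J \<Longrightarrow> f j = 1 \<or> f j = -1"
  shows "(\<Sum>j\<in>J. f j) = int (card J) - 2 * int (card {j \<in> J. f j = -1})"
proof -
  have "(\<Sum>j\<in>J. f j) = (\<Sum>j\<in>J. 1 - 2 * (if f j = -1 then 1 else 0))"
    by (rule sum.cong) (use assms(2) in auto)
  also have "\<dots> = int (card J) - 2 * (\<Sum>j\<in>J. if f j = -1 then 1 else 0)"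
    by (simp add: sum_subtractf sum_distrib_left)
  also have "(\<Sum>j\<in>J. if f j = -1 then 1 else 0) = int (card {j \<in> J. f j = -1})"
    using assms(1) by (simp add: sum.If_cases Int_def)
  finally show ?thesis .
qed

section \<open>Inversions of the residue permutation\<close>

lemma legendre_sign:
  assumes "0 < k" "k < p"
  shows "Legendre (int k) (int p) = 1 \<or> Legendre (int k) (int p) = -1"
proof -
  have "\<not> int p dvd int k" using assms by (auto dest: dvd_imp_le)
  then show ?thesis by (auto simp: Legendre_def cong_0_iff)
qed

text \<open>The value at \<open>a k\<close> is k or p - k, the latter exactly for non-residues, and
  k \<le> m < p - k. So a non-residue i forms an inversion with every later j, and a residue with
  none. This gives m - i inversions for each non-residue i; as m is odd, only even i affect the
  parity.\<close>

lemma residue_permutation_sign: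
  fixes p m :: nat and a :: "nat \<Rightarrow> int" and \<sigma> :: "int \<Rightarrow> int"
  assumes p: "p = 2 * m + 1" and m: "odd m"
    and a: "strict_mono_on {1..m} a"
    and perm: "\<sigma> permutes a ` {1..m}"
    and \<sigma>: "\<And>k. k \<in> {1..m} \<Longrightarrow> \<sigma> (a k) = (int k * Legendre (int k) (int p)) mod int p"
  shows "sign \<sigma> = (-1) ^ card {j \<in> {1..m div 2}. Legendre (int (2 * j)) (int p) = -1}"
proof -
  define N where "N = {i \<in> {1..m}. Legendre (int i) (int p) = -1}"
  have finN: "finite N" by (simp add: N_def)
  have val: "\<sigma> (a k) = (if k \<in> N then int p - int k else int k)" if k: "k \<in> {1..m}" for k
  proof (cases "k \<in> N")
    case True
    have "(- int k) mod int p = (int p - int k) mod int p"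
      by (metis minus_mod_self1 uminus_add_conv_diff add.commute diff_0 mod_add_self1)
    also have "\<dots> = int p - int k" using k p by (intro mod_pos_pos_trivial) auto
    finally show ?thesis using True \<sigma>[OF k] by (simp add: N_def)
  next
    case False
    then have "Legendre (int k) (int p) = 1" using legendre_sign[of k p] k p by (auto simp: N_def)
    then show ?thesis using False \<sigma>[OF k] k p by simp
  qed
  have less: "a i < a j \<longleftrightarrow> i < j" if "i \<in> {1..m}" "j \<in> {1..m}" for i j
    using strict_mono_on_less[OF a that] .
  have inj: "inj_on a {1..m}" using a by (rule strict_mono_on_imp_inj_on)
  have inv: "inversions (a ` {1..m}) \<sigma> = (\<lambda>(i, j). (a i, a j)) ` (SIGMA i:N. {i<..m})"
  proof (intro equalityI subsetI)
    fix v assume "v \<in> inversions (a ` {1..m}) \<sigma>"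
    then obtain i j where ij: "i \<in> {1..m}" "j \<in> {1..m}" "v = (a i, a j)" "a i < a j" "\<sigma> (a j) < \<sigma> (a i)"
      by (auto simp: inversions_def)
    then have "i < j" using less by blast
    moreover have "i \<in> N"
    proof (rule ccontr)
      assume "i \<notin> N"
      then have "\<sigma> (a i) = int i" using val[OF ij(1)] by simp
      moreover have "\<sigma> (a j) \<ge> int i" using val[OF ij(2)] \<open>i < j\<close> ij p by (auto split: if_splits)
      ultimately show False using ij(5) by simp
    qed
    ultimately show "v \<in> (\<lambda>(i, j). (a i, a j)) ` (SIGMA i:N. {i<..m})" using ij by auto
  next
    fix v assume "v \<in> (\<lambda>(i, j). (a i, a j)) ` (SIGMA i:N. {i<..m})"
    then obtain i j where ij: "i \<in> N" "i < j" "j \<le> m" "v = (a i, a j)" by auto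
    then have m: "i \<in> {1..m}" "j \<in> {1..m}" by (auto simp: N_def)
    have "\<sigma> (a i) = int p - int i" using val[OF m(1)] ij by simp
    moreover have "\<sigma> (a j) < int p - int i" using val[OF m(2)] ij p by (auto split: if_splits)
    ultimately show "v \<in> inversions (a ` {1..m}) \<sigma>" using ij m less by (auto simp: inversions_def)
  qed
  have "inj_on (\<lambda>(i, j). (a i, a j)) (SIGMA i:N. {i<..m})"
  proof (rule inj_onI)
    fix u v assume uv: "u \<in> (SIGMA i:N. {i<..m})" "v \<in> (SIGMA i:N. {i<..m})"
      "(\<lambda>(i, j). (a i, a j)) u = (\<lambda>(i, j). (a i, a j)) v"
    then have "fst u \<in> {1..m}" "snd u \<in> {1..m}" "fst v \<in> {1..m}" "snd v \<in> {1..m}"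
      by (auto simp: N_def)
    moreover have "a (fst u) = a (fst v)" "a (snd u) = a (snd v)" using uv(3) by (auto simp: case_prod_beta)
    ultimately show "u = v" using inj by (auto simp: prod_eq_iff dest: inj_onD)
  qed
  then have "card (inversions (a ` {1..m}) \<sigma>) = card (SIGMA i:N. {i<..m})"
    unfolding inv by (rule card_image)
  also have "\<dots> = (\<Sum>i\<in>N. m - i)" using finN by (simp add: card_SigmaI)
  finally have "sign \<sigma> = (-1) ^ (\<Sum>i\<in>N. m - i)"
    using sign_eq_inversions[OF perm] by simp
  also have "\<dots> = (\<Prod>i\<in>N. (-1) ^ (m - i))" by (rule power_sum)
  also have "\<dots> = (\<Prod>i\<in>N. if i \<in> {i. even i} then -1 else 1)"
  proof (rule prod.cong)
    fix i assume "i \<in> N"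
    then have "i \<le> m" by (simp add: N_def)
    then have "even (m - i) \<longleftrightarrow> odd i" using m by simp
    then show "(-1::int) ^ (m - i) = (if i \<in> {i. even i} then -1 else 1)"
      unfolding minus_one_power_iff by (simp only: mem_Collect_eq if_not_P split: if_split) simp
  qed simp
  also have "\<dots> = (-1) ^ card (N \<inter> {i. even i})"
    by (subst prod.inter_restrict[OF finN, symmetric]) simp
  also have "card (N \<inter> {i. even i}) = card {j \<in> {1..m div 2}. Legendre (int (2 * j)) (int p) = -1}"
  proof -
    have "N \<inter> {i. even i} = (\<lambda>j. 2 * j) ` {j \<in> {1..m div 2}. Legendre (int (2 * j)) (int p) = -1}"
      by (auto simp: N_def elim!: evenE)
    then show ?thesis by (simp add: card_image inj_on_def)
  qed
  finally show ?thesis .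
qed

theorem theorem1p4:
  fixes p m :: nat and a c :: "nat \<Rightarrow> int" and \<sigma> :: "int \<Rightarrow> int"
  assumes "prime p" and "p mod 4 = 3" and "m = (p - 1) div 2"
    and "strict_mono_on {1..m} a"
    and "a ` {1..m} = {x \<in> {1..int p - 1}. QuadRes (int p) x}"
    and "\<forall>k \<in> {1..m}. c k = (int k * Legendre (int k) (int p)) mod int p"
    and "\<sigma> permutes a ` {1..m}"
    and "\<forall>k \<in> {1..m}. \<sigma> (a k) = c k"
  shows "(p mod 8 = 3 \<longrightarrow> sign \<sigma> = (-1) ^ ((p + 1) div 8)) \<and>
         (p mod 8 = 7 \<longrightarrow>
            sign \<sigma> = (-1) ^ ((p + 1) div 8 +
                             (class_number (quadratic_field (- int p)) + 1) div 2))"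
proof -
  note p = assms(1,2)
  define M where "M = m div 2"
  have pm: "p = 2 * m + 1" and odd_m: "odd m" and mM: "m = 2 * M + 1" and pM: "p = 4 * M + 3"
    using assms(2,3) unfolding M_def by presburger+
  have p2: "2 < p" using pM by simp
  define A where "A = (\<Sum>k\<in>{1..M}. Legendre (int k) (int p))"
  define B where "B = (\<Sum>k\<in>{M + 1..2 * M + 1}. Legendre (int k) (int p))"
  note AB = legendre_quarter_sums[OF p(1) pM, folded A_def B_def]
  define w where "w = card {j \<in> {1..M}. Legendre (int (2 * j)) (int p) = -1}"
  have sgn: "sign \<sigma> = (-1) ^ w"
    unfolding w_def M_def
    by (rule residue_permutation_sign[OF pm odd_m assms(4,7)]) (use assms(6,8) in simp)
  have "(\<Sum>j\<in>{1..M}. Legendre (int (2 * j)) (int p)) = int (card {1..M}) - 2 * int w"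
    unfolding w_def
  proof (rule sum_signs_card)
    fix j assume "j \<in> {1..M}"
    then show "Legendre (int (2 * j)) (int p) = 1 \<or> Legendre (int (2 * j)) (int p) = -1"
      by (intro legendre_sign) (auto simp: pM)
  qed simp
  \<comment> \<open>The symbols of the even numbers below p/2 add up to the number of these, M,
    minus twice the non-residues among them, and also to the symbol of 2 times A. This expresses w
    through A.\<close>
  moreover have "(\<Sum>j\<in>{1..M}. Legendre (int (2 * j)) (int p)) = Legendre 2 (int p) * A"
    unfolding A_def sum_distrib_left using legendre_mult[OF p(1) p2] by simp
  ultimately have w: "2 * int w = int M - Legendre 2 (int p) * A" by simp
  have "sign \<sigma> = (-1) ^ ((p + 1) div 8)" if p8: "p mod 8 = 3"
  proof -
    have "Legendre 2 (int p) = -1" using legendre_two[OF p] p8 by simp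
    \<comment> \<open>The symbol of 2 is -1, so the quarter sum A vanishes and w = M/2 = (p -
      3)/8.\<close>
    then have "2 * int w = int M" using AB(1) w by simp
    then have "w = (p + 1) div 8" using pM p8 by presburger
    then show ?thesis using sgn by simp
  qed
  moreover have "sign \<sigma> = (-1) ^ ((p + 1) div 8 + (class_number (quadratic_field (- int p)) + 1) div 2)"
    if p8: "p mod 8 = 7"
  proof -
    interpret prime_discriminant p
      using p p8 p2 by unfold_locales (auto simp: less_le)
    define h where "h = class_number (quadratic_field (- int p))"
    have "Legendre 2 (int p) = 1" using legendre_two[OF p] p8 by simp
    then have "2 * int w = int M - A" "B = 0" using AB(1) w by simp_all
    \<comment> \<open>The class number equals the sum over the lower half, A + B, and B vanishes
      here. So h takes the place of A in the formula for w, giving 2 w + h = M.\<close>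
    moreover have "int p * int h = int p * (A + B)"
      unfolding h_def class_number_formula legendre_first_moment[OF p(1) p8 pm]
      using AB(2) mM by simp
    then have "int h = A + B" using p2 by simp
    ultimately have "2 * w + h = M" by simp
    moreover obtain t where t: "p = 8 * t + 7" using p8 by (metis mult_div_mod_eq)
    then have "M = 2 * t + 1" using pM by simp
    ultimately have hw: "2 * w + h = 2 * t + 1" by simp
    then have "odd h" by presburger
    then obtain s where s: "h = 2 * s + 1" by (rule oddE)
    have "(p + 1) div 8 = t + 1" "(h + 1) div 2 = s + 1" using t s by simp_all
    moreover have "w + s = t" using hw s by simp
    \<comment> \<open>With p = 8 t + 7 and h = 2 s + 1, M = 2 t + 1 gives w + s = t. The claimed
      exponent t + 1 + s + 1 therefore differs from w by the even number 2 (s + 1).\<close>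
    ultimately have "(p + 1) div 8 + (h + 1) div 2 = w + 2 * (s + 1)" by simp
    then show ?thesis unfolding sgn h_def[symmetric] by (simp add: power_add)
  qed
  ultimately show ?thesis by blast
qed

end
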